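(* Let $m_1,\dots,m_{2n}$ be positive integers and fix $\delta_0>0$. Let $R=(R_1,\dots,R_n)$ be a map with values in $\mathbb{C}^n$, defined and of class $C^1$ in $D(\delta_0)$. Suppose that there is a constant $0<c<1$ such that (i) $|R(z)-R(\xi)|\le c\left(\sum_{j=1}^n\left|z_j^{m_{n+j}}-\xi_j^{m_{n+j}}\right|^2\right)^{1/2}$ for all $z=(z_1,\dots,z_n),\ \xi=(\xi_1,\dots,\xi_n)\in D(\delta_0)$; (ii) $R_j(z)=o(|z_j|^{m_{n+j}})$ as $z_j\to0$, for all $j=1,\dots,n$. Then there exists $\delta$ with $0<\delta<\delta_0$ such that for $$K:=\{(z_1^{m_1},\dots,z_n^{m_n},\ \bar{z}_1^{\,m_{n+1}}+R_1(z),\dots,\bar{z}_n^{\,m_{2n}}+R_n(z)):z\in\overline{D(\delta)}\}\subset\mathbb{C}^{2n}$$ one has $\mathcal{P}(K)=\mathcal{C}(K)$. Furthermore, if $\gcd(m_i,m_j)=1$ for all $i\neq j$, then $$[z_1^{m_1},\dots,z_n^{m_n},\ \bar{z}_1^{\,m_{n+1}}+R_1(z),\dots,\bar{z}_n^{\,m_{2n}}+R_n(z);\ \overline{D(\delta)}]=\mathcal{C}(\overline{D(\delta)}).$$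
   Context: For $\delta>0$, $D(\delta):=\{z\in\mathbb{C}^n:|z_j|<\delta,\ j=1,\dots,n\}$. $|\cdot|$ on $\mathbb{C}^n$ is the Euclidean norm. Condition (ii) means: for every $\varepsilon'>0$ there is $\delta_j>0$ such that $|R_j(z)|\le\varepsilon'|z_j|^{m_{n+j}}$ for all $z\in D(\delta_0)$ with $|z_j|\le\delta_j$. For a compact set $K\subset\mathbb{C}^{N}$, $\mathcal{C}(K)$ is the set of continuous complex-valued functions on $K$, and $\mathcal{P}(K)$ is the set of functions on $K$ that are uniform limits on $K$ of holomorphic polynomials in the coordinates of $\mathbb{C}^N$. For $f_1,\dots,f_N\in\mathcal{C}(\overline{D(\delta)})$, $[f_1,\dots,f_N;\overline{D(\delta)}]$ denotes the uniform closure in $\mathcal{C}(\overline{D(\delta)})$ of the set of complex polynomials in $f_1,\dots,f_N$. *)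

theory Defs
  imports "HOL-Analysis.Analysis"
begin

definition polydisc :: "real \<Rightarrow> (complex ^ 'n) set" where
  "polydisc \<delta> = {z. \<forall>j. cmod (z $ j) < \<delta>}"

(* Class C^1 in the real sense on an open set S: "has_derivative" is the real Frechet derivative. *)
definition C1_on :: "('a::real_normed_vector \<Rightarrow> 'b::real_normed_vector) \<Rightarrow> 'a set \<Rightarrow> bool" where
  "C1_on f S \<longleftrightarrow> (\<exists>f' :: 'a \<Rightarrow> 'a \<Rightarrow>\<^sub>L 'b.
     (\<forall>x\<in>S. (f has_derivative blinfun_apply (f' x)) (at x)) \<and> continuous_on S f')"

(* Polynomial functions on C^N with complex coefficients; \<alpha> ranges over a finite set of multi-indices. *)
definition holomorphic_polynomial :: "(complex ^ 'N \<Rightarrow> complex) \<Rightarrow> bool" where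
  "holomorphic_polynomial p \<longleftrightarrow> (\<exists>(A :: ('N \<Rightarrow> nat) set) (a :: ('N \<Rightarrow> nat) \<Rightarrow> complex).
     finite A \<and> p = (\<lambda>w. \<Sum>\<alpha>\<in>A. a \<alpha> * (\<Prod>i\<in>UNIV. (w $ i) ^ \<alpha> i)))"

(* The three function spaces below are sets of functions on a set K, represented by total
   functions. Membership depends only on the values on K, so equalities between
   such sets are equalities between the corresponding sets of functions on K. *)

definition cont_funs :: "'a::topological_space set \<Rightarrow> ('a \<Rightarrow> complex) set" where
  "cont_funs K = {f. continuous_on K f}"

definition poly_limits :: "(complex ^ 'N) set \<Rightarrow> (complex ^ 'N \<Rightarrow> complex) set" where
  "poly_limits K = {f. \<exists>p :: nat \<Rightarrow> complex ^ 'N \<Rightarrow> complex.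
     (\<forall>k. holomorphic_polynomial (p k)) \<and> uniform_limit K p f sequentially}"

(* The uniform closure in cont_funs X of the polynomials in F_1, ..., F_N; the generators are
   the components of F. *)
definition uniform_algebra_gen ::
    "('a::topological_space \<Rightarrow> complex ^ 'N) \<Rightarrow> 'a set \<Rightarrow> ('a \<Rightarrow> complex) set" where
  "uniform_algebra_gen F X = {g \<in> cont_funs X. \<exists>p :: nat \<Rightarrow> complex ^ 'N \<Rightarrow> complex.
     (\<forall>k. holomorphic_polynomial (p k)) \<and> uniform_limit X (\<lambda>k x. p k (F x)) g sequentially}"

(* C^(2n) is indexed by the sum type 'n + 'n: Inl j stands for the index j, Inr j for n + j. *)
definition power_graph_map ::
    "('n + 'n \<Rightarrow> nat) \<Rightarrow> (complex ^ 'n \<Rightarrow> complex ^ 'n) \<Rightarrow> complex ^ 'n \<Rightarrow> complex ^ ('n + 'n)" where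
  "power_graph_map m R z = (\<chi> i. case i of
       Inl j \<Rightarrow> (z $ j) ^ m (Inl j)
     | Inr j \<Rightarrow> cnj (z $ j) ^ m (Inr j) + R z $ j)"

end

theory Submission
  imports Defs "HOL-Probability.Distributions"
begin

text \<open>
  Write \<open>p\<^sub>j = m\<^sub>j\<close>, \<open>q\<^sub>j = m\<^sub>n\<^sub>+\<^sub>j\<close> and \<open>\<zeta>\<^sub>j = z\<^sub>j ^ q\<^sub>j\<close>.  The Lipschitz condition says that \<open>R\<close>
  depends on \<open>z\<close> only through \<open>\<zeta>\<close>: \<open>R z = S \<zeta>\<close>, where \<open>S\<close> is Lipschitz with constant
  \<open>c < 1\<close>.  The last \<open>n\<close> generators are therefore \<open>g\<^sub>j = cnj \<zeta>\<^sub>j + S\<^sub>j \<zeta>\<close>, and the graph of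
  \<open>\<zeta> \<mapsto> g\<close> is a Lipschitz perturbation of the totally real graph of conjugation.  Let \<open>A\<close> be the
  uniformly closed algebra generated by all \<open>z\<^sub>j ^ p\<^sub>j\<close> and \<open>g\<^sub>j\<close> on a small closed polydisc.  It is
  enough to show that \<open>A\<close> contains the complex conjugates of its generators, because then the
  Stone--Weierstrass theorem applies on \<open>K\<close>
  (\<open>complex_Stone_Weierstrass_quotient\<close>); if the exponents are coprime, the parametrisation of
  \<open>K\<close> is injective, hence a homeomorphism, and every continuous function on the polydisc comes
  from \<open>K\<close>.

  Removing the powers \<open>p\<^sub>j\<close>.  By the second condition \<open>u = \<zeta>\<^sub>j g\<^sub>j\<close> is \<open>|\<zeta>\<^sub>j|\<^sup>2\<close> up to a small relative
  error when the polydisc is small, so \<open>w = u ^ p\<^sub>j\<close> stays in the right half plane and \<open>u\<close> is its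
  principal root.  Since \<open>w = (z\<^sub>j ^ p\<^sub>j) ^ q\<^sub>j * g\<^sub>j ^ p\<^sub>j\<close> lies in \<open>A\<close> and principal powers on the half
  plane are limits of polynomials, \<open>u\<close> lies in \<open>A\<close>.  Finally \<open>\<zeta>\<^sub>j\<close> is the uniform limit of
  \<open>\<zeta>\<^sub>j * w / (w + \<epsilon>)\<close>, whose numerator \<open>\<zeta>\<^sub>j ^ p\<^sub>j * g\<^sub>j ^ (p\<^sub>j - 1) * u\<close> lies in \<open>A\<close>, so \<open>\<zeta>\<^sub>j\<close> itself lies
  in \<open>A\<close> (\<open>closed_algebra_root\<close>).

  Functions of \<open>\<zeta>\<close>.  The phase \<open>h(\<zeta>,\<xi>) = \<Sum>\<^sub>j (\<zeta>\<^sub>j - \<xi>\<^sub>j) * (g\<^sub>j \<zeta> - g\<^sub>j \<xi>)\<close> is for fixed \<open>\<xi>\<close> a polynomial in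
  \<open>\<zeta>\<^sub>j\<close>, \<open>g\<^sub>j\<close>, and its real part is at least \<open>(1 - c) * |\<zeta> - \<xi>|\<^sup>2\<close>.  Averages of a function \<open>f\<close> of
  compact support against \<open>exp (- h(\<zeta>,\<xi>) / s\<^sup>2)\<close> therefore lie in \<open>A\<close>, and as \<open>s\<close> tends to \<open>0\<close> they
  converge uniformly to \<open>f\<close> times the Gaussian integral of a complex quadratic form, provided that
  \<open>S\<close> is strictly differentiable near the support of \<open>f\<close>.  That integral never vanishes
  (\<open>gaussian_integral_nonzero\<close>) and can be divided out.

  The map \<open>S\<close> is in general differentiable only off the coordinate hyperplanes, but on each
  coordinate face it is differentiable in the remaining coordinates wherever these do not vanish.
  The faces are glued with the functions \<open>\<epsilon> / (\<zeta>\<^sub>k g\<^sub>k + \<epsilon>)\<close> of the algebra, which are bounded by \<open>1\<close>,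
  equal \<open>1\<close> on \<open>\<zeta>\<^sub>k = 0\<close> and tend to \<open>0\<close> elsewhere (\<open>face_mem\<close>).  So \<open>A\<close> contains all continuous
  functions of \<open>\<zeta>\<close>, among them the conjugates of the \<open>g\<^sub>j\<close>, and the conjugate of \<open>z\<^sub>j ^ p\<^sub>j\<close> is
  recovered from \<open>z\<^sub>j ^ p\<^sub>j\<close> and continuous functions of \<open>\<zeta>\<^sub>j ^ p\<^sub>j = (z\<^sub>j ^ p\<^sub>j) ^ q\<^sub>j\<close> (\<open>conjugate_from_power\<close>).
\<close>

section \<open>Uniformly closed algebras of functions\<close>

text \<open>Uniform limits are a formation rule, so that membership can be shown by taking limits
repeatedly; \<open>closed_algebra_approx\<close> turns it back into approximation by polynomials in the
generators.\<close>

inductive_set closed_algebra :: "'a set \<Rightarrow> ('a \<Rightarrow> complex) set \<Rightarrow> ('a \<Rightarrow> complex) set"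
  for X G where
  const: "(\<lambda>_. a) \<in> closed_algebra X G"
| gen: "g \<in> G \<Longrightarrow> g \<in> closed_algebra X G"
| add: "f \<in> closed_algebra X G \<Longrightarrow> g \<in> closed_algebra X G \<Longrightarrow> (\<lambda>x. f x + g x) \<in> closed_algebra X G"
| mult: "f \<in> closed_algebra X G \<Longrightarrow> g \<in> closed_algebra X G \<Longrightarrow> (\<lambda>x. f x * g x) \<in> closed_algebra X G"
| limit: "(\<And>e. e > 0 \<Longrightarrow> \<exists>g. g \<in> closed_algebra X G \<and> (\<forall>x\<in>X. cmod (f x - g x) < e))
    \<Longrightarrow> f \<in> closed_algebra X G"

lemma closed_algebra_limit_le:
  assumes "\<And>e. e > 0 \<Longrightarrow> \<exists>g\<in>closed_algebra X G. \<forall>x\<in>X. cmod (f x - g x) \<le> e"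
  shows "f \<in> closed_algebra X G"
proof (rule closed_algebra.limit)
  fix e :: real assume "e > 0"
  then obtain g where "g \<in> closed_algebra X G" "\<forall>x\<in>X. cmod (f x - g x) \<le> e / 2"
    using assms[of "e / 2"] by auto
  then show "\<exists>g. g \<in> closed_algebra X G \<and> (\<forall>x\<in>X. cmod (f x - g x) < e)"
    using \<open>e > 0\<close> by (intro exI[of _ g]) force
qed

lemma closed_algebra_cong:
  assumes "f \<in> closed_algebra X G" "\<And>x. x \<in> X \<Longrightarrow> f x = g x"
  shows "g \<in> closed_algebra X G"
  using assms by (intro closed_algebra.limit exI[of _ f]) auto

lemma closed_algebra_sum:
  assumes "\<And>i. i \<in> I \<Longrightarrow> f i \<in> closed_algebra X G"
  shows "(\<lambda>x. \<Sum>i\<in>I. f i x) \<in> closed_algebra X G"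
  using assms by (induction I rule: infinite_finite_induct)
    (auto intro: closed_algebra.const closed_algebra.add)

lemma closed_algebra_power:
  assumes "f \<in> closed_algebra X G"
  shows "(\<lambda>x. f x ^ k) \<in> closed_algebra X G"
  using assms by (induction k) (auto intro: closed_algebra.const closed_algebra.mult)

lemma closed_algebra_cmult:
  assumes "f \<in> closed_algebra X G"
  shows "(\<lambda>x. a * f x) \<in> closed_algebra X G"
  by (rule closed_algebra.mult[OF closed_algebra.const assms])

lemma closed_algebra_diff:
  assumes "f \<in> closed_algebra X G" "g \<in> closed_algebra X G"
  shows "(\<lambda>x. f x - g x) \<in> closed_algebra X G"
  using closed_algebra.add[OF assms(1) closed_algebra_cmult[OF assms(2), of "-1"]] by simp

lemma closed_algebra_pullback:
  assumes "f \<in> closed_algebra Y G" and "\<And>x. x \<in> X \<Longrightarrow> \<pi> x \<in> Y"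
    and "\<And>g. g \<in> G \<Longrightarrow> (\<lambda>x. g (\<pi> x)) \<in> closed_algebra X H"
  shows "(\<lambda>x. f (\<pi> x)) \<in> closed_algebra X H"
  using assms(1)
proof induction
  case (limit f)
  show ?case
  proof (rule closed_algebra.limit)
    fix e :: real assume "e > 0"
    from limit[OF this] obtain g where
      g: "(\<lambda>x. g (\<pi> x)) \<in> closed_algebra X H" "\<forall>y\<in>Y. cmod (f y - g y) < e" by blast
    with assms(2) show "\<exists>g. g \<in> closed_algebra X H \<and> (\<forall>x\<in>X. cmod (f (\<pi> x) - g x) < e)"
      by blast
  qed
qed (auto intro: closed_algebra.intros assms(3))

lemma closed_algebra_bounded:
  assumes "f \<in> closed_algebra X G" and "\<And>g. g \<in> G \<Longrightarrow> bounded (g ` X)"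
  shows "bounded (f ` X)"
  using assms(1)
proof induction
  case (add f g)
  then obtain B C where "\<forall>x\<in>X. cmod (f x) \<le> B" "\<forall>x\<in>X. cmod (g x) \<le> C"
    by (auto simp: bounded_iff)
  then show ?case
    by (auto simp: bounded_iff intro!: exI[of _ "B + C"] norm_triangle_le add_mono)
next
  case (mult f g)
  then obtain B C where "\<forall>x\<in>X. cmod (f x) \<le> B" "\<forall>x\<in>X. cmod (g x) \<le> C"
    by (auto simp: bounded_iff)
  then show ?case
    by (auto simp: bounded_iff norm_mult intro!: exI[of _ "B * C"] mult_mono)
       (meson norm_ge_zero order_trans)
next
  case (limit f)
  from limit[of 1] obtain g B where "\<forall>x\<in>X. cmod (f x - g x) < 1" "\<forall>x\<in>X. cmod (g x) \<le> B"
    by (auto simp: bounded_iff)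
  then have "cmod (f x) \<le> 1 + B" if "x \<in> X" for x
    using norm_triangle_ineq[of "f x - g x" "g x"] that by fastforce
  then show ?case by (auto simp: bounded_iff)
qed (use assms(2) in \<open>auto simp: bounded_iff\<close>)

lemma closed_algebra_power_series:
  fixes a :: "nat \<Rightarrow> complex"
  assumes f: "f \<in> closed_algebra X G" and M: "\<And>x. x \<in> X \<Longrightarrow> cmod (f x) \<le> M"
    and summ: "summable (\<lambda>k. cmod (a k) * M ^ k)"
    and F: "\<And>x. x \<in> X \<Longrightarrow> (\<lambda>k. a k * f x ^ k) sums F x"
  shows "F \<in> closed_algebra X G"
proof (rule closed_algebra.limit)
  fix e :: real assume "e > 0"
  have "uniform_limit X (\<lambda>n x. \<Sum>k<n. a k * f x ^ k) (\<lambda>x. \<Sum>k. a k * f x ^ k) sequentially"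
    using summ by (rule Weierstrass_m_test[rotated])
       (auto simp: norm_mult norm_power intro!: mult_left_mono power_mono M)
  then obtain n where "\<forall>x\<in>X. dist (\<Sum>k<n. a k * f x ^ k) (\<Sum>k. a k * f x ^ k) < e"
    using \<open>e > 0\<close> unfolding uniform_limit_iff eventually_sequentially by blast
  moreover have "(\<lambda>x. \<Sum>k<n. a k * f x ^ k) \<in> closed_algebra X G"
    by (intro closed_algebra_sum closed_algebra_cmult closed_algebra_power f)
  ultimately show "\<exists>g. g \<in> closed_algebra X G \<and> (\<forall>x\<in>X. cmod (F x - g x) < e)"
    using F by (intro exI[of _ "\<lambda>x. \<Sum>k<n. a k * f x ^ k"])
       (auto simp: dist_norm norm_minus_commute sums_iff)
qed

lemma closed_algebra_exp:
  assumes f: "f \<in> closed_algebra X G" and M: "\<And>x. x \<in> X \<Longrightarrow> cmod (f x) \<le> M"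
  shows "(\<lambda>x. exp (f x)) \<in> closed_algebra X G"
proof (rule closed_algebra_power_series[OF f M, where a = "\<lambda>k. inverse (fact k)"])
  show "summable (\<lambda>k. cmod (inverse (fact k)) * M ^ k)"
    using summable_exp[of M] by (simp add: norm_inverse)
  show "(\<lambda>k. inverse (fact k) * f x ^ k) sums exp (f x)" for x
    using exp_converges[of "f x"] by (simp add: scaleR_conv_of_real field_simps)
qed

text \<open>A bounded part of the right half plane, moved to the right by \<open>e\<close>, lies in an open disc
\<open>|w - N| < N\<close> for large \<open>N\<close>, because its points satisfy
\<open>|w - N|\<^sup>2 \<le> (M + e)\<^sup>2 - 2 * N * e + N\<^sup>2\<close>.  After division by \<open>N\<close> power series around \<open>1\<close> converge
uniformly on it.\<close>

lemma half_plane_shift_bound: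
  assumes "e > 0" "M \<ge> 0"
  obtains N \<theta> :: real where "N > 0" "0 \<le> \<theta>" "\<theta> < 1"
    "\<And>w. 0 \<le> Re w \<Longrightarrow> cmod w \<le> M \<Longrightarrow> cmod ((w + of_real e) / of_real N - 1) \<le> \<theta>"
proof -
  define N where "N = ((M + e)\<^sup>2 + 1) / (2 * e) + e"
  have N: "N > 0" "2 * N * e > (M + e)\<^sup>2" using assms by (auto simp: N_def field_simps add_pos_pos add_pos_nonneg power2_eq_square)
  define \<theta> where "\<theta> = sqrt (max 0 ((M + e)\<^sup>2 - 2 * N * e + N\<^sup>2)) / N"
  show thesis
  proof
    show "N > 0" by fact
    show "0 \<le> \<theta>" using N by (auto simp: \<theta>_def)
    have "sqrt (max 0 ((M + e)\<^sup>2 - 2 * N * e + N\<^sup>2)) < N"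
      using N by (intro real_less_lsqrt) auto
    then show "\<theta> < 1" using N by (auto simp: \<theta>_def)
    fix w assume w: "0 \<le> Re w" "cmod w \<le> M"
    have "cmod (w + of_real e) \<le> M + e" using w norm_triangle_ineq[of w "of_real e"] assms by simp
    then have "(cmod (w + of_real e))\<^sup>2 \<le> (M + e)\<^sup>2" by (intro power_mono) auto
    moreover have NR: "0 \<le> N * Re w" using w N by simp
    ultimately have "(cmod (w + of_real e - of_real N))\<^sup>2 \<le> (M + e)\<^sup>2 - 2 * N * e + N\<^sup>2"
      using NR unfolding cmod_power2 by (simp add: power2_eq_square algebra_simps)
    then have "cmod (w + of_real e - of_real N) \<le> sqrt (max 0 ((M + e)\<^sup>2 - 2 * N * e + N\<^sup>2))"
      by (intro real_le_rsqrt) auto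
    moreover have "(w + of_real e) / of_real N - 1 = (w + of_real e - of_real N) / of_real N"
      using N by (simp add: field_simps)
    ultimately show "cmod ((w + of_real e) / of_real N - 1) \<le> \<theta>"
      using N by (simp add: norm_divide \<theta>_def divide_right_mono)
  qed
qed

text \<open>Binomial series.  The shift by \<open>e\<close> keeps the values away from the branch point \<open>0\<close>.\<close>

lemma closed_algebra_powr_shift:
  assumes f: "f \<in> closed_algebra X G" and M: "\<And>x. x \<in> X \<Longrightarrow> cmod (f x) \<le> M"
    and Re: "\<And>x. x \<in> X \<Longrightarrow> 0 \<le> Re (f x)" and e: "e > (0::real)"
  shows "(\<lambda>x. (f x + of_real e) powr s) \<in> closed_algebra X G"
proof (cases "X = {}")
  case True
  then show ?thesis by (intro closed_algebra.limit) (auto intro: closed_algebra.const)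
next
  case False
  then have "M \<ge> 0" using M by (meson all_not_in_conv norm_ge_zero order_trans)
  with e obtain N \<theta> :: real where N: "N > 0" "0 \<le> \<theta>" "\<theta> < 1"
    "\<And>w. 0 \<le> Re w \<Longrightarrow> cmod w \<le> M \<Longrightarrow> cmod ((w + of_real e) / of_real N - 1) \<le> \<theta>"
    using half_plane_shift_bound by metis
  define y where "y x = (1 / of_real N) * (f x + of_real e) - 1" for x
  have y: "y \<in> closed_algebra X G" unfolding y_def
    by (intro closed_algebra_diff closed_algebra_cmult closed_algebra.add closed_algebra.const f)
  have y_le: "cmod (y x) \<le> \<theta>" if "x \<in> X" for x
    using N(4)[OF Re[OF that] M[OF that]] by (simp add: y_def)
  have "(\<lambda>x. (1 + y x) powr s) \<in> closed_algebra X G"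
  proof (rule closed_algebra_power_series[OF y y_le, where a = "\<lambda>k. s gchoose k"])
    define r where "r = (\<theta> + 1) / 2"
    have "summable (\<lambda>k. (s gchoose k) * of_real r ^ k)"
      using N by (intro sums_summable[OF gen_binomial_complex]) (auto simp: r_def)
    then have "summable (\<lambda>k. norm ((s gchoose k) * of_real \<theta> ^ k))"
      by (rule powser_insidea) (use N in \<open>auto simp: r_def\<close>)
    then show "summable (\<lambda>k. cmod (s gchoose k) * \<theta> ^ k)"
      using N by (simp add: norm_mult norm_power)
    show "(\<lambda>k. (s gchoose k) * y x ^ k) sums (1 + y x) powr s" if "x \<in> X" for x
      using y_le[OF that] N by (intro gen_binomial_complex) auto
  qed auto
  then have "(\<lambda>x. (of_real N powr s) * (1 + y x) powr s) \<in> closed_algebra X G"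
    by (rule closed_algebra_cmult)
  moreover have "(of_real N powr s) * (1 + y x) powr s = (f x + of_real e) powr s" for x
  proof -
    have "f x + of_real e = of_real N * (1 + y x)" using N by (simp add: y_def)
    then show ?thesis using N by (simp add: powr_times_real_left)
  qed
  ultimately show ?thesis by simp
qed

lemma closed_algebra_inverse_shift:
  assumes f: "f \<in> closed_algebra X G" and M: "\<And>x. x \<in> X \<Longrightarrow> cmod (f x) \<le> M"
    and Re: "\<And>x. x \<in> X \<Longrightarrow> 0 \<le> Re (f x)" and e: "e > (0::real)"
  shows "(\<lambda>x. 1 / (f x + of_real e)) \<in> closed_algebra X G"
proof (rule closed_algebra_cong[OF closed_algebra_powr_shift[OF f M Re e, of "-1"]])
  fix x assume "x \<in> X"
  then have "Re (f x + of_real e) > 0" using Re e by force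
  then have "f x + of_real e \<noteq> 0" by force
  then show "(f x + of_real e) powr - 1 = 1 / (f x + of_real e)"
    by (simp add: powr_minus inverse_eq_divide)
qed

text \<open>The product \<open>u = x * g\<close> is so close to the positive number \<open>|x|\<^sup>2\<close> that \<open>u ^ p\<close> stays in the
right half plane and has \<open>u\<close> as principal \<open>p\<close>-th root; hence \<open>u\<close> is a limit of polynomials in
\<open>u ^ p = x ^ p * g ^ p\<close>.  To divide by the remaining powers of \<open>g\<close>, which may vanish, \<open>x\<close> is
written as the limit of \<open>x * u ^ p / (u ^ p + \<epsilon>)\<close>: near the zeros of \<open>x\<close> both sides are small, and
elsewhere \<open>u ^ p\<close> is bounded below.\<close>

lemma closed_algebra_root:
  fixes x g :: "'a \<Rightarrow> complex"
  assumes p: "p > 0" and xp: "(\<lambda>t. x t ^ p) \<in> closed_algebra X G" and g: "g \<in> closed_algebra X G"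
    and bx: "bounded (x ` X)" and bg: "bounded (g ` X)"
    and \<eta>: "\<eta> < 1" "\<And>y. cmod (y - 1) \<le> \<eta> \<Longrightarrow> \<bar>Im (Ln y)\<bar> \<le> pi / (2 * real p)"
    and near: "\<And>t. t \<in> X \<Longrightarrow> cmod (x t * g t - of_real ((cmod (x t))\<^sup>2)) \<le> \<eta> * (cmod (x t))\<^sup>2"
  shows "x \<in> closed_algebra X G"
proof -
  obtain B where B: "B > 0" "\<And>t. t \<in> X \<Longrightarrow> cmod (x t) \<le> B"
    using bx unfolding bounded_pos by auto
  obtain C where C: "C > 0" "\<And>t. t \<in> X \<Longrightarrow> cmod (g t) \<le> C"
    using bg unfolding bounded_pos by auto
  define u where "u t = x t * g t" for t
  define w where "w t = u t ^ p" for t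
  have w: "w \<in> closed_algebra X G"
    using closed_algebra.mult[OF xp closed_algebra_power[OF g, of p]]
    by (simp add: w_def[abs_def] u_def power_mult_distrib)
  define M where "M = (B * C) ^ p"
  have wM: "cmod (w t) \<le> M" if "t \<in> X" for t
    using B(2)[OF that] C(2)[OF that] B(1) unfolding w_def u_def M_def norm_mult norm_power
    by (intro power_mono mult_mono) auto
  have sector: "0 \<le> Re (w t) \<and> w t powr (1 / of_nat p) = u t" if "t \<in> X" for t
  proof (cases "x t = 0")
    case True
    then show ?thesis using p by (simp add: w_def u_def)
  next
    case False
    define y where "y = u t / of_real ((cmod (x t))\<^sup>2)"
    have u_eq: "u t = of_real ((cmod (x t))\<^sup>2) * y" using False by (simp add: y_def)
    have "y - 1 = (u t - of_real ((cmod (x t))\<^sup>2)) / of_real ((cmod (x t))\<^sup>2)"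
      using False by (simp add: y_def field_simps)
    then have "cmod (y - 1) = cmod (u t - of_real ((cmod (x t))\<^sup>2)) / (cmod (x t))\<^sup>2"
      by (simp add: norm_divide norm_power)
    then have y1: "cmod (y - 1) \<le> \<eta>"
      using near[OF that] False by (simp add: u_def divide_le_eq)
    then have "y \<noteq> 0" using \<eta>(1) by auto
    then have u0: "u t \<noteq> 0" using False by (simp add: u_eq)
    have "Im (Ln (u t)) = Im (Ln y)"
      unfolding u_eq using False \<open>y \<noteq> 0\<close> by (simp add: Ln_times_of_real del: of_real_power)
    then have im: "\<bar>real p * Im (Ln (u t))\<bar> \<le> pi / 2"
      using \<eta>(2)[OF y1] p by (simp add: abs_mult field_simps)
    have w_exp: "w t = exp (of_nat p * Ln (u t))"
      using u0 by (simp add: w_def exp_of_nat_mult)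
    have "- pi < real p * Im (Ln (u t))" "real p * Im (Ln (u t)) \<le> pi"
      using im pi_gt_zero unfolding abs_le_iff by linarith+
    then have "Ln (w t) = of_nat p * Ln (u t)"
      unfolding w_exp by (intro Ln_exp) auto
    then have "w t powr (1 / of_nat p) = u t"
      using u0 p by (simp add: powr_def w_def)
    moreover have "0 \<le> cos (real p * Im (Ln (u t)))"
      using im unfolding abs_le_iff by (intro cos_ge_zero) linarith+
    then have "0 \<le> Re (w t)"
      unfolding w_exp Re_exp by (intro mult_nonneg_nonneg) auto
    ultimately show ?thesis by blast
  qed
  have u: "u \<in> closed_algebra X G"
  proof (rule closed_algebra.limit)
    fix e :: real assume "e > 0"
    define H where "H = {z. 0 \<le> Re z} \<inter> cball 0 (M + 1)"
    have "compact H" unfolding H_def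
      by (intro closed_Int_compact closed_halfspace_Re_ge compact_cball)
    moreover have "continuous_on H (\<lambda>z. z powr (1 / of_nat p))"
      using p by (intro continuous_on_powr_complex continuous_intros) (auto simp: H_def Re_divide_of_nat)
    ultimately have "uniformly_continuous_on H (\<lambda>z. z powr (1 / of_nat p))"
      by (intro compact_uniformly_continuous)
    then obtain d where d: "d > 0" "\<And>z z'. z \<in> H \<Longrightarrow> z' \<in> H \<Longrightarrow> dist z' z < d \<Longrightarrow>
        dist (z' powr (1 / of_nat p)) (z powr (1 / of_nat p)) < e"
      unfolding uniformly_continuous_on_def using \<open>e > 0\<close> by metis
    define \<epsilon> where "\<epsilon> = min (d / 2) 1"
    have \<epsilon>: "\<epsilon> > 0" "\<epsilon> < d" "\<epsilon> \<le> 1" using d by (auto simp: \<epsilon>_def)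
    have "cmod (u t - (w t + of_real \<epsilon>) powr (1 / of_nat p)) < e" if "t \<in> X" for t
    proof -
      have "w t \<in> H" using sector[OF that] wM[OF that] by (simp add: H_def)
      moreover have "w t + of_real \<epsilon> \<in> H"
        using sector[OF that] wM[OF that] norm_triangle_ineq[of "w t" "of_real \<epsilon>"] \<epsilon> by (simp add: H_def)
      ultimately have "dist (w t powr (1 / of_nat p)) ((w t + of_real \<epsilon>) powr (1 / of_nat p)) < e"
        using \<epsilon> by (intro d) (auto simp: dist_norm)
      then show ?thesis using sector[OF that] by (simp add: dist_norm)
    qed
    moreover have "(\<lambda>t. (w t + of_real \<epsilon>) powr (1 / of_nat p)) \<in> closed_algebra X G"
      using \<epsilon> sector by (intro closed_algebra_powr_shift[OF w wM]) auto
    ultimately show "\<exists>h. h \<in> closed_algebra X G \<and> (\<forall>t\<in>X. cmod (u t - h t) < e)"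
      by blast
  qed
  show ?thesis
  proof (rule closed_algebra_limit_le)
    fix e :: real assume "e > 0"
    \<comment> \<open>\<open>\<kappa>\<close> bounds \<open>|w|\<close> from below where \<open>|x| > e\<close>, and \<open>\<epsilon>\<close> makes \<open>B * \<epsilon> / \<kappa>\<close> equal to \<open>e\<close>.\<close>
    define \<kappa> where "\<kappa> = ((1 - \<eta>) * e\<^sup>2) ^ p"
    have "\<kappa> > 0" using \<eta> \<open>e > 0\<close> by (simp add: \<kappa>_def)
    define \<epsilon> where "\<epsilon> = e * \<kappa> / B"
    have "\<epsilon> > 0" using \<open>e > 0\<close> \<open>\<kappa> > 0\<close> B by (simp add: \<epsilon>_def)
    have inv: "(\<lambda>t. 1 / (w t + of_real \<epsilon>)) \<in> closed_algebra X G"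
      using \<open>\<epsilon> > 0\<close> sector by (intro closed_algebra_inverse_shift[OF w wM]) auto
    define h where "h t = (x t ^ p * g t ^ (p - 1)) * u t * (1 / (w t + of_real \<epsilon>))" for t
    have "h \<in> closed_algebra X G" unfolding h_def
      by (intro closed_algebra.mult closed_algebra_power xp g u inv)
    moreover have "cmod (x t - h t) \<le> e" if "t \<in> X" for t
    proof -
      have Rew: "Re (w t + of_real \<epsilon>) \<ge> \<epsilon>" using sector[OF that] by simp
      have ne: "w t + of_real \<epsilon> \<noteq> 0" using Rew \<open>\<epsilon> > 0\<close> by force
      have "x t ^ p * g t ^ (p - 1) * u t = x t * w t"
        using p by (cases p) (simp_all add: w_def u_def power_mult_distrib field_simps)
      then have "x t - h t = x t * of_real \<epsilon> / (w t + of_real \<epsilon>)"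
        using ne by (simp add: h_def field_simps)
      then have eq: "cmod (x t - h t) = cmod (x t) * \<epsilon> / cmod (w t + of_real \<epsilon>)"
        using \<open>\<epsilon> > 0\<close> by (simp add: norm_mult norm_divide)
      have den: "\<epsilon> \<le> cmod (w t + of_real \<epsilon>)" using Rew complex_Re_le_cmod order_trans by blast
      show ?thesis
      proof (cases "cmod (x t) \<le> e")
        case True
        have "cmod (x t) * \<epsilon> / cmod (w t + of_real \<epsilon>) \<le> cmod (x t) * 1"
          using den \<open>\<epsilon> > 0\<close> unfolding times_divide_eq_right[symmetric]
          by (intro mult_left_mono) (auto simp: divide_le_eq_1)
        then show ?thesis using eq True by simp
      next
        case False
        have "cmod (u t) \<ge> (1 - \<eta>) * (cmod (x t))\<^sup>2"
          using near[OF that] norm_triangle_ineq2[of "of_real ((cmod (x t))\<^sup>2)" "u t"]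
          by (simp add: u_def norm_minus_commute algebra_simps norm_power)
        moreover have "(1 - \<eta>) * (cmod (x t))\<^sup>2 \<ge> (1 - \<eta>) * e\<^sup>2"
          using \<eta> False \<open>e > 0\<close> by (intro mult_left_mono power_mono) auto
        ultimately have "(1 - \<eta>) * e\<^sup>2 \<le> cmod (u t)" by linarith
        then have "cmod (w t) \<ge> \<kappa>"
          unfolding w_def \<kappa>_def norm_power using \<eta>(1) by (intro power_mono) auto
        moreover have "cmod (w t) \<le> cmod (w t + of_real \<epsilon>)"
          using sector[OF that] \<open>\<epsilon> > 0\<close>
          by (auto simp: cmod_def power2_eq_square intro!: real_sqrt_le_mono mult_mono)
        ultimately have "\<kappa> \<le> cmod (w t + of_real \<epsilon>)" by simp
        then have "cmod (x t) * \<epsilon> / cmod (w t + of_real \<epsilon>) \<le> B * \<epsilon> / \<kappa>"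
          using B that \<open>\<epsilon> > 0\<close> \<open>\<kappa> > 0\<close> by (intro frac_le mult_mono) (auto intro: less_imp_le)
        also have "\<dots> = e" using B \<open>\<kappa> > 0\<close> by (simp add: \<epsilon>_def)
        finally show ?thesis using eq by simp
      qed
    qed
    ultimately show "\<exists>h\<in>closed_algebra X G. \<forall>t\<in>X. cmod (x t - h t) \<le> e" by blast
  qed
qed

text \<open>Limits can be postponed to the last step, as long as the generators are bounded: then products of
uniform approximations are uniform approximations.  The set \<open>P\<close> is any algebra of functions that
contains the generators; it serves both for the polynomials and for the closed algebra of a larger
set.\<close>

lemma closed_algebra_approx:
  assumes f: "f \<in> closed_algebra X G" and bd: "\<And>g. g \<in> G \<Longrightarrow> bounded (g ` X)"
    and P: "\<And>a. (\<lambda>_. a) \<in> P" "G \<subseteq> P"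
      "\<And>f g. f \<in> P \<Longrightarrow> g \<in> P \<Longrightarrow> (\<lambda>x. f x + g x) \<in> P"
      "\<And>f g. f \<in> P \<Longrightarrow> g \<in> P \<Longrightarrow> (\<lambda>x. f x * g x) \<in> P"
    and e: "e > 0"
  shows "\<exists>g\<in>P. \<forall>x\<in>X. cmod (f x - g x) < e"
  using f e
proof (induction arbitrary: e)
  case (const a)
  then show ?case using P(1)[of a] by (intro bexI) auto
next
  case (gen g)
  then show ?case using P(2) by (intro bexI[of _ g]) auto
next
  case (add f1 f2)
  from add.IH(1)[of "e / 2"] add.IH(2)[of "e / 2"] add.prems obtain g1 g2 where
    g: "g1 \<in> P" "\<forall>x\<in>X. cmod (f1 x - g1 x) < e / 2" "g2 \<in> P" "\<forall>x\<in>X. cmod (f2 x - g2 x) < e / 2"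
    by (metis half_gt_zero)
  show ?case
  proof (rule bexI[OF ballI P(3)[OF g(1,3)]])
    fix x assume "x \<in> X"
    then have "cmod ((f1 x - g1 x) + (f2 x - g2 x)) < e / 2 + e / 2"
      using g by (intro norm_triangle_lt add_strict_mono) auto
    then show "cmod (f1 x + f2 x - (g1 x + g2 x)) < e" by (simp add: algebra_simps)
  qed
next
  case (mult f1 f2)
  obtain B1 where B1: "B1 > 0" "\<And>x. x \<in> X \<Longrightarrow> cmod (f1 x) \<le> B1"
    using closed_algebra_bounded[OF mult.hyps(1) bd] unfolding bounded_pos by auto
  obtain B2 where B2: "B2 > 0" "\<And>x. x \<in> X \<Longrightarrow> cmod (f2 x) \<le> B2"
    using closed_algebra_bounded[OF mult.hyps(2) bd] unfolding bounded_pos by auto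
  obtain g2 where g2: "g2 \<in> P" "\<forall>x\<in>X. cmod (f2 x - g2 x) < min 1 (e / 2 / B1)"
    using mult.IH(2)[of "min 1 (e / 2 / B1)"] mult.prems B1(1) by auto
  obtain g1 where g1: "g1 \<in> P" "\<forall>x\<in>X. cmod (f1 x - g1 x) < e / 2 / (B2 + 1)"
    using mult.IH(1)[of "e / 2 / (B2 + 1)"] mult.prems B2(1) by auto
  show ?case
  proof (rule bexI[OF ballI P(4)[OF g1(1) g2(1)]])
    fix x assume x: "x \<in> X"
    have "cmod (f1 x * (f2 x - g2 x)) \<le> B1 * cmod (f2 x - g2 x)"
      unfolding norm_mult using B1 x by (intro mult_right_mono) auto
    also have "\<dots> \<le> B1 * (e / 2 / B1)"
      using g2(2) x B1(1) by (intro mult_left_mono) force+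
    finally have 1: "cmod (f1 x * (f2 x - g2 x)) \<le> e / 2" using B1 by simp
    have "cmod (g2 x) \<le> B2 + 1"
      using B2(2)[OF x] g2(2) x norm_triangle_ineq3[of "f2 x" "g2 x"] by force
    then have "cmod ((f1 x - g1 x) * g2 x) \<le> cmod (f1 x - g1 x) * (B2 + 1)"
      unfolding norm_mult by (intro mult_left_mono) auto
    also have "\<dots> < e / 2 / (B2 + 1) * (B2 + 1)"
      using g1(2) x B2(1) by (intro mult_strict_right_mono) auto
    also have "\<dots> = e / 2" using B2(1) by (intro nonzero_eq_divide_eq[THEN iffD1]) auto
    finally have 2: "cmod ((f1 x - g1 x) * g2 x) < e / 2" .
    have "f1 x * f2 x - g1 x * g2 x = f1 x * (f2 x - g2 x) + (f1 x - g1 x) * g2 x"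
      by (simp add: algebra_simps)
    then show "cmod (f1 x * f2 x - g1 x * g2 x) < e"
      using norm_triangle_ineq[of "f1 x * (f2 x - g2 x)" "(f1 x - g1 x) * g2 x"] 1 2 by simp
  qed
next
  case (limit f)
  from limit.IH[of "e / 2"] limit.prems obtain h where
    h: "\<And>e. e > 0 \<Longrightarrow> \<exists>g\<in>P. \<forall>x\<in>X. cmod (h x - g x) < e" "\<forall>x\<in>X. cmod (f x - h x) < e / 2"
    by (metis half_gt_zero)
  obtain g where g: "g \<in> P" "\<forall>x\<in>X. cmod (h x - g x) < e / 2"
    using h(1)[of "e / 2"] limit.prems by auto
  show ?case
  proof (rule bexI[OF ballI g(1)])
    fix x assume "x \<in> X"
    then have "cmod ((f x - h x) + (h x - g x)) < e / 2 + e / 2"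
      using g h by (intro norm_triangle_lt add_strict_mono) auto
    then show "cmod (f x - g x) < e" by simp
  qed
qed

lemma closed_algebra_continuous:
  assumes f: "f \<in> closed_algebra X G" and G: "\<And>g. g \<in> G \<Longrightarrow> continuous_on X g"
  shows "continuous_on X f"
  using f
proof induction
  case (limit f)
  show ?case
  proof -
    have "\<exists>g. continuous_on X g \<and> (\<forall>x\<in>X. cmod (f x - g x) < inverse (real (Suc k)))" for k
      using limit[of "inverse (real (Suc k))"] by auto
    then obtain g where g: "\<And>k. continuous_on X (g k)"
      "\<And>k x. x \<in> X \<Longrightarrow> cmod (f x - g k x) < inverse (real (Suc k))" by metis
    have "uniform_limit X g f sequentially"
    proof (rule uniform_limitI)
      fix e :: real assume "e > 0"
      then have "\<forall>\<^sub>F k in sequentially. inverse (real (Suc k)) < e"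
        using order_tendstoD(2)[OF LIMSEQ_inverse_real_of_nat] by blast
      then show "\<forall>\<^sub>F k in sequentially. \<forall>x\<in>X. dist (g k x) (f x) < e"
      proof eventually_elim
        case (elim k)
        show ?case
        proof
          fix x assume "x \<in> X"
          from g(2)[OF this, of k] elim show "dist (g k x) (f x) < e"
            by (simp add: dist_norm norm_minus_commute)
        qed
      qed
    qed
    then show ?thesis
      using g(1) by (intro uniform_limit_theorem[OF _ _ trivial_limit_sequentially]) auto
  qed
qed (use G in \<open>auto intro: continuous_on_add continuous_on_mult\<close>)

lemma closed_algebra_subset:
  assumes "f \<in> closed_algebra X G" "X' \<subseteq> X" "\<And>g. g \<in> G \<Longrightarrow> g \<in> closed_algebra X' H"
  shows "f \<in> closed_algebra X' H"
  by (rule closed_algebra_pullback[OF assms(1), of X' "\<lambda>x. x"]) (use assms in auto)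

text \<open>On a compact set a strict bound along the zero set of \<open>r\<close> extends to a sublevel set of \<open>r\<close>: the
continuous function \<open>r\<close> has a positive minimum on the closed set where the bound fails.\<close>

lemma zero_set_neighbourhood:
  fixes D r :: "'a::t2_space \<Rightarrow> real"
  assumes W: "compact W" and D: "continuous_on W D" and r: "continuous_on W r"
    and r0: "\<And>x. x \<in> W \<Longrightarrow> r x \<ge> 0" and zero: "\<And>x. x \<in> W \<Longrightarrow> r x = 0 \<Longrightarrow> D x < a"
  shows "\<exists>t>0. \<forall>x\<in>W. r x \<le> t \<longrightarrow> D x < a"
proof -
  define K where "K = {x\<in>W. a \<le> D x}"
  have K: "compact K" 
  proof -
    have "closedin (top_of_set W) {x\<in>W. a \<le> D x}"
      using continuous_closedin_preimage[OF D, of "{a..}"] by (simp add: vimage_def Int_def)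
    then show ?thesis using W closedin_compact by (auto simp: K_def)
  qed
  show ?thesis
  proof (cases "K = {}")
    case True
    then show ?thesis by (intro exI[of _ 1]) (auto simp: K_def not_le)
  next
    case False
    obtain x where x: "x \<in> K" "\<And>y. y \<in> K \<Longrightarrow> r x \<le> r y"
      using continuous_attains_inf[OF K False continuous_on_subset[OF r]] by (auto simp: K_def)
    have "r x > 0" using x(1) zero[of x] r0[of x] by (auto simp: K_def order.order_iff_strict)
    then show ?thesis
      using x(2) by (intro exI[of _ "r x / 2"]) (force simp: K_def not_le[symmetric])
  qed
qed

text \<open>Stone--Weierstrass on the image of \<open>F\<close>, for the real functions there whose pullback lies in the
algebra.  The coordinates separate the points of the image, also where \<open>F\<close> identifies points.\<close>

lemma complex_Stone_Weierstrass_quotient: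
  fixes F :: "'a::t2_space \<Rightarrow> complex ^ 'N"
  assumes X: "compact X" "continuous_on X F"
    and coord: "\<And>i. (\<lambda>x. F x $ i) \<in> closed_algebra X G" "\<And>i. (\<lambda>x. cnj (F x $ i)) \<in> closed_algebra X G"
    and u: "continuous_on (F ` X) u"
  shows "(\<lambda>x. u (F x)) \<in> closed_algebra X G"
proof -
  define P where "P f \<longleftrightarrow> continuous_on (F ` X) f \<and> (\<lambda>x. complex_of_real (f (F x))) \<in> closed_algebra X G" for f
  have real: "(\<lambda>x. complex_of_real (f (F x))) \<in> closed_algebra X G" if f: "continuous_on (F ` X) f" for f
  proof (rule closed_algebra.limit)
    fix e :: real assume "e > 0"
    have "\<exists>g. P g \<and> (\<forall>w\<in>F ` X. \<bar>f w - g w\<bar> < e)"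
    proof (rule Stone_Weierstrass_HOL[of "F ` X" P])
      show "compact (F ` X)" using X by (intro compact_continuous_image)
      show "P (\<lambda>_. c)" for c by (simp add: P_def closed_algebra.const)
      show "P f \<Longrightarrow> continuous_on (F ` X) f" for f by (simp add: P_def)
      show "P f \<and> P g \<Longrightarrow> P (\<lambda>x. f x + g x)" for f g
        by (auto simp: P_def intro!: continuous_intros closed_algebra.add)
      show "P f \<and> P g \<Longrightarrow> P (\<lambda>x. f x * g x)" for f g
        by (auto simp: P_def intro!: continuous_intros closed_algebra.mult)
      fix w w' assume ww: "w \<in> F ` X \<and> w' \<in> F ` X \<and> w \<noteq> w'"
      then obtain i where i: "w $ i \<noteq> w' $ i" by (auto simp: vec_eq_iff)
      have "complex_of_real (Re z) = (1/2) * (z + cnj z)" "complex_of_real (Im z) = (- \<i> / 2) * (z - cnj z)" for z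
        by (auto simp: complex_eq_iff)
      then have "P (\<lambda>w. Re (w $ i))" "P (\<lambda>w. Im (w $ i))"
        by (auto simp only: P_def intro!: continuous_intros closed_algebra_cmult closed_algebra.add closed_algebra_diff coord)
      then show "\<exists>f. P f \<and> f w \<noteq> f w'" using i by (auto simp: complex_eq_iff)
    qed (use f \<open>e > 0\<close> in auto)
    then obtain g where g: "P g" "\<forall>w\<in>F ` X. \<bar>f w - g w\<bar> < e" by blast
    show "\<exists>g. g \<in> closed_algebra X G \<and> (\<forall>x\<in>X. cmod (complex_of_real (f (F x)) - g x) < e)"
      using g by (intro exI[of _ "\<lambda>x. complex_of_real (g (F x))"])
         (auto simp: P_def simp flip: of_real_diff)
  qed
  have "(\<lambda>x. complex_of_real (Re (u (F x))) + \<i> * complex_of_real (Im (u (F x)))) \<in> closed_algebra X G"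
    by (intro closed_algebra.add closed_algebra_cmult real[of "\<lambda>w. Re (u w)"] real[of "\<lambda>w. Im (u w)"] continuous_intros u)
  then show ?thesis by (simp flip: complex_eq)
qed

text \<open>With \<open>b = a ^ q\<close> one has \<open>cnj a = a ^ (q - 1) * cnj b / |a| ^ (2 * (q - 1))\<close>, and \<open>|a|\<close> is the real
\<open>q\<close>-th root of \<open>|b|\<close>.  Replacing \<open>|a|\<close> in the denominator by \<open>max |a| e\<close> makes the second factor a
continuous function of \<open>b\<close> and costs an error of at most \<open>e\<close>, where \<open>|a| \<le> e\<close>.\<close>

lemma conjugate_from_power:
  fixes a :: "'a \<Rightarrow> complex"
  assumes q: "q > 0" and a: "a \<in> closed_algebra X G"
    and k: "\<And>\<kappa> :: complex \<Rightarrow> complex. continuous_on UNIV \<kappa> \<Longrightarrow> (\<lambda>x. \<kappa> (a x ^ q)) \<in> closed_algebra X G"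
  shows "(\<lambda>x. cnj (a x)) \<in> closed_algebra X G"
proof (rule closed_algebra_limit_le)
  fix e :: real assume "e > 0"
  define \<kappa> where "\<kappa> b = cnj b * of_real (1 / (max (root q (cmod b)) e) ^ (2 * (q - 1)))" for b
  have "continuous_on UNIV \<kappa>"
    unfolding \<kappa>_def using \<open>e > 0\<close> by (intro continuous_intros) (auto simp: max_def)
  then have mem: "(\<lambda>x. a x ^ (q - 1) * \<kappa> (a x ^ q)) \<in> closed_algebra X G"
    by (intro closed_algebra.mult closed_algebra_power a k)
  have "cmod (cnj w - w ^ (q - 1) * \<kappa> (w ^ q)) \<le> e" for w
  proof -
    have rt: "root q (cmod (w ^ q)) = cmod w"
      using q by (simp add: norm_power real_root_power_cancel)
    have "w ^ (q - 1) * cnj (w ^ q) = cnj w * of_real (cmod w ^ (2 * (q - 1)))"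
    proof -
      obtain n where n: "q = Suc n" using q gr0_conv_Suc by blast
      have "w ^ n * cnj (w ^ Suc n) = cnj w * (w * cnj w) ^ n"
        by (simp add: power_mult_distrib)
      also have "w * cnj w = of_real ((cmod w)\<^sup>2)" by (rule complex_norm_square[symmetric])
      finally show ?thesis by (simp add: n power_mult)
    qed
    then have eq: "w ^ (q - 1) * \<kappa> (w ^ q)
        = cnj w * of_real (cmod w ^ (2 * (q - 1)) / (max (cmod w) e) ^ (2 * (q - 1)))"
      unfolding \<kappa>_def rt by (simp add: mult.assoc[symmetric])
    show ?thesis
    proof (cases "cmod w \<le> e")
      case True
      define t where "t = cmod w ^ (2 * (q - 1)) / (max (cmod w) e) ^ (2 * (q - 1))"
      have t: "0 \<le> t" "t \<le> 1"
        using \<open>e > 0\<close> by (auto simp: t_def divide_le_eq intro!: power_mono zero_less_power)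
      have "cnj w - w ^ (q - 1) * \<kappa> (w ^ q) = cnj w * of_real (1 - t)"
        unfolding eq t_def[symmetric] by (simp add: algebra_simps)
      then have "cmod (cnj w - w ^ (q - 1) * \<kappa> (w ^ q)) = cmod w * (1 - t)"
        using t by (simp only: norm_mult norm_of_real complex_mod_cnj abs_of_nonneg diff_ge_0_iff_ge)
      also have "\<dots> \<le> cmod w * 1" using t by (intro mult_left_mono) auto
      finally show ?thesis using True by simp
    next
      case False
      then have "max (cmod w) e = cmod w" "cmod w \<noteq> 0" using \<open>e > 0\<close> by auto
      then show ?thesis unfolding eq using \<open>e > 0\<close> by simp
    qed
  qed
  then show "\<exists>g\<in>closed_algebra X G. \<forall>x\<in>X. cmod (cnj (a x) - g x) \<le> e"
    by (intro bexI[OF _ mem]) simp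
qed

section \<open>Gaussian integrals of complex quadratic forms\<close>

lemma lborel_nn_integral_affine:
  fixes f :: "'a::euclidean_space \<Rightarrow> ennreal"
  assumes [measurable]: "f \<in> borel_measurable borel" and c: "c \<noteq> 0"
  shows "(\<integral>\<^sup>+x. f x \<partial>lborel) = ennreal (\<bar>c\<bar> ^ DIM('a)) * (\<integral>\<^sup>+x. f (t + c *\<^sub>R x) \<partial>lborel)"
  by (subst lborel_affine[OF c, of t])
     (simp add: nn_integral_density nn_integral_distr nn_integral_cmult)

lemma lborel_integrable_affine:
  fixes f :: "'a::euclidean_space \<Rightarrow> 'b::{banach, second_countable_topology}"
  assumes f: "integrable lborel f" and c: "c \<noteq> 0"
  shows "integrable lborel (\<lambda>x. f (t + c *\<^sub>R x))"
  using f f[THEN borel_measurable_integrable] c unfolding integrable_iff_bounded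
  by (subst (asm) lborel_nn_integral_affine[where c=c and t=t])
     (auto simp: ennreal_mult_less_top)

lemma lborel_integral_affine:
  fixes f :: "'a::euclidean_space \<Rightarrow> 'b::{banach, second_countable_topology}"
  assumes c: "c \<noteq> 0" and f[measurable]: "integrable lborel f"
  shows "(\<integral>x. f x \<partial>lborel) = \<bar>c\<bar> ^ DIM('a) *\<^sub>R (\<integral>x. f (t + c *\<^sub>R x) \<partial>lborel)"
  using c f f[THEN borel_measurable_integrable] lborel_integrable_affine[OF f c, of t]
  by (subst lborel_affine[OF c, of t]) (simp add: integral_density integral_distr)

lemma integrable_gaussian_real:
  fixes a :: real assumes "a > 0"
  shows "integrable lborel (\<lambda>x::real. exp (- a * x\<^sup>2))"
proof -
  define \<sigma> where "\<sigma> = 1 / sqrt (2 * a)"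
  have \<sigma>: "\<sigma> > 0" "2 * \<sigma>\<^sup>2 = 1 / a" using assms by (auto simp: \<sigma>_def power_divide)
  have "integrable lborel (\<lambda>x. normal_density 0 \<sigma> x)"
    using normal_moment_even[OF \<sigma>(1), of 0 0] by (auto simp: has_bochner_integral_iff)
  then have "integrable lborel (\<lambda>x. sqrt (2 * pi * \<sigma>\<^sup>2) * normal_density 0 \<sigma> x)" by simp
  moreover have "sqrt (2 * pi * \<sigma>\<^sup>2) * normal_density 0 \<sigma> x = exp (- a * x\<^sup>2)" for x
    using \<sigma> by (simp add: normal_density_def)
  ultimately show ?thesis by simp
qed

lemma integrable_gaussian:
  fixes a :: real assumes "a > 0"
  shows "integrable lborel (\<lambda>v::'a::euclidean_space. exp (- a * (norm v)\<^sup>2))"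
proof (rule integrableI_bounded)
  have "(\<integral>\<^sup>+(v::'a). ennreal (norm (exp (- a * (norm v)\<^sup>2))) \<partial>lborel)
      = (\<integral>\<^sup>+(v::'a). (\<Prod>b\<in>Basis. ennreal (exp (- a * (v \<bullet> b)\<^sup>2))) \<partial>lborel)"
  proof (rule nn_integral_cong)
    fix v :: 'a
    have "(norm v)\<^sup>2 = (\<Sum>b\<in>Basis. (v \<bullet> b)\<^sup>2)"
      unfolding power2_norm_eq_inner by (subst euclidean_inner) (simp add: power2_eq_square)
    then have "exp (- a * (norm v)\<^sup>2) = (\<Prod>b\<in>Basis. exp (- a * (v \<bullet> b)\<^sup>2))"
      by (simp only: sum_distrib_left exp_sum[OF finite_Basis])
    then show "ennreal (norm (exp (- a * (norm v)\<^sup>2))) = (\<Prod>b\<in>Basis. ennreal (exp (- a * (v \<bullet> b)\<^sup>2)))"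
      by (simp add: prod_ennreal prod_nonneg)
  qed
  also have "\<dots> = (\<Prod>b\<in>(Basis::'a set). \<integral>\<^sup>+x. ennreal (exp (- a * x\<^sup>2)) \<partial>lborel)"
    by (rule nn_integral_lborel_prod) auto
  also have "\<dots> < \<infinity>"
    using integrable_gaussian_real[OF assms]
    by (auto simp: integrable_iff_bounded less_top[symmetric] power_eq_top_ennreal)
  finally show "(\<integral>\<^sup>+(v::'a). ennreal (norm (exp (- a * (norm v)\<^sup>2))) \<partial>lborel) < \<infinity>" .
qed measurable

lemma integrable_gaussian_bound:
  fixes f :: "'a::euclidean_space \<Rightarrow> 'b::{banach, second_countable_topology}"
  assumes "a > 0" "f \<in> borel_measurable borel" "\<And>v. norm (f v) \<le> M * exp (- a * (norm v)\<^sup>2)"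
  shows "integrable lborel f"
proof (rule Bochner_Integration.integrable_bound)
  show "integrable lborel (\<lambda>v::'a. M * exp (- a * (norm v)\<^sup>2))"
    using integrable_gaussian[OF assms(1)] by (rule integrable_mult_right)
  show "AE v in lborel. norm (f v) \<le> norm (M * exp (- a * (norm v)\<^sup>2))"
    using assms(3) by (intro AE_I2) (metis abs_ge_self order_trans real_norm_def)
qed (use assms in auto)

text \<open>The square is an integral over pairs \<open>(v, w)\<close>; the substitution \<open>v = y + u / 2\<close>, \<open>w = y - u / 2\<close>
has Jacobian \<open>1\<close> and is carried out by a reflection in the inner integral and, after Fubini, a
translation in the other.\<close>

lemma norm_integral_squared:
  fixes \<psi> :: "'a::euclidean_space \<Rightarrow> complex"
  assumes a: "a > 0" and cont: "continuous_on UNIV \<psi>"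
    and bound: "\<And>v. cmod (\<psi> v) \<le> exp (- a * (norm v)\<^sup>2)"
  shows "of_real ((cmod (\<integral>v. \<psi> v \<partial>lborel))\<^sup>2)
       = (\<integral>u. (\<integral>y. \<psi> (y + (1/2) *\<^sub>R u) * cnj (\<psi> (y - (1/2) *\<^sub>R u)) \<partial>lborel) \<partial>lborel)"
proof -
  have meas: "\<psi> \<in> borel_measurable borel" using cont by (rule borel_measurable_continuous_onI)
  have int: "integrable lborel \<psi>"
    by (rule integrable_gaussian_bound[OF a meas, of 1]) (use bound in simp)
  let ?I = "\<integral>v. \<psi> v \<partial>lborel"
  define F where "F v u = \<psi> v * cnj (\<psi> (v - u))" for v u
  have "integrable lborel (\<lambda>x. case x of (v, u) \<Rightarrow> F v u)"
  proof (rule integrable_gaussian_bound[of "a / 4" _ 1])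
    have "continuous_on UNIV (\<lambda>x. case x of (v, u) \<Rightarrow> F v u)"
      unfolding F_def case_prod_unfold
      by (intro continuous_intros continuous_on_compose2[OF cont]) auto
    then show "(\<lambda>x. case x of (v, u) \<Rightarrow> F v u) \<in> borel_measurable borel"
      by (rule borel_measurable_continuous_onI)
    fix x :: "'a \<times> 'a"
    obtain v u where x: "x = (v, u)" by force
    have "(norm u)\<^sup>2 \<le> (norm v + norm (v - u))\<^sup>2"
      using norm_triangle_ineq4[of v "v - u"] by (intro power_mono) auto
    also have "\<dots> \<le> 2 * (norm v)\<^sup>2 + 2 * (norm (v - u))\<^sup>2"
      using sum_squares_bound[of "norm v" "norm (v - u)"] by (simp add: power2_sum)
    finally have *: "((norm v)\<^sup>2 + (norm u)\<^sup>2) / 4 \<le> (norm v)\<^sup>2 + (norm (v - u))\<^sup>2"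
      using zero_le_power2[of "norm v"] zero_le_power2[of "norm (v - u)"] by argo
    have "cmod (F v u) \<le> exp (- a * (norm v)\<^sup>2) * exp (- a * (norm (v - u))\<^sup>2)"
      unfolding F_def norm_mult complex_mod_cnj by (intro mult_mono bound) auto
    also have "\<dots> = exp (- a * ((norm v)\<^sup>2 + (norm (v - u))\<^sup>2))"
      by (simp add: exp_add[symmetric] algebra_simps)
    also have "\<dots> \<le> exp (- (a / 4) * (norm x)\<^sup>2)"
      using mult_left_mono[OF *, of a] a by (simp add: x norm_Pair)
    finally show "norm (case x of (v, u) \<Rightarrow> F v u) \<le> 1 * exp (- (a / 4) * (norm x)\<^sup>2)"
      by (simp add: x)
  qed (use a in auto)
  then have Fint: "integrable (lborel \<Otimes>\<^sub>M lborel) (\<lambda>(v, u). F v u)"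
    by (simp add: lborel_prod)
  have "of_real ((cmod ?I)\<^sup>2) = ?I * cnj ?I" by (rule complex_norm_square)
  also have "\<dots> = (\<integral>v. \<psi> v * cnj ?I \<partial>lborel)" by simp
  also have "\<dots> = (\<integral>v. (\<integral>u. F v u \<partial>lborel) \<partial>lborel)"
  proof (rule Bochner_Integration.integral_cong[OF refl])
    fix v
    have "?I = (\<integral>u. \<psi> (v - u) \<partial>lborel)"
      using lborel_integral_affine[OF _ int, of "-1" v] by simp
    then show "\<psi> v * cnj ?I = (\<integral>u. F v u \<partial>lborel)"
      by (simp add: F_def integral_cnj)
  qed
  also have "\<dots> = (\<integral>u. (\<integral>v. F v u \<partial>lborel) \<partial>lborel)"
    by (rule lborel_pair.Fubini_integral[OF Fint, symmetric])
  also have "\<dots> = (\<integral>u. (\<integral>y. \<psi> (y + (1/2) *\<^sub>R u) * cnj (\<psi> (y - (1/2) *\<^sub>R u)) \<partial>lborel) \<partial>lborel)"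
  proof (rule Bochner_Integration.integral_cong[OF refl])
    fix u
    have "integrable lborel (\<lambda>v. F v u)"
    proof (rule integrable_gaussian_bound[OF a, of _ 1])
      have "continuous_on UNIV (\<lambda>v. F v u)"
        unfolding F_def by (intro continuous_intros continuous_on_compose2[OF cont]) auto
      then show "(\<lambda>v. F v u) \<in> borel_measurable borel"
        by (rule borel_measurable_continuous_onI)
      have "cmod (\<psi> v) \<le> 1" for v
        by (rule order_trans[OF bound]) (use a in auto)
      then show "cmod (F v u) \<le> 1 * exp (- a * (norm v)\<^sup>2)" for v
        unfolding F_def norm_mult complex_mod_cnj mult.commute[of 1]
        by (intro mult_mono bound) auto
    qed
    from lborel_integral_affine[OF _ this, of 1 "(1/2) *\<^sub>R u"]
    have "(\<integral>v. F v u \<partial>lborel) = (\<integral>y. F ((1/2) *\<^sub>R u + y) u \<partial>lborel)" by simp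
    moreover have "F ((1/2) *\<^sub>R u + y) u = \<psi> (y + (1/2) *\<^sub>R u) * cnj (\<psi> (y - (1/2) *\<^sub>R u))" for y
    proof -
      have "(1/2) *\<^sub>R u + y - u = y - (1/2) *\<^sub>R u"
        using scaleR_left_distrib[of "1/2" "1/2" u] by (simp add: algebra_simps)
      then show ?thesis by (simp only: F_def) (simp only: add.commute)
    qed
    ultimately show "(\<integral>v. F v u \<partial>lborel) = (\<integral>y. \<psi> (y + (1/2) *\<^sub>R u) * cnj (\<psi> (y - (1/2) *\<^sub>R u)) \<partial>lborel)"
      by simp
  qed
  finally show ?thesis .
qed

text \<open>Let \<open>A\<close> and \<open>B\<close> be the real and the imaginary part of \<open>\<beta>\<close>.  By \<open>norm_integral_squared\<close> and the
parallelogram identity, the squared modulus of the integral is the integral of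
\<open>exp (- A u / 2) * P u\<close>, where \<open>P\<close> is the Fourier transform of a real Gaussian in the frequency
given by \<open>B\<close>.  The same identity applied to a Gaussian with half the variance shows that \<open>P\<close> is,
up to a positive constant, itself a squared modulus, so \<open>P \<ge> 0\<close>.  If the integral vanished, the
continuous function \<open>P\<close> would be zero almost everywhere, hence everywhere, but \<open>P 0\<close> is the
integral of a positive function.\<close>

lemma gaussian_integral_nonzero:
  fixes \<beta> :: "'a::euclidean_space \<Rightarrow> 'a \<Rightarrow> complex"
  assumes bil: "bounded_bilinear \<beta>" and sym: "\<And>x y. \<beta> x y = \<beta> y x"
    and a: "a > 0" and pos: "\<And>v. Re (\<beta> v v) \<ge> a * (norm v)\<^sup>2"
  shows "(\<integral>v. exp (- \<beta> v v) \<partial>lborel) \<noteq> 0"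
proof
  assume zero: "(\<integral>v. exp (- \<beta> v v) \<partial>lborel) = 0"
  interpret bounded_bilinear \<beta> by fact
  note [continuous_intros] = continuous_on
  define A where "A x = Re (\<beta> x x)" for x
  define B where "B x y = Im (\<beta> x y)" for x y
  have A_ge: "A v \<ge> a * (norm v)\<^sup>2" for v using pos by (simp add: A_def)
  have A0: "A v \<ge> 0" for v using A_ge[of v] a by (meson less_imp_le mult_nonneg_nonneg order_trans zero_le_power2)
  have contA[continuous_intros]: "continuous_on UNIV A"
    unfolding A_def by (intro continuous_intros)
  have par: "\<beta> (y + (1/2) *\<^sub>R u) (y + (1/2) *\<^sub>R u) + cnj (\<beta> (y - (1/2) *\<^sub>R u) (y - (1/2) *\<^sub>R u))
      = of_real (2 * A y + A u / 2) + of_real (2 * B y u) * \<i>" for y u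
    by (simp add: complex_eq_iff A_def B_def add_left add_right diff_left diff_right
         scaleR_left scaleR_right sym[of u y] field_simps)
  define P where "P u = (\<integral>y. exp (- of_real (2 * A y) - of_real (2 * B y u) * \<i>) \<partial>lborel)" for u
  have contB[continuous_intros]: "continuous_on UNIV (\<lambda>y. B y u)" for u
    unfolding B_def by (intro continuous_intros)
  have measP: "(\<lambda>y. exp (- of_real (2 * A y) - of_real (2 * B y u) * \<i>)) \<in> borel_measurable borel" for u
    by (intro borel_measurable_continuous_onI continuous_intros contA contB)
  have boundP: "norm (exp (- of_real (2 * A y) - of_real (2 * B y u) * \<i>)) \<le> 1 * exp (- (2 * a) * (norm y)\<^sup>2)" for y u
    using A_ge[of y] by simp
  have intP: "integrable lborel (\<lambda>y. exp (- of_real (2 * A y) - of_real (2 * B y u) * \<i>))" for u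
    by (rule integrable_gaussian_bound[OF _ measP boundP]) (use a in simp)
  \<comment> \<open>By \<open>par\<close> the integrand over \<open>y\<close> splits into a factor in \<open>u\<close> and the one defining \<open>P\<close>.\<close>
  have "of_real ((cmod (\<integral>v. exp (- \<beta> v v) \<partial>lborel))\<^sup>2)
      = (\<integral>u. (\<integral>y. exp (- \<beta> (y + (1/2) *\<^sub>R u) (y + (1/2) *\<^sub>R u)) * cnj (exp (- \<beta> (y - (1/2) *\<^sub>R u) (y - (1/2) *\<^sub>R u))) \<partial>lborel) \<partial>lborel)"
    by (rule norm_integral_squared[OF a]) (use A_ge in \<open>auto simp: A_def intro!: continuous_intros\<close>)
  also have "\<dots> = (\<integral>u. exp (- of_real (A u / 2)) * P u \<partial>lborel)"
  proof (rule Bochner_Integration.integral_cong[OF refl])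
    fix u
    have "exp (- \<beta> (y + (1/2) *\<^sub>R u) (y + (1/2) *\<^sub>R u)) * cnj (exp (- \<beta> (y - (1/2) *\<^sub>R u) (y - (1/2) *\<^sub>R u)))
      = exp (- of_real (A u / 2)) * exp (- of_real (2 * A y) - of_real (2 * B y u) * \<i>)" for y
    proof -
      have "exp (- \<beta> (y + (1/2) *\<^sub>R u) (y + (1/2) *\<^sub>R u)) * cnj (exp (- \<beta> (y - (1/2) *\<^sub>R u) (y - (1/2) *\<^sub>R u)))
        = exp (- (\<beta> (y + (1/2) *\<^sub>R u) (y + (1/2) *\<^sub>R u) + cnj (\<beta> (y - (1/2) *\<^sub>R u) (y - (1/2) *\<^sub>R u))))"
        by (simp add: exp_cnj exp_add[symmetric])
      then show ?thesis unfolding par by (simp add: exp_add[symmetric] algebra_simps)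
    qed
    then show "(\<integral>y. exp (- \<beta> (y + (1/2) *\<^sub>R u) (y + (1/2) *\<^sub>R u)) * cnj (exp (- \<beta> (y - (1/2) *\<^sub>R u) (y - (1/2) *\<^sub>R u))) \<partial>lborel)
       = exp (- of_real (A u / 2)) * P u"
      by (simp add: P_def)
  qed
  finally have sum0: "(\<integral>u. exp (- of_real (A u / 2)) * P u \<partial>lborel) = 0"
    using zero by simp
  \<comment> \<open>In \<open>P_eq\<close> the coefficient of \<open>A\<close> is \<open>4\<close> because the parallelogram identity turns it into
    \<open>8 * A y + 2 * A w\<close>, and \<open>2 * A w\<close> is the exponent in \<open>P\<close>.\<close>
  define C where "C = (\<integral>y. exp (- (8 * A y)) \<partial>lborel)"
  have intC: "integrable lborel (\<lambda>y. exp (- (r * A y)))" if "r > 0" for r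
    by (rule integrable_gaussian_bound[of "r * a" _ 1])
       (use that a A_ge in \<open>auto intro!: borel_measurable_continuous_onI continuous_intros contA\<close>)
  have pos_int: "(\<integral>y. exp (- (r * A y)) \<partial>lborel) > 0" if "r > 0" for r
  proof -
    have "(\<integral>y. exp (- (r * A y)) \<partial>lborel) \<noteq> 0"
    proof
      assume "(\<integral>y. exp (- (r * A y)) \<partial>lborel) = 0"
      then have "AE y in lborel. exp (- (r * A y)) = 0"
        using integral_nonneg_eq_0_iff_AE[OF intC[OF that]] by auto
      then have "AE y in (lborel :: 'a measure). False" by simp
      then show False by (simp add: eventually_False ae_filter_eq_bot_iff)
    qed
    moreover have "(\<integral>y. exp (- (r * A y)) \<partial>lborel) \<ge> 0" by (intro integral_nonneg_AE) auto
    ultimately show ?thesis by (metis less_eq_real_def)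
  qed
  have P_eq: "of_real ((cmod (\<integral>v. exp (- of_real (4 * A v) - of_real (2 * B v u) * \<i>) \<partial>lborel))\<^sup>2) = of_real C * P u" for u
  proof -
    let ?\<psi> = "\<lambda>v. exp (- of_real (4 * A v) - of_real (2 * B v u) * \<i>)"
    have par2: "4 * A (y + (1/2) *\<^sub>R w) + 4 * A (y - (1/2) *\<^sub>R w) = 8 * A y + 2 * A w" for y w
      by (simp add: A_def add_left add_right diff_left diff_right scaleR_left scaleR_right sym[of w y] field_simps)
    have B2: "B (y + (1/2) *\<^sub>R w) u - B (y - (1/2) *\<^sub>R w) u = B w u" for y w
      by (simp add: B_def add_left diff_left scaleR_left)
    have "of_real ((cmod (\<integral>v. ?\<psi> v \<partial>lborel))\<^sup>2)
       = (\<integral>w. (\<integral>y. ?\<psi> (y + (1/2) *\<^sub>R w) * cnj (?\<psi> (y - (1/2) *\<^sub>R w)) \<partial>lborel) \<partial>lborel)"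
      by (rule norm_integral_squared[of "4 * a"])
         (use a A_ge in \<open>auto intro!: continuous_intros contA contB\<close>)
    also have "\<dots> = (\<integral>w. of_real C * exp (- of_real (2 * A w) - of_real (2 * B w u) * \<i>) \<partial>lborel)"
    proof (rule Bochner_Integration.integral_cong[OF refl])
      fix w
      have "?\<psi> (y + (1/2) *\<^sub>R w) * cnj (?\<psi> (y - (1/2) *\<^sub>R w))
        = of_real (exp (- (8 * A y))) * exp (- of_real (2 * A w) - of_real (2 * B w u) * \<i>)" for y
      proof -
        have "?\<psi> (y + (1/2) *\<^sub>R w) * cnj (?\<psi> (y - (1/2) *\<^sub>R w))
          = exp (- of_real (4 * A (y + (1/2) *\<^sub>R w) + 4 * A (y - (1/2) *\<^sub>R w))
               - of_real (2 * (B (y + (1/2) *\<^sub>R w) u - B (y - (1/2) *\<^sub>R w) u)) * \<i>)"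
          by (simp add: exp_cnj exp_add[symmetric] algebra_simps)
        also have "\<dots> = of_real (exp (- (8 * A y))) * exp (- of_real (2 * A w) - of_real (2 * B w u) * \<i>)"
          unfolding par2 B2 exp_of_real[symmetric] by (simp add: exp_add[symmetric] algebra_simps)
        finally show ?thesis .
      qed
      then show "(\<integral>y. ?\<psi> (y + (1/2) *\<^sub>R w) * cnj (?\<psi> (y - (1/2) *\<^sub>R w)) \<partial>lborel)
         = of_real C * exp (- of_real (2 * A w) - of_real (2 * B w u) * \<i>)"
        by (simp add: C_def)
    qed
    also have "\<dots> = of_real C * P u" by (simp add: P_def)
    finally show ?thesis .
  qed
  define Q where "Q u = (cmod (\<integral>v. exp (- of_real (4 * A v) - of_real (2 * B v u) * \<i>) \<partial>lborel))\<^sup>2 / C" for u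
  have C: "C > 0" using pos_int[of 8] by (simp add: C_def)
  have PQ: "P u = of_real (Q u)" for u using P_eq[of u] C by (simp add: Q_def)
  have Q0: "Q u \<ge> 0" for u using C by (simp add: Q_def)
  have contP: "continuous_on UNIV P"
    unfolding continuous_on_sequentially
  proof (intro allI ballI impI)
    fix X :: "nat \<Rightarrow> 'a" and l assume "(\<forall>n. X n \<in> UNIV) \<and> X \<longlonglongrightarrow> l"
    then have X: "X \<longlonglongrightarrow> l" by blast
    show "(P \<circ> X) \<longlonglongrightarrow> P l" unfolding P_def comp_def
    proof (rule integral_dominated_convergence[where w = "\<lambda>y. 1 * exp (- (2 * a) * (norm y)\<^sup>2)"])
      show "integrable lborel (\<lambda>y::'a. 1 * exp (- (2 * a) * (norm y)\<^sup>2))"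
        using integrable_gaussian[of "2 * a"] a by simp
      show "AE y in lborel. (\<lambda>i. exp (- of_real (2 * A y) - of_real (2 * B y (X i)) * \<i>))
          \<longlonglongrightarrow> exp (- of_real (2 * A y) - of_real (2 * B y l) * \<i>)"
        unfolding B_def by (intro AE_I2 tendsto_intros tendsto tendsto_const X)
      show "AE y in lborel. norm (exp (- of_real (2 * A y) - of_real (2 * B y (X i)) * \<i>))
          \<le> 1 * exp (- (2 * a) * (norm y)\<^sup>2)" for i
        using boundP by blast
    qed (use measP in auto)
  qed
  have contQ: "continuous_on UNIV Q"
  proof -
    have "Q = (\<lambda>u. Re (P u))" by (simp add: PQ fun_eq_iff)
    then show ?thesis using contP by (simp add: continuous_on_Re)
  qed
  have intQ: "integrable lborel (\<lambda>u. exp (- (A u / 2)) * Q u)"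
  proof (rule integrable_gaussian_bound[of "a / 2" _ "\<integral>y. exp (- (2 * A y)) \<partial>lborel"])
    show "(\<lambda>u. exp (- (A u / 2)) * Q u) \<in> borel_measurable borel"
      by (intro borel_measurable_continuous_onI continuous_intros contA contQ) auto
    fix u
    have "Q u = cmod (P u)" using PQ[of u] Q0[of u] by simp
    also have "\<dots> \<le> (\<integral>y. norm (exp (- of_real (2 * A y) - of_real (2 * B y u) * \<i>)) \<partial>lborel)"
      unfolding P_def by (rule integral_norm_bound)
    finally have "Q u \<le> (\<integral>y. exp (- (2 * A y)) \<partial>lborel)" by simp
    moreover have "exp (- (A u / 2)) \<le> exp (- (a / 2) * (norm u)\<^sup>2)" using A_ge[of u] by simp
    ultimately have "exp (- (A u / 2)) * Q u \<le> exp (- (a / 2) * (norm u)\<^sup>2) * (\<integral>y. exp (- (2 * A y)) \<partial>lborel)"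
      using Q0 by (intro mult_mono) auto
    then show "norm (exp (- (A u / 2)) * Q u) \<le> (\<integral>y. exp (- (2 * A y)) \<partial>lborel) * exp (- (a / 2) * (norm u)\<^sup>2)"
      using Q0[of u] by (simp add: abs_mult mult.commute)
  qed (use a in auto)
  have "complex_of_real (\<integral>u. exp (- (A u / 2)) * Q u \<partial>lborel) = (\<integral>u. exp (- of_real (A u / 2)) * P u \<partial>lborel)"
    unfolding integral_complex_of_real[symmetric] PQ by (simp add: exp_of_real[symmetric])
  then have "(\<integral>u. exp (- (A u / 2)) * Q u \<partial>lborel) = 0" using sum0 by simp
  then have "AE u in lborel. exp (- (A u / 2)) * Q u = 0"
    using integral_nonneg_eq_0_iff_AE[OF intQ] Q0 by auto
  then have ae: "AE u in lborel. Q u = 0" by simp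
  have "Q 0 > 0"
  proof -
    have "P 0 = of_real (\<integral>y. exp (- (2 * A y)) \<partial>lborel)"
      unfolding P_def integral_complex_of_real[symmetric] by (simp add: B_def zero_right exp_of_real[symmetric])
    then show ?thesis using PQ[of 0] pos_int[of 2] by simp
  qed
  moreover have "open {u. Q u > 0}"
    using contQ by (intro open_Collect_less continuous_intros) auto
  ultimately have "\<not> negligible {u. Q u > 0}"
    by (intro open_not_negligible) auto
  moreover have "{u. Q u > 0} \<in> null_sets lborel"
  proof (subst AE_iff_null_sets)
    show "{u. Q u > 0} \<in> sets lborel" using \<open>open {u. Q u > 0}\<close> by simp
    show "AE u in lborel. u \<notin> {u. Q u > 0}" using ae by (rule eventually_mono) simp
  qed
  ultimately show False
    using negligible_iff_null_sets null_sets_completionI by blast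
qed

section \<open>Strict derivatives\<close>

lemma lipschitz_imp_continuous_on:
  assumes "0 \<le> c" "\<And>y z. y \<in> A \<Longrightarrow> z \<in> A \<Longrightarrow> norm (f y - f z) \<le> c * norm (y - z)"
  shows "continuous_on A f"
  using assms by (intro lipschitz_on_continuous_on[OF lipschitz_onI]) (auto simp: dist_norm)

text \<open>Difference quotients at moving base points and in moving directions.  This is what the kernel limit
uses along sequences, it composes without estimates, and it makes \<open>x \<mapsto> L x\<close> continuous by
itself (\<open>has_strict_derivative_continuous\<close>).\<close>

definition has_strict_derivative ::
    "('a::real_normed_vector \<Rightarrow> 'b::real_normed_vector) \<Rightarrow> ('a \<Rightarrow> 'b) \<Rightarrow> 'a \<Rightarrow> bool" where
  "has_strict_derivative f L x \<longleftrightarrow> bounded_linear L \<and>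
     (\<forall>X s v w. X \<longlonglongrightarrow> x \<longrightarrow> s \<longlonglongrightarrow> 0 \<longrightarrow> (\<forall>k. s k > 0) \<longrightarrow> v \<longlonglongrightarrow> w \<longrightarrow>
        (\<lambda>k. (f (X k + s k *\<^sub>R v k) - f (X k)) /\<^sub>R s k) \<longlonglongrightarrow> L w)"

lemma has_strict_derivativeD:
  assumes "has_strict_derivative f L x" "X \<longlonglongrightarrow> x" "s \<longlonglongrightarrow> 0" "\<And>k. s k > 0" "v \<longlonglongrightarrow> w"
  shows "(\<lambda>k. (f (X k + s k *\<^sub>R v k) - f (X k)) /\<^sub>R s k) \<longlonglongrightarrow> L w"
  using assms unfolding has_strict_derivative_def by blast

lemma has_strict_derivative_Lipschitz:
  assumes d: "has_strict_derivative f L x" and U: "open U" "x \<in> U"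
    and lip: "\<And>y z. y \<in> U \<Longrightarrow> z \<in> U \<Longrightarrow> norm (f y - f z) \<le> c * norm (y - z)"
  shows "norm (L w) \<le> c * norm w"
proof -
  let ?s = "\<lambda>k. inverse (real (Suc k))"
  have lim: "(\<lambda>k. (f (x + ?s k *\<^sub>R w) - f x) /\<^sub>R ?s k) \<longlonglongrightarrow> L w"
    by (rule has_strict_derivativeD[OF d tendsto_const LIMSEQ_inverse_real_of_nat _ tendsto_const]) simp
  have "(\<lambda>k. x + ?s k *\<^sub>R w) \<longlonglongrightarrow> x + 0 *\<^sub>R w"
    by (intro tendsto_intros LIMSEQ_inverse_real_of_nat)
  then have "\<forall>\<^sub>F k in sequentially. x + ?s k *\<^sub>R w \<in> U"
    using U by (intro topological_tendstoD) auto
  then have "\<forall>\<^sub>F k in sequentially. norm ((f (x + ?s k *\<^sub>R w) - f x) /\<^sub>R ?s k) \<le> c * norm w"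
  proof eventually_elim
    case (elim k)
    have "norm (f (x + ?s k *\<^sub>R w) - f x) \<le> c * (?s k * norm w)"
      using lip[OF elim U(2)] by simp
    then show ?case by (simp add: divide_simps) (simp add: algebra_simps)
  qed
  then show ?thesis
    using tendsto_norm[OF lim] by (intro tendsto_upperbound) auto
qed

text \<open>Diagonal choice: \<open>L (X k) w\<close> is within \<open>1 / (k + 1)\<close> of a difference quotient at \<open>X k\<close> with step
at most \<open>1 / (k + 1)\<close>, and these quotients converge to \<open>L x w\<close>.\<close>

lemma has_strict_derivative_continuous:
  assumes d: "\<And>x. x \<in> U \<Longrightarrow> has_strict_derivative f (L x) x"
    and X: "\<And>k. X k \<in> U" "x \<in> U" "X \<longlonglongrightarrow> x"
  shows "(\<lambda>k. L (X k) w) \<longlonglongrightarrow> L x w"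
proof -
  let ?s = "\<lambda>k. inverse (real (Suc k))"
  have "\<exists>t. 0 < t \<and> t \<le> ?s k \<and> norm ((f (X k + t *\<^sub>R w) - f (X k)) /\<^sub>R t - L (X k) w) < ?s k" for k
  proof -
    have "(\<lambda>j. (f (X k + ?s j *\<^sub>R w) - f (X k)) /\<^sub>R ?s j) \<longlonglongrightarrow> L (X k) w"
      by (rule has_strict_derivativeD[OF d[OF X(1)] tendsto_const LIMSEQ_inverse_real_of_nat _ tendsto_const]) simp
    then have "\<forall>\<^sub>F j in sequentially. dist ((f (X k + ?s j *\<^sub>R w) - f (X k)) /\<^sub>R ?s j) (L (X k) w) < ?s k"
      by (rule tendstoD) simp
    then obtain N where N: "\<And>j. j \<ge> N \<Longrightarrow> dist ((f (X k + ?s j *\<^sub>R w) - f (X k)) /\<^sub>R ?s j) (L (X k) w) < ?s k"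
      unfolding eventually_sequentially by blast
    show ?thesis
      using N[of "max N k"] by (intro exI[of _ "?s (max N k)"]) (auto simp: dist_norm intro!: le_imp_inverse_le)
  qed
  then obtain t where t: "\<And>k. 0 < t k" "\<And>k. t k \<le> ?s k"
     "\<And>k. norm ((f (X k + t k *\<^sub>R w) - f (X k)) /\<^sub>R t k - L (X k) w) < ?s k" by metis
  have "t \<longlonglongrightarrow> 0"
    by (rule real_tendsto_sandwich[OF _ _ tendsto_const LIMSEQ_inverse_real_of_nat])
       (use t(2) t(1)[THEN less_imp_le] in \<open>auto intro!: always_eventually\<close>)
  then have 1: "(\<lambda>k. (f (X k + t k *\<^sub>R w) - f (X k)) /\<^sub>R t k) \<longlonglongrightarrow> L x w"
    by (intro has_strict_derivativeD[OF d[OF X(2)] X(3)] t tendsto_const)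
  have 2: "(\<lambda>k. (f (X k + t k *\<^sub>R w) - f (X k)) /\<^sub>R t k - L (X k) w) \<longlonglongrightarrow> 0"
    by (rule Lim_null_comparison[OF _ LIMSEQ_inverse_real_of_nat])
       (use t(3)[THEN less_imp_le] in \<open>auto intro!: always_eventually\<close>)
  from tendsto_diff[OF 1 2] show ?thesis by simp
qed

text \<open>The mean value inequality for \<open>f\<close> minus its linearisation at \<open>x\<close>, on a ball where the derivative
varies little.\<close>

lemma C1_on_has_strict_derivative:
  fixes f :: "'a::real_normed_vector \<Rightarrow> 'b::real_normed_vector"
  assumes f: "C1_on f U" and U: "open U" "x \<in> U"
  shows "\<exists>L. has_strict_derivative f L x"
proof -
  obtain f' :: "'a \<Rightarrow> 'a \<Rightarrow>\<^sub>L 'b" where f': "\<And>x. x \<in> U \<Longrightarrow> (f has_derivative blinfun_apply (f' x)) (at x)"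
    "continuous_on U f'"
    using f unfolding C1_on_def by blast
  have "has_strict_derivative f (blinfun_apply (f' x)) x"
    unfolding has_strict_derivative_def
  proof (intro conjI allI impI)
    show "bounded_linear (blinfun_apply (f' x))" by (rule blinfun.bounded_linear_right)
    fix X s v w
    assume X: "X \<longlonglongrightarrow> x" and s: "s \<longlonglongrightarrow> (0::real)" "\<forall>k. 0 < s k" and v: "v \<longlonglongrightarrow> (w::'a)"
    let ?q = "\<lambda>k. (f (X k + s k *\<^sub>R v k) - f (X k)) /\<^sub>R s k"
    have Xv: "(\<lambda>k. X k + s k *\<^sub>R v k) \<longlonglongrightarrow> x"
      using tendsto_add[OF X tendsto_scaleR[OF s(1) v]] by simp
    obtain B where B: "B > 0" "\<And>k. norm (v k) \<le> B"
      using convergent_imp_bounded[OF v] unfolding bounded_pos by auto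
    have "(\<lambda>k. ?q k - blinfun_apply (f' x) (v k)) \<longlonglongrightarrow> 0"
    proof (rule tendstoI)
      fix e :: real assume "e > 0"
      define e' where "e' = e / (2 * B)"
      have e': "e' > 0" using \<open>e > 0\<close> B by (simp add: e'_def)
      have "\<forall>\<^sub>F y in at x within U. dist (f' y) (f' x) < e'"
        using f'(2) U(2) e' unfolding continuous_on_def by (auto intro: tendstoD)
      then obtain d1 where d1: "d1 > 0" "\<And>y. y \<in> U \<Longrightarrow> dist y x < d1 \<Longrightarrow> dist (f' y) (f' x) < e'"
        unfolding eventually_at using e' by (metis dist_self)
      obtain d2 where d2: "d2 > 0" "ball x d2 \<subseteq> U" using U openE by blast
      define S where "S = ball x (min d1 d2)"
      have "\<forall>\<^sub>F k in sequentially. X k \<in> S" "\<forall>\<^sub>F k in sequentially. X k + s k *\<^sub>R v k \<in> S"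
        by (intro topological_tendstoD[OF X] topological_tendstoD[OF Xv]; use d1 d2 in \<open>simp add: S_def\<close>)+
      then show "\<forall>\<^sub>F k in sequentially. dist (?q k - blinfun_apply (f' x) (v k)) 0 < e"
      proof eventually_elim
        case (elim k)
        have "norm (f (X k + s k *\<^sub>R v k) - f (X k) - blinfun_apply (f' x) ((X k + s k *\<^sub>R v k) - X k))
          \<le> norm ((X k + s k *\<^sub>R v k) - X k) * e'"
        proof (rule differentiable_bound_linearization[where S = S])
          show "X k + t *\<^sub>R (X k + s k *\<^sub>R v k - X k) \<in> S" if "t \<in> {0..1}" for t
          proof -
            have "(1 - t) *\<^sub>R X k + t *\<^sub>R (X k + s k *\<^sub>R v k) \<in> S"
              using elim that convex_ball[of x "min d1 d2"] unfolding S_def by (intro convexD) auto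
            then show ?thesis by (simp add: algebra_simps)
          qed
          show "(f has_derivative blinfun_apply (f' y)) (at y within S)" if "y \<in> S" for y
          proof -
            have "y \<in> U" using that d2(2) by (auto simp: S_def)
            then show ?thesis using f'(1) has_derivative_at_withinI by blast
          qed
          show "onorm (blinfun_apply (f' y) - blinfun_apply (f' x)) \<le> e'" if "y \<in> S" for y
          proof -
            have "norm (f' y - f' x) < e'"
              using d1(2)[of y] that d2 by (auto simp: S_def dist_norm norm_minus_commute)
            then show ?thesis by (simp add: norm_blinfun.rep_eq minus_blinfun.rep_eq fun_diff_def)
          qed
          show "x \<in> S" using d1 d2 by (simp add: S_def)
        qed
        then have *: "norm (f (X k + s k *\<^sub>R v k) - f (X k) - s k *\<^sub>R blinfun_apply (f' x) (v k)) \<le> s k * norm (v k) * e'"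
          using s(2) by (simp add: blinfun.scaleR_right abs_of_pos)
        have "?q k - blinfun_apply (f' x) (v k)
          = (f (X k + s k *\<^sub>R v k) - f (X k) - s k *\<^sub>R blinfun_apply (f' x) (v k)) /\<^sub>R s k"
          using s(2)[rule_format, of k] by (simp add: scaleR_diff_right)
        then have "norm (?q k - blinfun_apply (f' x) (v k))
          = norm (f (X k + s k *\<^sub>R v k) - f (X k) - s k *\<^sub>R blinfun_apply (f' x) (v k)) / s k"
          using s(2)[rule_format, of k] by (simp only: norm_scaleR) (simp add: divide_inverse)
        also have "\<dots> \<le> norm (v k) * e'"
          using * s(2)[rule_format, of k] by (simp add: divide_le_eq mult_ac)
        also have "\<dots> \<le> B * e'" using B e' by (intro mult_right_mono) auto
        also have "\<dots> < e" using B \<open>e > 0\<close> by (simp add: e'_def)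
        finally show ?case by simp
      qed
    qed
    moreover have "(\<lambda>k. blinfun_apply (f' x) (v k)) \<longlonglongrightarrow> blinfun_apply (f' x) w"
      by (intro tendsto_intros v)
    ultimately show "?q \<longlonglongrightarrow> blinfun_apply (f' x) w"
      using tendsto_add by fastforce
  qed
  then show ?thesis by blast
qed

text \<open>A continuous branch of the root has the expected strict derivative, since
\<open>a ^ q - b ^ q = (a - b) * (\<Sum>i<q. b ^ (q - Suc i) * a ^ i)\<close> expresses the difference quotient
through values of the branch.\<close>

lemma root_branch_quotient:
  fixes r :: "complex \<Rightarrow> complex"
  assumes q: "q > 0" and x: "x \<noteq> 0" and r: "isCont r x" "\<And>w. w \<noteq> 0 \<Longrightarrow> r w ^ q = w"
    and X: "X \<longlonglongrightarrow> x" and s: "s \<longlonglongrightarrow> (0::real)" "\<And>k. 0 < s k" and v: "v \<longlonglongrightarrow> w"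
  shows "(\<lambda>k. (r (X k + s k *\<^sub>R v k) - r (X k)) /\<^sub>R s k) \<longlonglongrightarrow> w / (of_nat q * r x ^ (q - 1))"
proof -
  have Xv: "(\<lambda>k. X k + s k *\<^sub>R v k) \<longlonglongrightarrow> x"
    using tendsto_add[OF X tendsto_scaleR[OF s(1) v]] by simp
  define D where "D k = (\<Sum>i<q. r (X k) ^ (q - Suc i) * r (X k + s k *\<^sub>R v k) ^ i)" for k
  have rx: "r x \<noteq> 0" using r(2)[OF x] x q by (metis power_eq_0_iff)
  have "D \<longlonglongrightarrow> (\<Sum>i<q. r x ^ (q - Suc i) * r x ^ i)"
    unfolding D_def by (intro tendsto_intros isCont_tendsto_compose[OF r(1)] X Xv)
  also have "(\<Sum>i<q. r x ^ (q - Suc i) * r x ^ i) = (\<Sum>i<q. r x ^ (q - 1))"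
    by (intro sum.cong) (auto simp: power_add[symmetric])
  finally have D: "D \<longlonglongrightarrow> of_nat q * r x ^ (q - 1)" by simp
  have ne: "of_nat q * r x ^ (q - 1) \<noteq> 0" using q rx by simp
  have lim: "(\<lambda>k. v k / D k) \<longlonglongrightarrow> w / (of_nat q * r x ^ (q - 1))"
    by (intro tendsto_divide v D ne)
  have "\<forall>\<^sub>F k in sequentially. D k \<noteq> 0" "\<forall>\<^sub>F k in sequentially. X k \<noteq> 0"
    "\<forall>\<^sub>F k in sequentially. X k + s k *\<^sub>R v k \<noteq> 0"
    using tendsto_imp_eventually_ne[OF D ne] tendsto_imp_eventually_ne[OF X x]
      tendsto_imp_eventually_ne[OF Xv x] by auto
  then have "\<forall>\<^sub>F k in sequentially. v k / D k = (r (X k + s k *\<^sub>R v k) - r (X k)) /\<^sub>R s k"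
  proof eventually_elim
    case (elim k)
    have "s k *\<^sub>R v k = r (X k + s k *\<^sub>R v k) ^ q - r (X k) ^ q" using elim r(2) by simp
    also have "\<dots> = (r (X k + s k *\<^sub>R v k) - r (X k)) * D k"
      unfolding D_def by (rule power_diff_sumr2)
    finally have "r (X k + s k *\<^sub>R v k) - r (X k) = s k *\<^sub>R v k / D k"
      using elim by (simp add: field_simps)
    then show ?case using s(2)[of k] by (simp add: scaleR_conv_of_real field_simps)
  qed
  from Lim_transform_eventually[OF lim this] show ?thesis .
qed

section \<open>Approximation by a complex Gaussian kernel\<close>

lemma continuous_on_mult_support:
  fixes f g :: "'a::topological_space \<Rightarrow> 'b::real_normed_algebra"
  assumes f: "continuous_on UNIV f" "\<And>x. x \<notin> C \<Longrightarrow> f x = 0"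
    and C: "closed C" "C \<subseteq> U" "open U" and g: "continuous_on U g"
  shows "continuous_on UNIV (\<lambda>x. f x * g x)"
proof -
  have "continuous_on U (\<lambda>x. f x * g x)"
    by (intro continuous_on_mult g continuous_on_subset[OF f(1)]) auto
  moreover have "continuous_on (- C) (\<lambda>x. f x * g x)"
    by (rule continuous_on_eq[OF continuous_on_const[of _ 0]]) (use f(2) in auto)
  moreover have "U \<union> - C = UNIV" using C by auto
  ultimately show ?thesis
    using continuous_on_open_Un[of U "- C" "\<lambda>x. f x * g x"] C by (simp add: open_Compl)
qed

text \<open>The integral is a uniform limit of Riemann sums: by uniform continuity the integrand may be replaced
by a function that is constant in \<open>\<xi>\<close> on each piece of a finite measurable partition of \<open>C\<close>.\<close>

lemma closed_algebra_integral:
  fixes \<Phi> :: "'a::metric_space \<Rightarrow> 'b::euclidean_space \<Rightarrow> complex"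
  assumes Y: "compact Y" and C: "compact C"
    and cont: "continuous_on (Y \<times> C) (\<lambda>(z, \<xi>). \<Phi> z \<xi>)"
    and mem: "\<And>\<xi>. \<xi> \<in> C \<Longrightarrow> (\<lambda>z. \<Phi> z \<xi>) \<in> closed_algebra Y G"
  shows "(\<lambda>z. \<integral>\<xi>. indicator C \<xi> *\<^sub>R \<Phi> z \<xi> \<partial>lborel) \<in> closed_algebra Y G"
proof (rule closed_algebra_limit_le)
  fix e :: real assume "e > 0"
  define \<epsilon> where "\<epsilon> = e / (measure lborel C + 1)"
  have \<epsilon>: "\<epsilon> > 0" "\<epsilon> * measure lborel C \<le> e"
    using \<open>e > 0\<close> by (auto simp: \<epsilon>_def divide_simps add_nonneg_pos mult_left_mono)
  have "uniformly_continuous_on (Y \<times> C) (\<lambda>(z, \<xi>). \<Phi> z \<xi>)"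
    using cont by (intro compact_uniformly_continuous compact_Times Y C)
  then obtain d where d: "d > 0"
    "\<And>z \<xi> \<xi>'. z \<in> Y \<Longrightarrow> \<xi> \<in> C \<Longrightarrow> \<xi>' \<in> C \<Longrightarrow> dist \<xi> \<xi>' < d \<Longrightarrow> dist (\<Phi> z \<xi>) (\<Phi> z \<xi>') < \<epsilon>"
    unfolding uniformly_continuous_on_def using \<epsilon>(1)
    by (force simp: dist_Pair_Pair)
  obtain N where N: "finite N" "N \<subseteq> C" "C \<subseteq> (\<Union>x\<in>N. ball x d)"
    using compactE_image[OF C, of C "\<lambda>x. ball x d"] d(1) by (metis UN_I centre_in_ball open_ball subsetI)
  obtain xs where xs: "set xs = N" using finite_list[OF N(1)] by blast
  define n where "n = length xs"
  define B where "B i = (if i < n then C \<inter> ball (xs ! i) d else {})" for i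
  define D where "D = disjointed B"
  have BC: "B i \<in> sets borel" for i using compact_imp_closed[OF C] by (auto simp: B_def)
  have Dm[measurable]: "D i \<in> sets borel" for i
    using sets.range_disjointed_sets[of B borel] BC by (auto simp: D_def)
  have DB: "D i \<subseteq> B i" for i unfolding D_def by (rule disjointed_subset)
  have UD: "(\<Union>i. D i) = C"
  proof -
    have "(\<Union>i. B i) = C"
    proof
      show "C \<subseteq> (\<Union>i. B i)"
      proof
        fix \<xi> assume "\<xi> \<in> C"
        then obtain x where "x \<in> set xs" "\<xi> \<in> ball x d" using N(3) xs by auto
        then obtain i where "i < n" "x = xs ! i" by (auto simp: n_def in_set_conv_nth)
        then show "\<xi> \<in> (\<Union>i. B i)" using \<open>\<xi> \<in> C\<close> \<open>\<xi> \<in> ball x d\<close> by (auto simp: B_def)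
      qed
    qed (auto simp: B_def)
    then show ?thesis by (simp add: D_def UN_disjointed_eq)
  qed
  have DC: "D i \<subseteq> C" for i using UD by (metis UN_upper UNIV_I)
  have Cfin: "emeasure lborel C < \<infinity>" by (rule emeasure_compact_finite[OF C])
  have Dfin: "emeasure lborel (D i) < \<infinity>" for i
  proof -
    have "emeasure lborel (D i) \<le> emeasure lborel C"
      by (intro emeasure_mono DC) (simp add: borel_compact[OF C])
    then show ?thesis using Cfin by (rule le_less_trans)
  qed
  define s where "s z \<xi> = (\<Sum>i<n. indicator (D i) \<xi> *\<^sub>R \<Phi> z (xs ! i))" for z \<xi>
  have xsC: "xs ! i \<in> C" if "i < n" for i using that N(2) nth_mem[of i xs] by (auto simp: xs n_def)
  have intD: "integrable lborel (\<lambda>\<xi>. indicator (D i) \<xi> *\<^sub>R \<Phi> z (xs ! i))" for i z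
    using Dfin[of i] Dm[of i] by (intro integrable_scaleR_left) simp
  have ints: "(\<integral>\<xi>. s z \<xi> \<partial>lborel) = (\<Sum>i<n. of_real (measure lborel (D i)) * \<Phi> z (xs ! i))" for z
    unfolding s_def using intD
    by (subst Bochner_Integration.integral_sum) (simp_all add: scaleR_conv_of_real)
  have "cmod ((\<integral>\<xi>. indicator C \<xi> *\<^sub>R \<Phi> z \<xi> \<partial>lborel) - (\<Sum>i<n. of_real (measure lborel (D i)) * \<Phi> z (xs ! i))) \<le> e"
    if z: "z \<in> Y" for z
  proof -
    have contz: "continuous_on C (\<Phi> z)"
    proof -
      have "continuous_on C (\<lambda>\<xi>. (z, \<xi>))" by (intro continuous_intros)
      moreover have "(\<lambda>\<xi>. (z, \<xi>)) ` C \<subseteq> Y \<times> C" using z by blast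
      ultimately have "continuous_on C (\<lambda>\<xi>. case (z, \<xi>) of (z, \<xi>) \<Rightarrow> \<Phi> z \<xi>)"
        by (rule continuous_on_compose2[OF cont])
      then show ?thesis by simp
    qed
    have int: "integrable lborel (\<lambda>\<xi>. indicator C \<xi> *\<^sub>R \<Phi> z \<xi>)"
      using borel_integrable_compact[OF C contz] by (simp add: indicator_scaleR_eq_if)
    have pt: "cmod (indicator C \<xi> *\<^sub>R \<Phi> z \<xi> - s z \<xi>) \<le> \<epsilon> * indicator C \<xi>" for \<xi>
    proof (cases "\<xi> \<in> C")
      case True
      then obtain i where i: "\<xi> \<in> D i" using UD by blast
      then have B: "\<xi> \<in> B i" using DB by blast
      then have "i < n" by (auto simp: B_def split: if_splits)
      have "indicator (D j) \<xi> = (0::real)" if "j \<noteq> i" for j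
        using disjoint_family_disjointed[of B] i that
        by (auto simp: disjoint_family_on_def D_def indicator_def)
      then have "s z \<xi> = (\<Sum>j<n. if j = i then \<Phi> z (xs ! i) else 0)"
        unfolding s_def using i by (intro sum.cong) auto
      also have "\<dots> = \<Phi> z (xs ! i)" using \<open>i < n\<close> by simp
      finally have "s z \<xi> = \<Phi> z (xs ! i)" .
      moreover have "dist (\<Phi> z \<xi>) (\<Phi> z (xs ! i)) < \<epsilon>"
        using B \<open>i < n\<close> by (intro d z xsC) (auto simp: B_def dist_commute)
      ultimately show ?thesis using True by (simp add: dist_norm)
    next
      case False
      then have "\<xi> \<notin> D i" for i using UD by blast
      then show ?thesis using False by (simp add: s_def)
    qed
    have int_s: "integrable lborel (s z)"
      unfolding s_def by (intro Bochner_Integration.integrable_sum intD)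
    have "(\<integral>\<xi>. indicator C \<xi> *\<^sub>R \<Phi> z \<xi> \<partial>lborel) - (\<integral>\<xi>. s z \<xi> \<partial>lborel)
        = (\<integral>\<xi>. indicator C \<xi> *\<^sub>R \<Phi> z \<xi> - s z \<xi> \<partial>lborel)"
      by (rule Bochner_Integration.integral_diff[OF int int_s, symmetric])
    also have "cmod \<dots> \<le> (\<integral>\<xi>. \<epsilon> * indicator C \<xi> \<partial>lborel)"
    proof (rule Bochner_Integration.integral_norm_bound_integral)
      show "integrable lborel (\<lambda>\<xi>. indicator C \<xi> *\<^sub>R \<Phi> z \<xi> - s z \<xi>)"
        by (rule Bochner_Integration.integrable_diff[OF int int_s])
      show "integrable lborel (\<lambda>\<xi>. \<epsilon> * indicator C \<xi>)"
        using Cfin compact_imp_closed[OF C] by (auto simp: borel_closed)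
    qed (rule pt)
    also have "\<dots> = \<epsilon> * measure lborel C"
      by simp
    finally show ?thesis using \<epsilon>(2) by (simp add: ints)
  qed
  then have close: "\<forall>z\<in>Y. cmod ((\<integral>\<xi>. indicator C \<xi> *\<^sub>R \<Phi> z \<xi> \<partial>lborel) - (\<Sum>i<n. of_real (measure lborel (D i)) * \<Phi> z (xs ! i))) \<le> e"
    by (rule ballI)
  have "(\<lambda>z. \<Sum>i<n. of_real (measure lborel (D i)) * \<Phi> z (xs ! i)) \<in> closed_algebra Y G"
  proof (rule closed_algebra_sum)
    fix i assume "i \<in> {..<n}"
    then show "(\<lambda>z. of_real (measure lborel (D i)) * \<Phi> z (xs ! i)) \<in> closed_algebra Y G"
      by (intro closed_algebra_cmult[OF mem] xsC) simp
  qed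
  then show "\<exists>g\<in>closed_algebra Y G. \<forall>z\<in>Y. cmod ((\<integral>\<xi>. indicator C \<xi> *\<^sub>R \<Phi> z \<xi> \<partial>lborel) - g z) \<le> e"
    by (rule bexI[where x = "\<lambda>z. \<Sum>i<n. of_real (measure lborel (D i)) * \<Phi> z (xs ! i)", rotated]) (rule close)
qed

lemma uniform_from_sequential:
  fixes T :: "real \<Rightarrow> 'a::metric_space \<Rightarrow> 'b::metric_space"
  assumes Y: "compact Y" and g: "continuous_on Y g" and "e > 0"
    and lim: "\<And>s z l. \<lbrakk>s \<longlonglongrightarrow> 0; \<And>k. s k > 0; \<And>k. z k \<in> Y; z \<longlonglongrightarrow> l; l \<in> Y\<rbrakk>
       \<Longrightarrow> (\<lambda>k. T (s k) (z k)) \<longlonglongrightarrow> g l"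
  shows "\<exists>s>0. \<forall>z\<in>Y. dist (T s z) (g z) < e"
proof (rule ccontr)
  assume neg: "\<not> ?thesis"
  let ?s = "\<lambda>k. inverse (real (Suc k))"
  have "\<exists>z\<in>Y. dist (T (?s k) z) (g z) \<ge> e" for k
    using neg by (metis inverse_positive_iff_positive not_less of_nat_0_less_iff zero_less_Suc)
  then obtain z where z: "\<And>k. z k \<in> Y" "\<And>k. dist (T (?s k) (z k)) (g (z k)) \<ge> e" by metis
  then obtain l r where l: "l \<in> Y" "strict_mono r" "(z \<circ> r) \<longlonglongrightarrow> l"
    using Y unfolding compact_eq_seq_compact_metric seq_compact_def by metis
  have "(\<lambda>k. T (?s (r k)) (z (r k))) \<longlonglongrightarrow> g l"
    using l z LIMSEQ_subseq_LIMSEQ[OF LIMSEQ_inverse_real_of_nat l(2)]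
    by (intro lim) (auto simp: o_def)
  moreover have "(\<lambda>k. g (z (r k))) \<longlonglongrightarrow> g l"
    using g l z unfolding continuous_on_sequentially by (auto simp: o_def)
  ultimately have "(\<lambda>k. dist (T (?s (r k)) (z (r k))) (g (z (r k)))) \<longlonglongrightarrow> dist (g l) (g l)"
    by (rule tendsto_dist)
  then have "e \<le> dist (g l) (g l)"
    by (rule tendsto_lowerbound) (use z in auto)
  then show False using \<open>e > 0\<close> by simp
qed

text \<open>The complex structure enters only through the bilinear form \<open>b\<close>, which will be
\<open>\<Sum>\<^sub>j v\<^sub>j * w\<^sub>j\<close>.  With \<open>|v|\<^sup>2 = b v (cnj v)\<close> the expression \<open>phase z \<xi>\<close> below is then
\<open>b (z - \<xi>) (g z - g \<xi>)\<close> for \<open>g z = cnj z + S z\<close>.\<close>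

locale gaussian_kernel =
  fixes b :: "'a::euclidean_space \<Rightarrow> 'a \<Rightarrow> complex" and S :: "'a \<Rightarrow> 'a" and L :: "'a \<Rightarrow> 'a \<Rightarrow> 'a"
    and U Y :: "'a set" and c :: real
  assumes b: "bounded_bilinear b" and b_le: "\<And>v w. cmod (b v w) \<le> norm v * norm w"
    and U: "open U" and Y: "compact Y"
    and c: "0 \<le> c" "c < 1"
    and lip: "\<And>y z. y \<in> Y \<union> U \<Longrightarrow> z \<in> Y \<union> U \<Longrightarrow> norm (S y - S z) \<le> c * norm (y - z)"
    and strict: "\<And>z. z \<in> U \<Longrightarrow> has_strict_derivative S (L z) z"
begin

definition phase :: "'a \<Rightarrow> 'a \<Rightarrow> complex" where
  "phase z \<xi> = of_real ((norm (z - \<xi>))\<^sup>2) + b (z - \<xi>) (S z - S \<xi>)"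

text \<open>The limit of \<open>phase z (z + s * v) / s\<^sup>2\<close> as \<open>s\<close> tends to \<open>0\<close>.\<close>

definition quadratic_part :: "'a \<Rightarrow> 'a \<Rightarrow> complex" where
  "quadratic_part z v = of_real ((norm v)\<^sup>2) + b v (L z v)"

definition mass :: "'a \<Rightarrow> complex" where
  "mass z = (\<integral>v. exp (- quadratic_part z v) \<partial>lborel)"

text \<open>The average of \<open>f\<close> against the kernel of width \<open>s\<close>, written in the rescaled variable
\<open>v = (\<xi> - z) / s\<close>, in which dominated convergence applies; \<open>average_change\<close> returns to \<open>\<xi>\<close>.\<close>

definition average :: "('a \<Rightarrow> complex) \<Rightarrow> real \<Rightarrow> 'a \<Rightarrow> complex" where
  "average f s z = (\<integral>v. f (z + s *\<^sub>R v) * exp (- phase z (z + s *\<^sub>R v) / of_real (s\<^sup>2)) \<partial>lborel)"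

interpretation b: bounded_bilinear b by (rule b)

lemma contS: "continuous_on (Y \<union> U) S"
  by (rule lipschitz_imp_continuous_on[OF c(1) lip])

lemma Re_perturbed:
  assumes "norm w \<le> c * norm v"
  shows "Re (of_real ((norm v)\<^sup>2) + b v w) \<ge> (1 - c) * (norm v)\<^sup>2"
proof -
  have "- Re (b v w) \<le> cmod (b v w)" using abs_Re_le_cmod[of "b v w"] by linarith
  also have "\<dots> \<le> norm v * norm w" by (rule b_le)
  also have "\<dots> \<le> norm v * (c * norm v)" using assms by (intro mult_left_mono) auto
  finally show ?thesis by (simp add: algebra_simps power2_eq_square)
qed

lemma Re_phase:
  assumes "z \<in> Y \<union> U" "\<xi> \<in> Y \<union> U"
  shows "Re (phase z \<xi>) \<ge> (1 - c) * (norm (z - \<xi>))\<^sup>2"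
  unfolding phase_def by (rule Re_perturbed[OF lip[OF assms]])

lemma Re_quadratic_part:
  assumes "z \<in> U" shows "Re (quadratic_part z v) \<ge> (1 - c) * (norm v)\<^sup>2"
  unfolding quadratic_part_def
  by (rule Re_perturbed, rule has_strict_derivative_Lipschitz[OF strict[OF assms] U assms]) (use lip in auto)

lemma exp_quadratic_part_bound: "z \<in> U \<Longrightarrow> cmod (exp (- quadratic_part z v)) \<le> 1 * exp (- (1 - c) * (norm v)\<^sup>2)"
  using Re_quadratic_part[of z v] by (simp add: algebra_simps)

lemma measurable_exp_quadratic_part:
  assumes "z \<in> U" shows "(\<lambda>v. exp (- quadratic_part z v)) \<in> borel_measurable borel"
proof -
  have "bounded_linear (L z)" using strict[OF assms] by (simp add: has_strict_derivative_def)
  then have "continuous_on UNIV (L z)" by (rule linear_continuous_on)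
  then show ?thesis unfolding quadratic_part_def
    by (intro borel_measurable_continuous_onI continuous_intros b.continuous_on) auto
qed

text \<open>The exponent is the diagonal of the symmetrised form \<open>\<beta>\<close>, whose real part is at least
\<open>(1 - c) * |v|\<^sup>2\<close>.\<close>

lemma mass_nonzero:
  assumes z: "z \<in> U" shows "mass z \<noteq> 0"
proof -
  have L: "bounded_linear (L z)" using strict[OF z] by (simp add: has_strict_derivative_def)
  define \<beta> where "\<beta> x y = of_real (x \<bullet> y) + (b x (L z y) + b y (L z x)) / 2" for x y
  interpret L: bounded_linear "L z" by (rule L)
  have L_le: "norm (L z v) \<le> c * norm v" for v
    by (rule has_strict_derivative_Lipschitz[OF strict[OF z] U z]) (use lip in auto)
  have "bounded_bilinear \<beta>"
  proof
    show "\<exists>K. \<forall>x y. norm (\<beta> x y) \<le> norm x * norm y * K"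
    proof (intro exI allI)
      fix x y
      have *: "cmod (b x (L z y)) \<le> c * (norm x * norm y)" for x y
      proof -
        have "cmod (b x (L z y)) \<le> norm x * norm (L z y)" by (rule b_le)
        also have "\<dots> \<le> norm x * (c * norm y)" by (intro mult_left_mono L_le) auto
        finally show ?thesis by (simp add: algebra_simps)
      qed
      have "cmod (b x (L z y) + b y (L z x)) \<le> c * (norm x * norm y) + c * (norm y * norm x)"
        by (intro norm_triangle_le add_mono *)
      moreover have "cmod (of_real (x \<bullet> y)) \<le> norm x * norm y"
        using Cauchy_Schwarz_ineq2[of x y] by simp
      ultimately have "cmod (\<beta> x y) \<le> norm x * norm y + (c * (norm x * norm y) + c * (norm y * norm x)) / 2"
        unfolding \<beta>_def by (intro norm_triangle_le add_mono) (auto simp: norm_divide)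
      then show "cmod (\<beta> x y) \<le> norm x * norm y * (1 + c)" by (simp add: algebra_simps)
    qed
  qed (auto simp: \<beta>_def b.add_left b.add_right b.scaleR_left b.scaleR_right L.add L.scaleR
         inner_add_left inner_add_right scaleR_conv_of_real field_simps)
  moreover have "\<beta> v v = quadratic_part z v" for v
    by (simp add: \<beta>_def quadratic_part_def power2_norm_eq_inner)
  ultimately show ?thesis
    unfolding mass_def using gaussian_integral_nonzero[of \<beta> "1 - c"] Re_quadratic_part[OF z] c
    by (simp add: \<beta>_def inner_commute add.commute)
qed

lemma continuous_mass: "continuous_on U mass"
  unfolding continuous_on_sequentially
proof (intro allI ballI impI)
  fix X :: "nat \<Rightarrow> 'a" and l assume "l \<in> U" "(\<forall>n. X n \<in> U) \<and> X \<longlonglongrightarrow> l"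
  then have X: "\<And>n. X n \<in> U" "X \<longlonglongrightarrow> l" by blast+
  show "(mass \<circ> X) \<longlonglongrightarrow> mass l" unfolding mass_def comp_def
  proof (rule integral_dominated_convergence[where w = "\<lambda>v. 1 * exp (- (1 - c) * (norm v)\<^sup>2)"])
    show "integrable lborel (\<lambda>v::'a. 1 * exp (- (1 - c) * (norm v)\<^sup>2))"
      using c by (intro integrable_mult_right integrable_gaussian) auto
    show "AE v in lborel. (\<lambda>i. exp (- quadratic_part (X i) v)) \<longlonglongrightarrow> exp (- quadratic_part l v)"
      unfolding quadratic_part_def
      by (intro AE_I2 tendsto_intros b.tendsto has_strict_derivative_continuous[OF strict X(1) \<open>l \<in> U\<close> X(2)])
    show "AE v in lborel. norm (exp (- quadratic_part (X i) v)) \<le> 1 * exp (- (1 - c) * (norm v)\<^sup>2)" for i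
      using exp_quadratic_part_bound[OF X(1)] by blast
  qed (use measurable_exp_quadratic_part X \<open>l \<in> U\<close> in auto)
qed

context
  fixes f :: "'a \<Rightarrow> complex" and C
  assumes f: "continuous_on UNIV f" "\<And>x. x \<notin> C \<Longrightarrow> f x = 0" and C: "compact C" "C \<subseteq> U"
begin

lemma continuous_phase: "z \<in> Y \<Longrightarrow> continuous_on U (phase z)"
  unfolding phase_def
  by (intro continuous_intros b.continuous_on continuous_on_subset[OF contS]) auto

lemma continuous_integrand:
  assumes "z \<in> Y" "s > 0"
  shows "continuous_on UNIV (\<lambda>\<xi>. f \<xi> * exp (- phase z \<xi> / of_real (s\<^sup>2)))"
  using assms by (intro continuous_on_mult_support[OF f _ C(2) U] continuous_intros continuous_phase compact_imp_closed C) auto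

lemma average_change:
  assumes "z \<in> Y" "s > 0"
  shows "average f s z = (\<integral>\<xi>. indicator C \<xi> *\<^sub>R (of_real (1 / s ^ DIM('a)) * (f \<xi> * exp (- phase z \<xi> / of_real (s\<^sup>2)))) \<partial>lborel)"
proof -
  let ?g = "\<lambda>\<xi>. f \<xi> * exp (- phase z \<xi> / of_real (s\<^sup>2))"
  have ind: "?g = (\<lambda>\<xi>. indicator C \<xi> *\<^sub>R ?g \<xi>)" using f(2) by (auto simp: fun_eq_iff indicator_def)
  have "integrable lborel (\<lambda>\<xi>. indicator C \<xi> *\<^sub>R ?g \<xi>)"
    using borel_integrable_compact[OF C(1) continuous_on_subset[OF continuous_integrand[OF assms]]]
    by (simp add: indicator_scaleR_eq_if)
  then have "integrable lborel ?g" by (subst ind)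
  from lborel_integral_affine[OF _ this, of s z] assms
  have eq: "(\<integral>\<xi>. ?g \<xi> \<partial>lborel) = s ^ DIM('a) *\<^sub>R average f s z" by (simp add: average_def)
  have "(\<integral>\<xi>. indicator C \<xi> *\<^sub>R (of_real (1 / s ^ DIM('a)) * ?g \<xi>) \<partial>lborel) = (\<integral>\<xi>. of_real (1 / s ^ DIM('a)) * ?g \<xi> \<partial>lborel)"
    by (rule Bochner_Integration.integral_cong) (use f(2) in \<open>auto simp: indicator_def\<close>)
  also have "\<dots> = of_real (1 / s ^ DIM('a)) * (\<integral>\<xi>. ?g \<xi> \<partial>lborel)"
    by (rule integral_mult_right_zero)
  also have "\<dots> = average f s z" using assms unfolding eq by (simp add: scaleR_conv_of_real)
  finally show ?thesis by simp
qed

text \<open>Dominated convergence, with a Gaussian majorant from \<open>Re_phase\<close>.  Outside \<open>U\<close>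
the kernel may have no limit, but it is bounded by \<open>1\<close> on the support of \<open>f\<close>, and \<open>f\<close> tends to \<open>0\<close>.\<close>

lemma average_limit:
  assumes s: "s \<longlonglongrightarrow> 0" "\<And>k. s k > 0" and z: "\<And>k. z k \<in> Y" "z \<longlonglongrightarrow> l" "l \<in> Y"
  shows "(\<lambda>k. average f (s k) (z k)) \<longlonglongrightarrow> f l * mass l"
proof -
  obtain M where M: "\<And>x. cmod (f x) \<le> M" "M > 0"
  proof -
    have "bounded (f ` C)" by (intro compact_imp_bounded compact_continuous_image continuous_on_subset[OF f(1)] C(1)) auto
    then obtain M where "M > 0" "\<And>x. x \<in> C \<Longrightarrow> cmod (f x) \<le> M" unfolding bounded_pos by auto
    then have "cmod (f x) \<le> M" for x using f(2)[of x] by (cases "x \<in> C") auto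
    with \<open>M > 0\<close> that show thesis by blast
  qed
  let ?I = "\<lambda>k v. f (z k + s k *\<^sub>R v) * exp (- phase (z k) (z k + s k *\<^sub>R v) / of_real ((s k)\<^sup>2))"
  have bound: "cmod (?I k v) \<le> M * exp (- (1 - c) * (norm v)\<^sup>2)" for k v
  proof (cases "z k + s k *\<^sub>R v \<in> C")
    case True
    then have "(1 - c) * (norm (s k *\<^sub>R v))\<^sup>2 \<le> Re (phase (z k) (z k + s k *\<^sub>R v))"
      using Re_phase[of "z k" "z k + s k *\<^sub>R v"] z C by auto
    then have "(1 - c) * (norm v)\<^sup>2 \<le> Re (phase (z k) (z k + s k *\<^sub>R v)) / (s k)\<^sup>2"
      using s(2)[of k] by (simp add: power_mult_distrib field_simps)
    also have "\<dots> = Re (phase (z k) (z k + s k *\<^sub>R v) / of_real ((s k)\<^sup>2))"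
      by (simp only: Re_divide_of_real)
    finally show ?thesis
      unfolding norm_mult norm_exp_eq_Re using M
      by (intro mult_mono) (auto simp: algebra_simps simp del: of_real_power)
  next
    case False
    then show ?thesis using f(2) M(2) by simp
  qed
  have lim_pt: "(\<lambda>k. z k + s k *\<^sub>R v) \<longlonglongrightarrow> l" for v
    using tendsto_add[OF z(2) tendsto_scaleR[OF s(1) tendsto_const[of v]]] by simp
  have lim_f: "(\<lambda>k. f (z k + s k *\<^sub>R v)) \<longlonglongrightarrow> f l" for v
    using f(1) lim_pt[of v] unfolding continuous_on_sequentially by (auto simp: o_def)
  have meas: "?I k \<in> borel_measurable borel" for k
  proof -
    have "continuous_on UNIV (\<lambda>v. z k + s k *\<^sub>R v)" by (intro continuous_intros)
    from continuous_on_compose2[OF continuous_integrand[OF z(1)[of k] s(2)[of k]] this]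
    show ?thesis by (intro borel_measurable_continuous_onI) simp
  qed
  have dom: "integrable lborel (\<lambda>v::'a. M * exp (- (1 - c) * (norm v)\<^sup>2))"
    using c by (intro integrable_mult_right integrable_gaussian) auto
  show ?thesis
  proof (cases "l \<in> U")
    case True
    have "(\<lambda>k. ?I k v) \<longlonglongrightarrow> f l * exp (- quadratic_part l v)" for v
    proof -
      have "(\<lambda>k. of_real ((norm v)\<^sup>2) + b v ((S (z k + s k *\<^sub>R v) - S (z k)) /\<^sub>R s k)) \<longlonglongrightarrow> quadratic_part l v"
        unfolding quadratic_part_def by (intro tendsto_intros b.tendsto has_strict_derivativeD[OF strict[OF True] z(2) s tendsto_const])
      moreover have "phase (z k) (z k + s k *\<^sub>R v) / of_real ((s k)\<^sup>2)
          = of_real ((norm v)\<^sup>2) + b v ((S (z k + s k *\<^sub>R v) - S (z k)) /\<^sub>R s k)" for k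
      proof -
        define w where "w = S (z k + s k *\<^sub>R v) - S (z k)"
        have "S (z k) - S (z k + s k *\<^sub>R v) = - w" "z k - (z k + s k *\<^sub>R v) = - (s k *\<^sub>R v)"
          by (simp_all add: w_def)
        then show ?thesis
          using s(2)[of k] unfolding phase_def w_def[symmetric]
          by (simp add: b.scaleR_left b.scaleR_right b.minus_left b.minus_right)
             (simp add: scaleR_conv_of_real field_simps power2_eq_square)
      qed
      ultimately have "(\<lambda>k. phase (z k) (z k + s k *\<^sub>R v) / of_real ((s k)\<^sup>2)) \<longlonglongrightarrow> quadratic_part l v" by presburger
      then have "(\<lambda>k. f (z k + s k *\<^sub>R v) * exp (- (phase (z k) (z k + s k *\<^sub>R v) / of_real ((s k)\<^sup>2)))) \<longlonglongrightarrow> f l * exp (- quadratic_part l v)"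
        by (intro tendsto_mult tendsto_exp tendsto_minus lim_f)
      then show ?thesis by simp
    qed
    then have "(\<lambda>k. average f (s k) (z k)) \<longlonglongrightarrow> (\<integral>v. f l * exp (- quadratic_part l v) \<partial>lborel)"
      unfolding average_def
      by (intro integral_dominated_convergence[OF _ _ dom]) (use meas measurable_exp_quadratic_part[OF True] bound in auto)
    then show ?thesis by (simp add: mass_def)
  next
    case False
    then have fl: "f l = 0" using f(2) C by blast
    have "(\<lambda>k. ?I k v) \<longlonglongrightarrow> 0" for v
    proof (rule Lim_null_comparison)
      show "(\<lambda>k. cmod (f (z k + s k *\<^sub>R v))) \<longlonglongrightarrow> 0"
        using tendsto_norm[OF lim_f[of v]] fl by simp
      have "cmod (?I k v) \<le> cmod (f (z k + s k *\<^sub>R v))" for k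
      proof (cases "z k + s k *\<^sub>R v \<in> C")
        case True
        have "0 \<le> (1 - c) * (norm (z k - (z k + s k *\<^sub>R v)))\<^sup>2" using c by simp
        also have "\<dots> \<le> Re (phase (z k) (z k + s k *\<^sub>R v))"
          using Re_phase[of "z k" "z k + s k *\<^sub>R v"] True z C by auto
        finally have "0 \<le> Re (phase (z k) (z k + s k *\<^sub>R v) / of_real ((s k)\<^sup>2))"
          by (simp only: Re_divide_of_real) simp
        then show ?thesis
          unfolding norm_mult norm_exp_eq_Re by (intro mult_left_le) (auto simp del: of_real_power)
      next
        case False
        then show ?thesis using f(2) by simp
      qed
      then show "\<forall>\<^sub>F k in sequentially. cmod (?I k v) \<le> cmod (f (z k + s k *\<^sub>R v))" by simp
    qed
    then have "(\<lambda>k. average f (s k) (z k)) \<longlonglongrightarrow> (\<integral>v. 0 \<partial>(lborel::'a measure))"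
      unfolding average_def
      by (intro integral_dominated_convergence[OF _ _ dom]) (use meas bound in auto)
    then show ?thesis by (simp add: fl)
  qed
qed

lemma average_mem:
  assumes s: "s > 0" and mem: "\<And>\<xi>. \<xi> \<in> U \<Longrightarrow> (\<lambda>z. phase z \<xi>) \<in> closed_algebra Y G"
  shows "average f s \<in> closed_algebra Y G"
proof (rule closed_algebra_cong[rotated])
  show "(\<integral>\<xi>. indicator C \<xi> *\<^sub>R (of_real (1 / s ^ DIM('a)) * (f \<xi> * exp (- phase z \<xi> / of_real (s\<^sup>2)))) \<partial>lborel) = average f s z"
    if "z \<in> Y" for z using average_change[OF that s] by simp
  have cont_phase: "continuous_on (Y \<times> U) (\<lambda>(z, \<xi>). phase z \<xi>)"
    unfolding phase_def case_prod_unfold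
    by (intro continuous_intros b.continuous_on continuous_on_compose2[OF contS]) auto
  show "(\<lambda>z. \<integral>\<xi>. indicator C \<xi> *\<^sub>R (of_real (1 / s ^ DIM('a)) * (f \<xi> * exp (- phase z \<xi> / of_real (s\<^sup>2)))) \<partial>lborel) \<in> closed_algebra Y G"
  proof (rule closed_algebra_integral[OF Y C(1)])
    have "continuous_on (Y \<times> C) (\<lambda>x. phase (fst x) (snd x))"
      using continuous_on_subset[OF cont_phase, of "Y \<times> C"] C(2) by (auto simp: case_prod_unfold)
    moreover have "continuous_on (Y \<times> C) (\<lambda>x. f (snd x))"
      by (intro continuous_on_compose2[OF f(1)] continuous_intros) auto
    ultimately show "continuous_on (Y \<times> C) (\<lambda>(z, \<xi>). of_real (1 / s ^ DIM('a)) * (f \<xi> * exp (- phase z \<xi> / of_real (s\<^sup>2))))"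
      unfolding case_prod_unfold using s by (intro continuous_intros) auto
    fix \<xi> assume "\<xi> \<in> C"
    then have "\<xi> \<in> U" using C by blast
    have "continuous_on Y (\<lambda>z. phase z \<xi>)"
    proof -
      have "continuous_on Y (\<lambda>z. (z, \<xi>))" by (intro continuous_intros)
      moreover have "(\<lambda>z. (z, \<xi>)) ` Y \<subseteq> Y \<times> U" using \<open>\<xi> \<in> U\<close> by blast
      ultimately have "continuous_on Y (\<lambda>z. case (z, \<xi>) of (z, \<xi>) \<Rightarrow> phase z \<xi>)"
        by (rule continuous_on_compose2[OF cont_phase])
      then show ?thesis by simp
    qed
    then have "bounded ((\<lambda>z. (- 1 / of_real (s\<^sup>2)) * phase z \<xi>) ` Y)"
      by (intro compact_imp_bounded compact_continuous_image Y continuous_intros)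
    then obtain M where "\<And>z. z \<in> Y \<Longrightarrow> cmod ((- 1 / of_real (s\<^sup>2)) * phase z \<xi>) \<le> M"
      unfolding bounded_iff by auto
    then have "(\<lambda>z. exp ((- 1 / of_real (s\<^sup>2)) * phase z \<xi>)) \<in> closed_algebra Y G"
      by (rule closed_algebra_exp[OF closed_algebra_cmult[OF mem[OF \<open>\<xi> \<in> U\<close>]]])
    then show "(\<lambda>z. of_real (1 / s ^ DIM('a)) * (f \<xi> * exp (- phase z \<xi> / of_real (s\<^sup>2)))) \<in> closed_algebra Y G"
      by (intro closed_algebra_cmult) simp
  qed
qed

end

text \<open>Dividing \<open>f\<close> by the mass first makes the averages converge to \<open>f\<close> itself.\<close>

lemma compact_support_mem:
  assumes f: "continuous_on UNIV f" "\<And>x. x \<notin> C \<Longrightarrow> f x = 0" and C: "compact C" "C \<subseteq> U"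
    and mem: "\<And>\<xi>. \<xi> \<in> U \<Longrightarrow> (\<lambda>z. phase z \<xi>) \<in> closed_algebra Y G"
  shows "f \<in> closed_algebra Y G"
proof (rule closed_algebra.limit)
  fix e :: real assume "e > 0"
  define F where "F x = f x * (1 / mass x)" for x
  have contF: "continuous_on UNIV F" unfolding F_def
    by (rule continuous_on_mult_support[OF f _ C(2) U])
       (use C mass_nonzero in \<open>auto intro!: continuous_intros continuous_mass compact_imp_closed\<close>)
  have F0: "F x = 0" if "x \<notin> C" for x using f(2)[OF that] by (simp add: F_def)
  have Ff: "F x * mass x = f x" for x
    using mass_nonzero[of x] f(2)[of x] C(2) by (auto simp: F_def)
  have "\<exists>s>0. \<forall>z\<in>Y. dist (average F s z) (f z) < e"
  proof (rule uniform_from_sequential[OF Y continuous_on_subset[OF f(1)] \<open>e > 0\<close>])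
    fix s z l assume "s \<longlonglongrightarrow> (0::real)" "\<And>k. s k > 0" "\<And>k. z k \<in> Y" "z \<longlonglongrightarrow> l" "l \<in> Y"
    from average_limit[OF contF F0 C this] show "(\<lambda>k. average F (s k) (z k)) \<longlonglongrightarrow> f l" by (simp add: Ff)
  qed auto
  then obtain s where "s > 0" "\<forall>z\<in>Y. dist (average F s z) (f z) < e" by blast
  moreover have "average F s \<in> closed_algebra Y G" by (rule average_mem[OF contF F0 C \<open>s > 0\<close> mem])
  ultimately show "\<exists>g. g \<in> closed_algebra Y G \<and> (\<forall>x\<in>Y. cmod (f x - g x) < e)"
    by (auto simp: dist_norm norm_minus_commute)
qed

end

section \<open>Lipschitz graphs that are smooth along the coordinate faces\<close>

definition bilin :: "complex ^ 'n \<Rightarrow> complex ^ 'n \<Rightarrow> complex" where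
  "bilin v w = (\<Sum>j\<in>UNIV. v $ j * w $ j)"

lemma norm_bilin_le: "cmod (bilin v w) \<le> norm v * norm w"
proof -
  have "cmod (bilin v w) \<le> (\<Sum>j\<in>UNIV. \<bar>cmod (v $ j)\<bar> * \<bar>cmod (w $ j)\<bar>)"
    unfolding bilin_def by (rule order_trans[OF norm_sum]) (simp add: norm_mult)
  also have "\<dots> \<le> norm v * norm w" unfolding norm_vec_def by (rule L2_set_mult_ineq)
  finally show ?thesis .
qed

lemma bounded_bilinear_bilin: "bounded_bilinear (bilin :: complex ^ 'n \<Rightarrow> complex ^ 'n \<Rightarrow> complex)"
proof
  show "\<exists>K. \<forall>v w :: complex ^ 'n. norm (bilin v w) \<le> norm v * norm w * K"
    using norm_bilin_le by (intro exI[of _ 1]) auto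
qed (auto simp: bilin_def algebra_simps sum.distrib sum_distrib_left scaleR_sum_right)

definition graph_gens :: "(complex ^ 'n \<Rightarrow> complex ^ 'n) \<Rightarrow> (complex ^ 'n \<Rightarrow> complex) set" where
  "graph_gens S = range (\<lambda>j z. z $ j) \<union> range (\<lambda>j z. cnj (z $ j) + S z $ j)"

lemma graph_gens_coord: "(\<lambda>z. z $ j) \<in> closed_algebra X (graph_gens S)"
  by (rule closed_algebra.gen) (auto simp: graph_gens_def)

lemma graph_gens_graph: "(\<lambda>z. cnj (z $ j) + S z $ j) \<in> closed_algebra X (graph_gens S)"
  by (rule closed_algebra.gen) (auto simp: graph_gens_def)

text \<open>The phase is \<open>\<Sum>\<^sub>j (z\<^sub>j - \<xi>\<^sub>j) * (g\<^sub>j z - g\<^sub>j \<xi>)\<close> with \<open>g\<^sub>j z = cnj z\<^sub>j + S\<^sub>j z\<close>, a polynomial in the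
generators for each \<open>\<xi>\<close>.\<close>

lemma compact_support_in_graph_algebra:
  fixes S :: "complex ^ 'n \<Rightarrow> complex ^ 'n"
  assumes "compact Y" "open U" "0 \<le> c" "c < 1"
    and "\<And>y z. y \<in> Y \<union> U \<Longrightarrow> z \<in> Y \<union> U \<Longrightarrow> norm (S y - S z) \<le> c * norm (y - z)"
    and "\<And>z. z \<in> U \<Longrightarrow> \<exists>L. has_strict_derivative S L z"
    and "continuous_on UNIV f" "\<And>x. x \<notin> C \<Longrightarrow> f x = 0" "compact C" "C \<subseteq> U"
  shows "f \<in> closed_algebra Y (graph_gens S)"
proof -
  obtain L where L: "\<And>z. z \<in> U \<Longrightarrow> has_strict_derivative S (L z) z" using assms(6) by metis
  interpret gaussian_kernel bilin S L U Y c
    by (rule gaussian_kernel.intro[OF bounded_bilinear_bilin norm_bilin_le assms(2,1,3,4,5) L])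
  have ph: "phase z \<xi> = (\<Sum>j\<in>UNIV. (z $ j - \<xi> $ j) * ((cnj (z $ j) + S z $ j) - (cnj (\<xi> $ j) + S \<xi> $ j)))" for z \<xi>
  proof -
    have "(norm (z - \<xi>))\<^sup>2 = (\<Sum>j\<in>UNIV. (cmod (z $ j - \<xi> $ j))\<^sup>2)"
      unfolding norm_vec_def L2_set_def by (simp add: sum_nonneg)
    then have "of_real ((norm (z - \<xi>))\<^sup>2) = (\<Sum>j\<in>UNIV. (z $ j - \<xi> $ j) * cnj (z $ j - \<xi> $ j))"
      by (simp only: of_real_sum complex_norm_square)
    then show ?thesis
      unfolding phase_def bilin_def by (simp add: sum.distrib[symmetric] algebra_simps)
  qed
  show ?thesis
  proof (rule compact_support_mem)
    show "(\<lambda>z. phase z \<xi>) \<in> closed_algebra Y (graph_gens S)" for \<xi>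
      unfolding ph
      by (intro closed_algebra_sum closed_algebra.mult closed_algebra_diff closed_algebra.const
            graph_gens_coord graph_gens_graph)
  qed (use assms in auto)
qed

definition proj :: "'n set \<Rightarrow> complex ^ 'n \<Rightarrow> complex ^ 'n" where
  "proj J z = (\<chi> j. if j \<in> J then z $ j else 0)"

lemma proj_nth [simp]: "proj J z $ j = (if j \<in> J then z $ j else 0)"
  by (simp add: proj_def)

lemma norm_proj_le: "norm (proj J z) \<le> norm z"
  unfolding norm_vec_def by (intro L2_set_mono) auto

lemma proj_diff: "proj J z - proj J w = proj J (z - w)"
  by (simp add: vec_eq_iff)

lemma cutoff_near_compact:
  fixes Y :: "'a::{heine_borel} set"
  assumes "compact Y" "open V" "Y \<subseteq> V"
  obtains \<psi> :: "'a \<Rightarrow> real" and C where "continuous_on UNIV \<psi>" "compact C" "C \<subseteq> V"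
    "\<And>x. x \<in> Y \<Longrightarrow> \<psi> x = 1" "\<And>x. x \<notin> C \<Longrightarrow> \<psi> x = 0"
proof (cases "Y = {}")
  case True
  show thesis by (rule that[of "\<lambda>_. 0" "{}"]) (use True in auto)
next
  case False
  obtain e where e: "e > 0" "{x. infdist x Y \<le> e} \<subseteq> V"
    using compact_in_open_separated[OF False assms] by metis
  show thesis
  proof (rule that[of "\<lambda>x. max 0 (1 - infdist x Y / e)" "{x. infdist x Y \<le> e}"])
    show "continuous_on UNIV (\<lambda>x. max 0 (1 - infdist x Y / e))"
      using e by (intro continuous_intros) auto
    have "closed {x. infdist x Y \<le> e}"
      by (intro closed_Collect_le continuous_intros)
    moreover have "bounded {x. infdist x Y \<le> e}"
    proof -
      obtain B a where B: "\<And>y. y \<in> Y \<Longrightarrow> dist a y \<le> B" 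
        using compact_imp_bounded[OF assms(1)] unfolding bounded_def by blast
      have "dist a x \<le> B + e" if "infdist x Y \<le> e" for x
      proof -
        obtain y where "y \<in> Y" "infdist x Y = dist x y"
          using infdist_attains_inf[OF compact_imp_closed[OF assms(1)] False] by metis
        then show ?thesis using that B[of y] dist_triangle[of a x y] by (simp add: dist_commute)
      qed
      then show ?thesis unfolding bounded_def by blast
    qed
    ultimately show "compact {x. infdist x Y \<le> e}" by (simp add: compact_eq_bounded_closed)
  qed (use e in \<open>auto simp: field_simps\<close>)
qed


text \<open>A continuous cutoff, \<open>0\<close> up to \<open>t / 2\<close> and \<open>1\<close> from \<open>t\<close> on.\<close>

definition ramp :: "real \<Rightarrow> real \<Rightarrow> real" where
  "ramp t r = min 1 (max 0 (2 * r / t - 1))"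

lemma continuous_on_ramp [continuous_intros]:
  "continuous_on A f \<Longrightarrow> continuous_on A (\<lambda>x. ramp t (f x))"
  unfolding ramp_def divide_inverse by (intro continuous_intros)

lemma ramp_0: "t > 0 \<Longrightarrow> r \<le> t / 2 \<Longrightarrow> ramp t r = 0"
  by (simp add: ramp_def field_simps)

lemma ramp_1: "t > 0 \<Longrightarrow> t \<le> r \<Longrightarrow> ramp t r = 1"
  by (simp add: ramp_def field_simps)

lemma ramp_bounds: "0 \<le> ramp t r" "ramp t r \<le> 1"
  by (auto simp: ramp_def)

text \<open>Differentiability is required of \<open>proj J \<circ> S \<circ> proj J\<close>, the map that \<open>S\<close> induces on the
coordinate subspace of \<open>J\<close>, at the points where the coordinates in \<open>J\<close> do not vanish.  Extending the
induced map to the whole space makes it possible to integrate over the full space for every face,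
instead of over subspaces of varying dimension.\<close>

locale stratified_graph =
  fixes S :: "complex ^ 'n \<Rightarrow> complex ^ 'n" and V Y :: "(complex ^ 'n) set" and c \<kappa> :: real
  assumes V: "open V" and Y: "compact Y" "Y \<subseteq> V" and c: "0 \<le> c" "c < 1"
    and lip: "\<And>y z. y \<in> V \<Longrightarrow> z \<in> V \<Longrightarrow> norm (S y - S z) \<le> c * norm (y - z)"
    and proj_V: "\<And>J z. z \<in> V \<Longrightarrow> proj J z \<in> V"
    and strict: "\<And>J z. z \<in> V \<Longrightarrow> (\<And>j. j \<in> J \<Longrightarrow> z $ j \<noteq> 0)
      \<Longrightarrow> \<exists>L. has_strict_derivative (\<lambda>z. proj J (S (proj J z))) L z"
    and zero: "\<And>z j. z \<in> V \<Longrightarrow> z $ j = 0 \<Longrightarrow> S z $ j = 0"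
    and \<kappa>: "\<kappa> > 0"
    and pos: "\<And>z j. z \<in> Y \<Longrightarrow> \<kappa> * (cmod (z $ j))\<^sup>2 \<le> Re (z $ j * (cnj (z $ j) + S z $ j))"
begin

definition face :: "'n set \<Rightarrow> (complex ^ 'n) set" where
  "face Z = {z\<in>Y. \<forall>j\<in>Z. z $ j = 0}"

lemma face_subset: "face Z \<subseteq> Y"
  by (auto simp: face_def)

lemma compact_face: "compact (face Z)"
proof -
  have "face Z = Y \<inter> (\<Inter>j\<in>Z. {z. z $ j = 0})" by (auto simp: face_def)
  moreover have "closed (\<Inter>j\<in>Z. {z :: complex ^ 'n. z $ j = 0})"
    by (intro closed_INT ballI closed_Collect_eq continuous_intros)
  ultimately show ?thesis using Y(1) by (simp add: compact_Int_closed)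
qed

lemma contS: "continuous_on V S"
  by (rule lipschitz_imp_continuous_on[OF c(1) lip])

lemma continuous_gens: "g \<in> graph_gens S \<Longrightarrow> continuous_on Y g"
  using continuous_on_subset[OF contS Y(2)]
  by (auto simp: graph_gens_def intro!: continuous_intros)

text \<open>A function that vanishes near all hyperplanes other than those cutting out the face is extended to
a function \<open>f\<close> of compact support in the region where the induced map is differentiable.  Then \<open>f\<close>
lies in the algebra of the induced graph, and on the face the generators of that graph are
generators of the given one, or zero.\<close>

lemma open_stratum_mem:
  assumes F: "continuous_on Y F" and ZN: "Z \<union> N = UNIV" and t: "t > 0"
    and van: "\<And>z j. z \<in> Y \<Longrightarrow> j \<in> N \<Longrightarrow> cmod (z $ j) \<le> t \<Longrightarrow> F z = 0"
  shows "F \<in> closed_algebra (face Z) (graph_gens S)"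
proof -
  define J where "J = - Z"
  have J: "J \<subseteq> N" using ZN by (auto simp: J_def)
  define S' where "S' z = proj J (S (proj J z))" for z
  define U where "U = {z\<in>V. \<forall>j\<in>J. z $ j \<noteq> 0}"
  have "U = V \<inter> (\<Inter>j\<in>J. {z. z $ j \<noteq> 0})" by (auto simp: U_def)
  moreover have "open (\<Inter>j\<in>J. {z :: complex ^ 'n. z $ j \<noteq> 0})"
    by (intro open_INT ballI open_Collect_neq continuous_intros) auto
  ultimately have "open U" using V by auto
  obtain G where G: "continuous_on UNIV G" "\<And>z. z \<in> Y \<Longrightarrow> G z = F z"
    using Tietze_unbounded[OF F, of UNIV] compact_imp_closed[OF Y(1)] by auto
  obtain \<psi> C where \<psi>: "continuous_on UNIV \<psi>" "compact C" "C \<subseteq> V"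
    "\<And>x. x \<in> Y \<Longrightarrow> \<psi> x = (1::real)" "\<And>x. x \<notin> C \<Longrightarrow> \<psi> x = 0"
    using cutoff_near_compact[OF Y(1) V Y(2)] by blast
  define f where "f z = G z * of_real (\<psi> z * (\<Prod>j\<in>J. ramp t (cmod (z $ j))))" for z
  define C' where "C' = C \<inter> (\<Inter>j\<in>J. {z. t / 2 \<le> cmod (z $ j)})"
  have f_mem: "f \<in> closed_algebra (face Z) (graph_gens S')"
  proof (rule compact_support_in_graph_algebra[OF compact_face \<open>open U\<close> c])
    fix y z assume "y \<in> face Z \<union> U" "z \<in> face Z \<union> U"
    then have "y \<in> V" "z \<in> V" using Y(2) face_subset by (auto simp: U_def)
    then have "norm (S (proj J y) - S (proj J z)) \<le> c * norm (proj J y - proj J z)"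
      by (intro lip proj_V)
    also have "\<dots> \<le> c * norm (y - z)"
      unfolding proj_diff using c by (intro mult_left_mono norm_proj_le) auto
    finally show "norm (S' y - S' z) \<le> c * norm (y - z)"
      unfolding S'_def proj_diff using norm_proj_le order_trans by blast
  next
    show "\<exists>L. has_strict_derivative S' L z" if "z \<in> U" for z
      using strict[of z J] that by (simp add: U_def S'_def[abs_def])
    show "continuous_on UNIV f"
      unfolding f_def by (intro continuous_intros G \<psi>)
    show "f x = 0" if x: "x \<notin> C'" for x
    proof (cases "x \<in> C")
      case True
      then obtain j where "j \<in> J" "\<not> t / 2 \<le> cmod (x $ j)" using x by (auto simp: C'_def)
      then have "j \<in> J" "cmod (x $ j) \<le> t / 2" by auto
      then have "(\<Prod>j\<in>J. ramp t (cmod (x $ j))) = 0"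
        using ramp_0[OF t] by (intro prod_zero) auto
      then show ?thesis by (simp add: f_def)
    qed (simp add: f_def \<psi>)
    have "closed (\<Inter>j\<in>J. {z :: complex ^ 'n. t / 2 \<le> cmod (z $ j)})"
      by (intro closed_INT ballI closed_Collect_le continuous_intros)
    then show "compact C'" unfolding C'_def using \<psi>(2) by (simp add: compact_Int_closed)
    show "C' \<subseteq> U"
    proof
      fix x assume x: "x \<in> C'"
      then have "t / 2 \<le> cmod (x $ j)" if "j \<in> J" for j using that by (auto simp: C'_def)
      then have "x $ j \<noteq> 0" if "j \<in> J" for j using that t by fastforce
      then show "x \<in> U" using x \<psi>(3) by (auto simp: U_def C'_def)
    qed
  qed
  have f_mem': "f \<in> closed_algebra (face Z) (graph_gens S)"
  proof (rule closed_algebra_subset[OF f_mem subset_refl])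
    fix g assume "g \<in> graph_gens S'"
    then consider j where "g = (\<lambda>z. z $ j)" | j where "g = (\<lambda>z. cnj (z $ j) + S' z $ j)"
      by (auto simp: graph_gens_def)
    then show "g \<in> closed_algebra (face Z) (graph_gens S)"
    proof cases
      case 1
      then show ?thesis by (simp add: graph_gens_coord)
    next
      case (2 j)
      have proj_face: "proj J z = z" if "z \<in> face Z" for z
        using that by (auto simp: vec_eq_iff face_def J_def)
      show ?thesis
      proof (cases "j \<in> J")
        case True
        show ?thesis unfolding 2
          by (rule closed_algebra_cong[OF graph_gens_graph[of j]]) (use True proj_face in \<open>simp add: S'_def\<close>)
      next
        case False
        show ?thesis unfolding 2
          by (rule closed_algebra_cong[OF closed_algebra.const[of 0]])
             (use False in \<open>auto simp: S'_def face_def J_def\<close>)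
      qed
    qed
  qed
  show ?thesis
  proof (rule closed_algebra_cong[OF f_mem'])
    fix z assume "z \<in> face Z"
    then have z: "z \<in> Y" using face_subset by blast
    show "f z = F z"
    proof (cases "\<exists>j\<in>J. cmod (z $ j) \<le> t")
      case True
      then show ?thesis using van[OF z] J G(2)[OF z] by (auto simp: f_def)
    next
      case False
      then have "(\<Prod>j\<in>J. ramp t (cmod (z $ j))) = 1"
        using ramp_1[OF t] by (intro prod.neutral) auto
      then show ?thesis using G(2)[OF z] \<psi>(4)[OF z] by (simp add: f_def)
    qed
  qed
qed

text \<open>Induction on the set \<open>M\<close> of coordinates about which nothing is known: on the face the
coordinates in \<open>Z\<close> are zero, and \<open>F\<close> vanishes near the hyperplanes of \<open>N\<close>.  For \<open>k\<close> in \<open>M\<close>, let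
\<open>u = \<epsilon> / (z\<^sub>k g\<^sub>k + \<epsilon>)\<close> and split \<open>F = F * u + F * (1 - u)\<close>.  The first summand is close to \<open>G * u\<close>,
where \<open>G\<close> approximates \<open>F\<close> on the smaller face \<open>z\<^sub>k = 0\<close>: near that face \<open>G\<close> is close to \<open>F\<close>, and
away from it \<open>u\<close> is small.  The second summand vanishes for \<open>z\<^sub>k = 0\<close>, so cutting it off near that
hyperplane changes it little and makes it a function to which the induction hypothesis for \<open>insert k N\<close>
applies.\<close>

lemma face_mem:
  assumes "finite M" "Z \<union> N \<union> M = UNIV" "continuous_on Y F" "t > 0"
    and "\<And>z j. z \<in> Y \<Longrightarrow> j \<in> N \<Longrightarrow> cmod (z $ j) \<le> t \<Longrightarrow> F z = 0"
  shows "F \<in> closed_algebra (face Z) (graph_gens S)"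
  using assms
proof (induction M arbitrary: Z N F t rule: finite_induct)
  case empty
  then show ?case using open_stratum_mem by simp
next
  case (insert k M)
  note F = insert.prems(2) and van = insert.prems(4)
  define W where "W = face Z"
  have W: "compact W" "W \<subseteq> Y" unfolding W_def by (rule compact_face, rule face_subset)
  define h where "h z = z $ k * (cnj (z $ k) + S z $ k)" for z
  have h_cont: "continuous_on Y h"
    unfolding h_def by (intro continuous_intros continuous_on_subset[OF contS Y(2)])
  have h_pos: "\<kappa> * (cmod (z $ k))\<^sup>2 \<le> Re (h z)" if "z \<in> Y" for z
    using pos[OF that] by (simp add: h_def)
  have h_nonneg: "0 \<le> Re (h z)" if "z \<in> Y" for z
    using h_pos[OF that] \<kappa> by (meson less_imp_le mult_nonneg_nonneg order_trans zero_le_power2)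
  have h_mem: "h \<in> closed_algebra X (graph_gens S)" for X
    unfolding h_def by (intro closed_algebra.mult graph_gens_coord graph_gens_graph)
  obtain Bh where Bh: "\<And>z. z \<in> W \<Longrightarrow> cmod (h z) \<le> Bh"
    using compact_imp_bounded[OF compact_continuous_image[OF continuous_on_subset[OF h_cont W(2)] W(1)]]
    unfolding bounded_iff by auto
  have gens_bd: "bounded (g ` X)" if "g \<in> graph_gens S" "X \<subseteq> Y" for g X
    using compact_imp_bounded[OF compact_continuous_image[OF continuous_gens[OF that(1)] Y(1)]] that(2)
    by (meson bounded_subset image_mono)
  show ?case
  proof (rule closed_algebra.limit)
    fix e :: real assume "e > 0"
    define \<eta> where "\<eta> = e / 4"
    have \<eta>: "\<eta> > 0" using \<open>e > 0\<close> by (simp add: \<eta>_def)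
    have "F \<in> closed_algebra (face (insert k Z)) (graph_gens S)"
      using insert.prems by (intro insert.IH[of "insert k Z" N F t]) auto
    then obtain G where G: "G \<in> closed_algebra Y (graph_gens S)"
      "\<forall>z\<in>face (insert k Z). cmod (F z - G z) < \<eta>"
      using closed_algebra_approx[of F "face (insert k Z)" "graph_gens S" "closed_algebra Y (graph_gens S)" \<eta>]
        gens_bd face_subset \<eta> by (auto intro: closed_algebra.intros)
    have G_cont: "continuous_on Y G"
      by (rule closed_algebra_continuous[OF G(1) continuous_gens])
    have "\<exists>t1>0. \<forall>z\<in>W. cmod (z $ k) \<le> t1 \<longrightarrow> cmod (F z - G z) < \<eta>"
    proof (rule zero_set_neighbourhood[OF W(1)])
      show "continuous_on W (\<lambda>z. cmod (F z - G z))"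
        by (intro continuous_intros continuous_on_subset[OF F] continuous_on_subset[OF G_cont] W)
      show "cmod (F z - G z) < \<eta>" if "z \<in> W" "cmod (z $ k) = 0" for z
        using G(2) that by (auto simp: W_def face_def)
    qed (auto intro!: continuous_intros)
    then obtain t1 where t1: "t1 > 0" "\<And>z. z \<in> W \<Longrightarrow> cmod (z $ k) \<le> t1 \<Longrightarrow> cmod (F z - G z) < \<eta>"
      by blast
    obtain B where B: "B > 0" "\<And>z. z \<in> W \<Longrightarrow> cmod (F z - G z) \<le> B"
    proof -
      have "continuous_on W (\<lambda>z. F z - G z)"
        by (intro continuous_intros continuous_on_subset[OF F] continuous_on_subset[OF G_cont] W)
      from compact_imp_bounded[OF compact_continuous_image[OF this W(1)]] that show thesis
        unfolding bounded_pos by auto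
    qed
    \<comment> \<open>Chosen after \<open>G\<close>: where \<open>|z\<^sub>k| \<ge> t1\<close>, it gives \<open>|u| \<le> \<epsilon> / (\<kappa> * t1\<^sup>2)\<close> and so \<open>B * |u| \<le> \<eta>\<close>.\<close>
    define \<epsilon> where "\<epsilon> = \<eta> * (\<kappa> * t1\<^sup>2) / B"
    have \<epsilon>: "\<epsilon> > 0" using \<eta> \<kappa> t1 B by (simp add: \<epsilon>_def)
    have den: "\<epsilon> \<le> cmod (h z + of_real \<epsilon>)" "Re (h z) \<le> cmod (h z + of_real \<epsilon>)"
      "cmod (h z) \<le> cmod (h z + of_real \<epsilon>)" "h z + of_real \<epsilon> \<noteq> 0" if "z \<in> Y" for z
    proof -
      have "Re (h z) + \<epsilon> \<le> cmod (h z + of_real \<epsilon>)"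
        using complex_Re_le_cmod[of "h z + of_real \<epsilon>"] by simp
      then show "\<epsilon> \<le> cmod (h z + of_real \<epsilon>)" "Re (h z) \<le> cmod (h z + of_real \<epsilon>)"
        using h_nonneg[OF that] \<epsilon> by linarith+
      then show "h z + of_real \<epsilon> \<noteq> 0" using \<epsilon> by auto
      show "cmod (h z) \<le> cmod (h z + of_real \<epsilon>)"
        using h_nonneg[OF that] \<epsilon>
        by (auto simp: cmod_def power2_eq_square intro!: real_sqrt_le_mono mult_mono)
    qed
    define u where "u z = of_real \<epsilon> * (1 / (h z + of_real \<epsilon>))" for z
    have u_mem: "u \<in> closed_algebra W (graph_gens S)" unfolding u_def
      using h_nonneg W by (intro closed_algebra_cmult closed_algebra_inverse_shift[OF h_mem Bh _ \<epsilon>]) auto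
    have u_le: "cmod (u z) \<le> 1" if "z \<in> Y" for z
      using den[OF that] \<epsilon> by (simp add: u_def norm_mult norm_divide divide_le_eq)
    have Fu: "cmod (F z * u z - G z * u z) \<le> \<eta>" if z: "z \<in> W" for z
    proof -
      have zY: "z \<in> Y" using z W by blast
      have eq: "cmod (F z * u z - G z * u z) = cmod (F z - G z) * cmod (u z)"
        by (simp add: norm_mult[symmetric] left_diff_distrib)
      show ?thesis
      proof (cases "cmod (z $ k) \<le> t1")
        case True
        have "cmod (F z - G z) * cmod (u z) \<le> \<eta> * 1"
          using t1(2)[OF z True] u_le[OF zY] \<eta> by (intro mult_mono) auto
        then show ?thesis using eq by simp
      next
        case False
        have "\<kappa> * t1\<^sup>2 \<le> \<kappa> * (cmod (z $ k))\<^sup>2"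
          using False t1(1) \<kappa> by (intro mult_left_mono power_mono) auto
        then have "\<kappa> * t1\<^sup>2 \<le> cmod (h z + of_real \<epsilon>)"
          using h_pos[OF zY] den(2)[OF zY] by linarith
        moreover have "cmod (u z) = \<epsilon> / cmod (h z + of_real \<epsilon>)"
          using \<epsilon> by (simp add: u_def norm_mult norm_divide)
        moreover have "0 < \<kappa> * t1\<^sup>2" using \<kappa> t1(1) by simp
        ultimately have "cmod (u z) \<le> \<epsilon> / (\<kappa> * t1\<^sup>2)"
          using \<epsilon> by (metis frac_le order_refl less_imp_le)
        then have "cmod (F z - G z) * cmod (u z) \<le> B * (\<epsilon> / (\<kappa> * t1\<^sup>2))"
          using B z by (intro mult_mono) (auto intro: less_imp_le)
        also have "\<dots> = \<eta>" using B \<kappa> t1 by (simp add: \<epsilon>_def)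
        finally show ?thesis using eq by simp
      qed
    qed
    define F1 where "F1 z = F z * (h z * (1 / (h z + of_real \<epsilon>)))" for z
    have F1: "F z = F z * u z + F1 z" if "z \<in> Y" for z
    proof -
      have "u z + h z * (1 / (h z + of_real \<epsilon>)) = 1"
        using den(4)[OF that] by (simp add: u_def add_divide_distrib[symmetric] add.commute)
      then show ?thesis unfolding F1_def by (metis distrib_left mult.right_neutral)
    qed
    have F1_cont: "continuous_on Y F1"
      unfolding F1_def using den(4) by (intro continuous_intros F h_cont) auto
    have "\<exists>t2>0. \<forall>z\<in>W. cmod (z $ k) \<le> t2 \<longrightarrow> cmod (F1 z) < \<eta>"
    proof (rule zero_set_neighbourhood[OF W(1)])
      show "continuous_on W (\<lambda>z. cmod (F1 z))"
        by (intro continuous_intros continuous_on_subset[OF F1_cont] W)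
      show "cmod (F1 z) < \<eta>" if "z \<in> W" "cmod (z $ k) = 0" for z
        using that \<eta> by (simp add: F1_def h_def)
    qed (auto intro!: continuous_intros)
    then obtain t2 where t2: "t2 > 0" "\<And>z. z \<in> W \<Longrightarrow> cmod (z $ k) \<le> t2 \<Longrightarrow> cmod (F1 z) < \<eta>"
      by blast
    define F2 where "F2 z = F1 z * of_real (ramp t2 (cmod (z $ k)))" for z
    have F2_cont: "continuous_on Y F2"
      unfolding F2_def by (intro continuous_intros F1_cont)
    have F2_mem: "F2 \<in> closed_algebra W (graph_gens S)" unfolding W_def
    proof (rule insert.IH[OF _ F2_cont])
      show "Z \<union> insert k N \<union> M = UNIV" using insert.prems(1) by auto
      show "0 < min t (t2 / 2)" using insert.prems(3) t2(1) by simp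
      fix z j assume z: "z \<in> Y" "j \<in> insert k N" "cmod (z $ j) \<le> min t (t2 / 2)"
      show "F2 z = 0"
      proof (cases "j = k")
        case True
        then show ?thesis using z ramp_0[OF t2(1)] by (simp add: F2_def)
      next
        case False
        then show ?thesis using z van[of z j] by (simp add: F2_def F1_def)
      qed
    qed
    have F12: "cmod (F1 z - F2 z) \<le> \<eta>" if z: "z \<in> W" for z
    proof (cases "cmod (z $ k) \<le> t2")
      case True
      have "F1 z - F2 z = F1 z * of_real (1 - ramp t2 (cmod (z $ k)))"
        by (simp add: F2_def algebra_simps)
      then have "cmod (F1 z - F2 z) = cmod (F1 z) * (1 - ramp t2 (cmod (z $ k)))"
        using ramp_bounds[of t2 "cmod (z $ k)"] by (simp only: norm_mult norm_of_real abs_of_nonneg diff_ge_0_iff_ge)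
      also have "\<dots> \<le> \<eta> * 1"
        using ramp_bounds[of t2 "cmod (z $ k)"] t2(2)[OF z True] \<eta> by (intro mult_mono) auto
      finally show ?thesis by simp
    next
      case False
      then show ?thesis using ramp_1[OF t2(1)] \<eta> by (simp add: F2_def)
    qed
    have G_W: "G \<in> closed_algebra W (graph_gens S)"
      by (rule closed_algebra_subset[OF G(1) W(2) closed_algebra.gen])
    show "\<exists>g. g \<in> closed_algebra (face Z) (graph_gens S) \<and> (\<forall>z\<in>face Z. cmod (F z - g z) < e)"
    proof (rule exI[of _ "\<lambda>z. G z * u z + F2 z"], rule conjI)
      show "(\<lambda>z. G z * u z + F2 z) \<in> closed_algebra (face Z) (graph_gens S)"
        using closed_algebra.add[OF closed_algebra.mult[OF G_W u_mem] F2_mem] by (simp add: W_def)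
      show "\<forall>z\<in>face Z. cmod (F z - (G z * u z + F2 z)) < e"
      proof
        fix z assume "z \<in> face Z"
        then have z: "z \<in> W" by (simp add: W_def)
        have "F z - (G z * u z + F2 z) = (F z * u z - G z * u z) + (F1 z - F2 z)"
          using F1[of z] z W(2) by (simp add: subset_iff)
        then have "cmod (F z - (G z * u z + F2 z)) \<le> \<eta> + \<eta>"
          using Fu[OF z] F12[OF z] norm_triangle_mono by metis
        then show "cmod (F z - (G z * u z + F2 z)) < e" using \<eta> by (simp add: \<eta>_def)
      qed
    qed
  qed
qed

theorem continuous_mem:
  assumes "continuous_on Y F" shows "F \<in> closed_algebra Y (graph_gens S)"
  using face_mem[of UNIV "{}" "{}" F 1] assms by (simp add: face_def)

end

section \<open>The substitution of powers\<close>

definition power_map :: "('n \<Rightarrow> nat) \<Rightarrow> complex ^ 'n \<Rightarrow> complex ^ 'n" where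
  "power_map q z = (\<chi> j. z $ j ^ q j)"

definition root_map :: "('n \<Rightarrow> nat) \<Rightarrow> complex ^ 'n \<Rightarrow> complex ^ 'n" where
  "root_map q \<zeta> = (\<chi> j. SOME w. w ^ q j = \<zeta> $ j)"

lemma power_map_nth [simp]: "power_map q z $ j = z $ j ^ q j"
  by (simp add: power_map_def)

lemma root_map_power:
  assumes "q j > 0" shows "root_map q \<zeta> $ j ^ q j = \<zeta> $ j"
proof -
  have "q j \<noteq> 0" using assms by simp
  then obtain w where "\<zeta> $ j = w ^ q j" by (rule exists_complex_root)
  then have "\<exists>w. w ^ q j = \<zeta> $ j" by metis
  from someI_ex[OF this] show ?thesis by (simp add: root_map_def)
qed

lemma closure_polydisc:
  assumes "\<delta> > 0"
  shows "closure (polydisc \<delta> :: (complex ^ 'n) set) = {z. \<forall>j. cmod (z $ j) \<le> \<delta>}"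
proof
  have "closed {z :: complex ^ 'n. \<forall>j. cmod (z $ j) \<le> \<delta>}"
    by (intro closed_Collect_all closed_Collect_le continuous_intros)
  then show "closure (polydisc \<delta> :: (complex ^ 'n) set) \<subseteq> {z. \<forall>j. cmod (z $ j) \<le> \<delta>}"
    by (intro closure_minimal) (auto simp: polydisc_def less_imp_le)
  show "{z. \<forall>j. cmod (z $ j) \<le> \<delta>} \<subseteq> closure (polydisc \<delta> :: (complex ^ 'n) set)"
  proof
    fix z :: "complex ^ 'n" assume z: "z \<in> {z. \<forall>j. cmod (z $ j) \<le> \<delta>}"
    show "z \<in> closure (polydisc \<delta>)" unfolding closure_approachable
    proof (intro allI impI)
      fix e :: real assume "e > 0"
      define t where "t = min (1/2) (e / (2 * (norm z + 1)))"
      have t: "0 < t" "t < 1" using \<open>e > 0\<close> by (auto simp: t_def add_nonneg_pos)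
      have "t * norm z \<le> e / (2 * (norm z + 1)) * norm z"
        by (intro mult_right_mono) (auto simp: t_def)
      also have "\<dots> < e" using \<open>e > 0\<close> by (simp add: divide_simps add_nonneg_pos)
      finally have "dist ((1 - t) *\<^sub>R z) z < e"
        using t by (simp add: dist_norm algebra_simps)
      moreover have "(1 - t) *\<^sub>R z \<in> polydisc \<delta>"
      proof -
        have "(1 - t) * cmod (z $ j) < \<delta>" for j
        proof -
          have "(1 - t) * cmod (z $ j) \<le> (1 - t) * \<delta>"
            using z t by (intro mult_left_mono) auto
          also have "\<dots> < \<delta>" using t assms by (simp add: algebra_simps)
          finally show ?thesis .
        qed
        then show ?thesis using t by (simp add: polydisc_def)
      qed
      ultimately show "\<exists>y\<in>polydisc \<delta>. dist y z < e" by blast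
    qed
  qed
qed

lemma compact_closure_polydisc: "\<delta> > 0 \<Longrightarrow> compact (closure (polydisc \<delta> :: (complex ^ 'n) set))"
proof -
  assume "\<delta> > 0"
  have "norm z \<le> (\<Sum>j\<in>(UNIV::'n set). \<delta>)" if z: "z \<in> closure (polydisc \<delta>)" for z :: "complex ^ 'n"
  proof -
    have "norm z \<le> (\<Sum>j\<in>UNIV. cmod (z $ j))"
      unfolding norm_vec_def by (rule L2_set_le_sum) auto
    also have "\<dots> \<le> (\<Sum>j\<in>(UNIV::'n set). \<delta>)"
      using z closure_polydisc[OF \<open>\<delta> > 0\<close>] by (intro sum_mono) auto
    finally show ?thesis .
  qed
  then have "bounded (closure (polydisc \<delta> :: (complex ^ 'n) set))"
    unfolding bounded_iff by blast
  then show ?thesis by (simp add: compact_eq_bounded_closed)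
qed

lemma open_polydisc: "open (polydisc \<delta> :: (complex ^ 'n) set)"
proof -
  have "polydisc \<delta> = (\<Inter>j. {z :: complex ^ 'n. cmod (z $ j) < \<delta>})" by (auto simp: polydisc_def)
  then show ?thesis by (auto intro!: open_INT open_Collect_less continuous_intros)
qed

text \<open>The hypotheses on the substitution \<open>\<zeta> = power_map q z\<close>.  The condition \<open>R0\<close> is what remains of
\<open>R\<^sub>j z = o(|\<zeta>\<^sub>j|)\<close> on the coordinate hyperplanes; the quantitative smallness is a separate
assumption of \<open>power_map_algebra\<close>, on the smaller set \<open>X\<close>.\<close>

locale power_graph =
  fixes q :: "'n::finite \<Rightarrow> nat" and \<delta>\<^sub>0 c :: real and R :: "complex ^ 'n \<Rightarrow> complex ^ 'n"
  assumes q: "\<And>j. q j > 0" and \<delta>\<^sub>0: "\<delta>\<^sub>0 > 0" and C1: "C1_on R (polydisc \<delta>\<^sub>0)"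
    and c: "0 \<le> c" "c < 1"
    and lipR: "\<And>z \<xi>. z \<in> polydisc \<delta>\<^sub>0 \<Longrightarrow> \<xi> \<in> polydisc \<delta>\<^sub>0 \<Longrightarrow>
           norm (R z - R \<xi>) \<le> c * norm (power_map q z - power_map q \<xi>)"
    and R0: "\<And>z j. z \<in> polydisc \<delta>\<^sub>0 \<Longrightarrow> z $ j = 0 \<Longrightarrow> R z $ j = 0"
begin

text \<open>The choice of the root does not matter: \<open>R\<close> takes the same value on all roots (\<open>S_power_map\<close>).\<close>

definition S :: "complex ^ 'n \<Rightarrow> complex ^ 'n" where
  "S \<zeta> = R (root_map q \<zeta>)"

definition V :: "(complex ^ 'n) set" where
  "V = {\<zeta>. \<forall>j. cmod (\<zeta> $ j) < \<delta>\<^sub>0 ^ q j}"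

lemma power_map_root_map: "power_map q (root_map q \<zeta>) = \<zeta>"
  by (simp add: vec_eq_iff root_map_power[of q, OF q])

lemma polydisc_iff: "z \<in> polydisc \<delta>\<^sub>0 \<longleftrightarrow> power_map q z \<in> V"
proof -
  have "cmod (z $ j) < \<delta>\<^sub>0 \<longleftrightarrow> cmod (z $ j) ^ q j < \<delta>\<^sub>0 ^ q j" for j
    using q[of j] \<delta>\<^sub>0 power_strict_mono[of "cmod (z $ j)" \<delta>\<^sub>0 "q j"]
      power_less_imp_less_base[of "cmod (z $ j)" "q j" \<delta>\<^sub>0] by auto
  then show ?thesis by (simp add: polydisc_def V_def norm_power)
qed

lemma root_map_V: "\<zeta> \<in> V \<Longrightarrow> root_map q \<zeta> \<in> polydisc \<delta>\<^sub>0"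
  by (simp add: polydisc_iff power_map_root_map)

lemma S_lip: "y \<in> V \<Longrightarrow> z \<in> V \<Longrightarrow> norm (S y - S z) \<le> c * norm (y - z)"
  unfolding S_def using lipR[of "root_map q y" "root_map q z"] root_map_V
  by (simp add: power_map_root_map)

lemma S_power_map:
  assumes "z \<in> polydisc \<delta>\<^sub>0" shows "S (power_map q z) = R z"
proof -
  have "norm (R (root_map q (power_map q z)) - R z) \<le> c * norm (power_map q z - power_map q z)"
    using lipR[of "root_map q (power_map q z)" z] assms
    by (simp add: polydisc_iff power_map_root_map)
  then show ?thesis by (simp add: S_def)
qed

lemma open_V: "open V"
proof -
  have "V = (\<Inter>j. {\<zeta>. cmod (\<zeta> $ j) < \<delta>\<^sub>0 ^ q j})" by (auto simp: V_def)
  then show ?thesis by (auto intro!: open_INT open_Collect_less continuous_intros)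
qed

lemma proj_V: "z \<in> V \<Longrightarrow> proj J z \<in> V"
  using \<delta>\<^sub>0 by (auto simp: V_def)

lemma S_zero:
  assumes "z \<in> V" "z $ j = 0" shows "S z $ j = 0"
proof -
  have "root_map q z $ j = 0" using root_map_power[of q j z] q[of j] assms(2) by simp
  then show ?thesis unfolding S_def using R0 root_map_V[OF assms(1)] by blast
qed

text \<open>Where the coordinates in \<open>J\<close> do not vanish they have continuous root branches \<open>r j\<close>.  The other
coordinates of \<open>proj J \<zeta>\<close> are zero and have the root zero, so near \<open>z\<close> the induced map is
\<open>proj J \<circ> R \<circ> \<rho>\<close> with \<open>\<rho>\<close> strictly differentiable, and the chain rule for strict derivatives
applies.\<close>

lemma S_strict:
  assumes z: "z \<in> V" "\<And>j. j \<in> J \<Longrightarrow> z $ j \<noteq> 0"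
  shows "\<exists>L. has_strict_derivative (\<lambda>z. proj J (S (proj J z))) L z"
proof -
  define a where "a = root_map q z"
  have a: "a $ j ^ q j = z $ j" for j unfolding a_def by (rule root_map_power[of q, OF q])
  define r where "r j w = a $ j * (w / z $ j) powr (1 / of_nat (q j))" for j w
  have r_pow: "r j w ^ q j = w" if "j \<in> J" "w \<noteq> 0" for j w
  proof -
    have "((w / z $ j) powr (1 / of_nat (q j))) ^ q j = w / z $ j"
      using that z(2) q[of j] by (simp add: powr_def exp_of_nat_mult[symmetric])
    then show ?thesis using a[of j] z(2)[OF that(1)] by (simp add: r_def power_mult_distrib)
  qed
  have r_cont: "isCont (r j) (z $ j)" if "j \<in> J" for j
    unfolding r_def using z(2)[OF that] by (intro continuous_intros) (auto simp: complex_nonpos_Reals_iff)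
  have r_z: "r j (z $ j) = a $ j" if "j \<in> J" for j
    using z(2)[OF that] by (simp add: r_def)
  define \<rho> where "\<rho> \<zeta> = (\<chi> j. if j \<in> J then r j (\<zeta> $ j) else 0)" for \<zeta>
  define U where "U = {\<zeta>\<in>V. \<forall>j\<in>J. \<zeta> $ j \<noteq> 0}"
  have "U = V \<inter> (\<Inter>j\<in>J. {z. z $ j \<noteq> 0})" by (auto simp: U_def)
  moreover have "open (\<Inter>j\<in>J. {z :: complex ^ 'n. z $ j \<noteq> 0})"
    by (intro open_INT ballI open_Collect_neq continuous_intros) auto
  ultimately have "open U" using open_V by auto
  have zU: "z \<in> U" using z by (simp add: U_def)
  have pw: "power_map q (\<rho> \<zeta>) = proj J \<zeta>" if "\<zeta> \<in> U" for \<zeta>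
    using that r_pow q by (auto simp: vec_eq_iff \<rho>_def U_def zero_power)
  have \<rho>_mem: "\<rho> \<zeta> \<in> polydisc \<delta>\<^sub>0" if "\<zeta> \<in> U" for \<zeta>
    unfolding polydisc_iff pw[OF that] using that by (intro proj_V) (simp add: U_def)
  have SR: "S (proj J \<zeta>) = R (\<rho> \<zeta>)" if "\<zeta> \<in> U" for \<zeta>
    using S_power_map[OF \<rho>_mem[OF that]] pw[OF that] by simp
  obtain L where L: "has_strict_derivative R L (\<rho> z)"
    using C1_on_has_strict_derivative[OF C1 open_polydisc \<rho>_mem[OF zU]] by blast
  define D where "D v = (\<chi> j. if j \<in> J then v $ j / (of_nat (q j) * a $ j ^ (q j - 1)) else 0)" for v :: "complex ^ 'n"
  have D_lin: "bounded_linear D"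
    by (rule linear_conv_bounded_linear[THEN iffD1], rule linearI)
       (auto simp: D_def vec_eq_iff add_divide_distrib scaleR_conv_of_real)
  have proj_lin: "bounded_linear (proj J :: complex ^ 'n \<Rightarrow> _)"
    by (rule linear_conv_bounded_linear[THEN iffD1], rule linearI) (auto simp: vec_eq_iff)
  have "has_strict_derivative (\<lambda>z. proj J (S (proj J z))) (\<lambda>v. proj J (L (D v))) z"
    unfolding has_strict_derivative_def
  proof (intro conjI allI impI)
    have "bounded_linear L" using L by (simp add: has_strict_derivative_def)
    then show "bounded_linear (\<lambda>v. proj J (L (D v)))"
      using bounded_linear_compose[OF proj_lin bounded_linear_compose[OF _ D_lin]] by blast
    fix X v :: "nat \<Rightarrow> complex ^ 'n" and s w
    assume X: "X \<longlonglongrightarrow> z" and s: "s \<longlonglongrightarrow> (0::real)" "\<forall>k. 0 < s k" and v: "v \<longlonglongrightarrow> w"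
    have Xv: "(\<lambda>k. X k + s k *\<^sub>R v k) \<longlonglongrightarrow> z"
      using tendsto_add[OF X tendsto_scaleR[OF s(1) v]] by simp
    define w' where "w' k = (\<rho> (X k + s k *\<^sub>R v k) - \<rho> (X k)) /\<^sub>R s k" for k
    have "w' \<longlonglongrightarrow> D w"
    proof (rule vec_tendstoI)
      fix j
      show "(\<lambda>k. w' k $ j) \<longlonglongrightarrow> D w $ j"
      proof (cases "j \<in> J")
        case True
        have "(\<lambda>k. (r j (X k $ j + s k *\<^sub>R v k $ j) - r j (X k $ j)) /\<^sub>R s k)
            \<longlonglongrightarrow> w $ j / (of_nat (q j) * r j (z $ j) ^ (q j - 1))"
          by (rule root_branch_quotient[OF q z(2)[OF True] r_cont[OF True] r_pow[OF True]])
             (use s in \<open>auto intro: tendsto_vec_nth X v\<close>)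
        then show ?thesis using True by (simp add: w'_def \<rho>_def D_def r_z)
      qed (simp add: w'_def \<rho>_def D_def)
    qed
    moreover have "(\<lambda>k. \<rho> (X k)) \<longlonglongrightarrow> \<rho> z"
    proof (rule vec_tendstoI)
      show "(\<lambda>k. \<rho> (X k) $ j) \<longlonglongrightarrow> \<rho> z $ j" for j
        using isCont_tendsto_compose[OF r_cont tendsto_vec_nth[OF X]]
        by (cases "j \<in> J") (auto simp: \<rho>_def)
    qed
    ultimately have "(\<lambda>k. (R (\<rho> (X k) + s k *\<^sub>R w' k) - R (\<rho> (X k))) /\<^sub>R s k) \<longlonglongrightarrow> L (D w)"
      using s by (intro has_strict_derivativeD[OF L]) auto
    moreover have "\<rho> (X k) + s k *\<^sub>R w' k = \<rho> (X k + s k *\<^sub>R v k)" for k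
      using s(2)[rule_format, of k] by (simp add: w'_def)
    ultimately have "(\<lambda>k. proj J ((R (\<rho> (X k + s k *\<^sub>R v k)) - R (\<rho> (X k))) /\<^sub>R s k)) \<longlonglongrightarrow> proj J (L (D w))"
      by (intro bounded_linear.tendsto[OF proj_lin]) simp
    moreover have "\<forall>\<^sub>F k in sequentially. X k \<in> U" "\<forall>\<^sub>F k in sequentially. X k + s k *\<^sub>R v k \<in> U"
      using topological_tendstoD[OF X \<open>open U\<close> zU] topological_tendstoD[OF Xv \<open>open U\<close> zU] by auto
    then have "\<forall>\<^sub>F k in sequentially. proj J ((R (\<rho> (X k + s k *\<^sub>R v k)) - R (\<rho> (X k))) /\<^sub>R s k)
       = (proj J (S (proj J (X k + s k *\<^sub>R v k))) - proj J (S (proj J (X k)))) /\<^sub>R s k"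
      by eventually_elim (simp add: SR proj_diff, simp add: vec_eq_iff)
    ultimately show "(\<lambda>k. (proj J (S (proj J (X k + s k *\<^sub>R v k))) - proj J (S (proj J (X k)))) /\<^sub>R s k)
       \<longlonglongrightarrow> proj J (L (D w))"
      by (rule Lim_transform_eventually)
  qed
  then show ?thesis by blast
qed

text \<open>Smallness of \<open>R\<close> gives \<open>Re (\<zeta>\<^sub>j g\<^sub>j) \<ge> |\<zeta>\<^sub>j|\<^sup>2 / 2\<close>, the positivity used for gluing the faces.\<close>

lemma power_map_algebra:
  assumes X: "compact X" "X \<subseteq> polydisc \<delta>\<^sub>0"
    and small: "\<And>z j. z \<in> X \<Longrightarrow> cmod (R z $ j) \<le> (1/2) * cmod (z $ j) ^ q j"
    and F: "continuous_on (power_map q ` X) F"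
    and pw: "\<And>j. (\<lambda>z. z $ j ^ q j) \<in> closed_algebra X G"
    and gr: "\<And>j. (\<lambda>z. cnj (z $ j) ^ q j + R z $ j) \<in> closed_algebra X G"
  shows "(\<lambda>z. F (power_map q z)) \<in> closed_algebra X G"
proof -
  let ?Y = "power_map q ` X"
  have cont_pw: "continuous_on A (power_map q)" for A
    unfolding power_map_def by (intro continuous_intros)
  interpret stratified_graph S V ?Y c "1/2"
  proof
    show "compact ?Y" by (intro compact_continuous_image cont_pw X)
    show "?Y \<subseteq> V" using X(2) polydisc_iff by auto
    fix \<zeta> j assume "\<zeta> \<in> ?Y"
    then obtain z where z: "z \<in> X" "\<zeta> = power_map q z" by blast
    have S: "S \<zeta> = R z" using S_power_map z X(2) by auto
    have "cmod (\<zeta> $ j * S \<zeta> $ j) \<le> cmod (\<zeta> $ j) * ((1/2) * cmod (\<zeta> $ j))"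
      unfolding norm_mult S using small[OF z(1), of j] z(2)
      by (intro mult_left_mono) (auto simp: norm_power)
    moreover have "\<zeta> $ j * (cnj (\<zeta> $ j) + S \<zeta> $ j) = of_real ((cmod (\<zeta> $ j))\<^sup>2) + \<zeta> $ j * S \<zeta> $ j"
      by (simp only: complex_norm_square distrib_left)
    moreover have "- Re (\<zeta> $ j * S \<zeta> $ j) \<le> cmod (\<zeta> $ j * S \<zeta> $ j)"
      using abs_Re_le_cmod[of "\<zeta> $ j * S \<zeta> $ j"] by linarith
    ultimately show "1/2 * (cmod (\<zeta> $ j))\<^sup>2 \<le> Re (\<zeta> $ j * (cnj (\<zeta> $ j) + S \<zeta> $ j))"
      by (simp add: power2_eq_square)
  qed (use open_V c S_lip proj_V S_strict S_zero in auto)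
  show ?thesis
  proof (rule closed_algebra_pullback[OF continuous_mem[OF F]])
    fix g assume "g \<in> graph_gens S"
    then consider j where "g = (\<lambda>z. z $ j)" | j where "g = (\<lambda>z. cnj (z $ j) + S z $ j)"
      by (auto simp: graph_gens_def)
    then show "(\<lambda>z. g (power_map q z)) \<in> closed_algebra X G"
    proof cases
      case 1
      then show ?thesis using pw by simp
    next
      case (2 j)
      show ?thesis unfolding 2
        by (rule closed_algebra_cong[OF gr[of j]]) (use S_power_map X(2) in auto)
    qed
  qed auto
qed

end

section \<open>Polynomial limits\<close>

lemma holomorphic_polynomial_monomial: "holomorphic_polynomial (\<lambda>w. c * (\<Prod>i\<in>UNIV. w $ i ^ \<gamma> i))"
  unfolding holomorphic_polynomial_def by (intro exI[of _ "{\<gamma>}"] exI[of _ "\<lambda>_. c"]) simp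

lemma holomorphic_polynomial_const: "holomorphic_polynomial (\<lambda>_. c)"
  using holomorphic_polynomial_monomial[of c "\<lambda>_. 0"] by simp

lemma holomorphic_polynomial_coord: "holomorphic_polynomial (\<lambda>w. w $ i)"
proof -
  have "(\<Prod>k\<in>UNIV. w $ k ^ (if k = i then 1 else 0)) = w $ i" for w :: "complex ^ 'a"
  proof -
    have "(\<Prod>k\<in>UNIV. w $ k ^ (if k = i then 1 else 0)) = (\<Prod>k\<in>UNIV. if k = i then w $ k else 1)"
      by (intro prod.cong) auto
    then show ?thesis by simp
  qed
  then show ?thesis
    using holomorphic_polynomial_monomial[of 1 "\<lambda>k. if k = i then 1 else 0"] by simp
qed

lemma holomorphic_polynomial_add:
  assumes "holomorphic_polynomial p" "holomorphic_polynomial r"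
  shows "holomorphic_polynomial (\<lambda>w. p w + r w)"
proof -
  obtain A a where A: "finite A" "p = (\<lambda>w. \<Sum>\<alpha>\<in>A. a \<alpha> * (\<Prod>i\<in>UNIV. w $ i ^ \<alpha> i))"
    using assms(1) unfolding holomorphic_polynomial_def by blast
  obtain B b where B: "finite B" "r = (\<lambda>w. \<Sum>\<alpha>\<in>B. b \<alpha> * (\<Prod>i\<in>UNIV. w $ i ^ \<alpha> i))"
    using assms(2) unfolding holomorphic_polynomial_def by blast
  have *: "(\<Sum>\<alpha>\<in>C. d \<alpha> * (\<Prod>i\<in>UNIV. w $ i ^ \<alpha> i))
      = (\<Sum>\<alpha>\<in>A \<union> B. (if \<alpha> \<in> C then d \<alpha> else 0) * (\<Prod>i\<in>UNIV. w $ i ^ \<alpha> i))"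
    if "C \<subseteq> A \<union> B" for C d and w :: "complex ^ 'a"
    using that A(1) B(1) by (intro sum.mono_neutral_cong_left) auto
  have "p w + r w = (\<Sum>\<alpha>\<in>A \<union> B. ((if \<alpha> \<in> A then a \<alpha> else 0) + (if \<alpha> \<in> B then b \<alpha> else 0)) * (\<Prod>i\<in>UNIV. w $ i ^ \<alpha> i))" for w
    unfolding A(2) B(2) using *[of A a w] *[of B b w] by (simp add: sum.distrib distrib_right)
  then show ?thesis
    unfolding holomorphic_polynomial_def using A(1) B(1)
    by (intro exI[of _ "A \<union> B"] exI[of _ "\<lambda>\<alpha>. (if \<alpha> \<in> A then a \<alpha> else 0) + (if \<alpha> \<in> B then b \<alpha> else 0)"]) auto
qed

lemma holomorphic_polynomial_sum:
  "(\<And>k. k \<in> I \<Longrightarrow> holomorphic_polynomial (p k)) \<Longrightarrow> holomorphic_polynomial (\<lambda>w. \<Sum>k\<in>I. p k w)"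
  by (induction I rule: infinite_finite_induct)
     (auto intro: holomorphic_polynomial_const holomorphic_polynomial_add)

lemma holomorphic_polynomial_mult:
  assumes "holomorphic_polynomial p" "holomorphic_polynomial r"
  shows "holomorphic_polynomial (\<lambda>w. p w * r w)"
proof -
  obtain A a where A: "p = (\<lambda>w. \<Sum>\<alpha>\<in>A. a \<alpha> * (\<Prod>i\<in>UNIV. w $ i ^ \<alpha> i))"
    using assms(1) unfolding holomorphic_polynomial_def by blast
  obtain B b where B: "r = (\<lambda>w. \<Sum>\<alpha>\<in>B. b \<alpha> * (\<Prod>i\<in>UNIV. w $ i ^ \<alpha> i))"
    using assms(2) unfolding holomorphic_polynomial_def by blast
  have "p w * r w = (\<Sum>\<alpha>\<in>A. \<Sum>\<beta>\<in>B. (a \<alpha> * b \<beta>) * (\<Prod>i\<in>UNIV. w $ i ^ (\<alpha> i + \<beta> i)))" for w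
    unfolding A B sum_product by (simp add: power_add prod.distrib mult_ac)
  then show ?thesis
    by (simp add: holomorphic_polynomial_sum holomorphic_polynomial_monomial)
qed

lemma holomorphic_polynomial_continuous:
  "holomorphic_polynomial p \<Longrightarrow> continuous_on K p"
  unfolding holomorphic_polynomial_def by (auto intro!: continuous_intros)

lemma closed_algebra_polynomial_limit:
  fixes F :: "'a \<Rightarrow> complex ^ 'N"
  assumes f: "f \<in> closed_algebra X (range (\<lambda>i x. F x $ i))" and bd: "bounded (F ` X)"
  shows "\<exists>p. (\<forall>k. holomorphic_polynomial (p k)) \<and> uniform_limit X (\<lambda>k x. p k (F x)) f sequentially"
proof -
  define P where "P = (\<lambda>p x. p (F x)) ` Collect holomorphic_polynomial"
  have "\<exists>g\<in>P. \<forall>x\<in>X. cmod (f x - g x) < e" if "e > 0" for e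
  proof (rule closed_algebra_approx[OF f _ _ _ _ _ that])
    obtain B where B: "\<And>x. x \<in> X \<Longrightarrow> norm (F x) \<le> B" using bd unfolding bounded_iff by auto
    show "bounded (g ` X)" if g: "g \<in> range (\<lambda>i x. F x $ i)" for g
    proof -
      obtain i where "g = (\<lambda>x. F x $ i)" using g by blast
      then have "cmod (g x) \<le> B" if "x \<in> X" for x
        using B[OF that] Finite_Cartesian_Product.norm_nth_le[of "F x" i] by simp
      then show ?thesis unfolding bounded_iff by auto
    qed
    show "(\<lambda>_. a) \<in> P" for a
      using holomorphic_polynomial_const unfolding P_def by (intro image_eqI[of _ _ "\<lambda>_. a"]) auto
    show "range (\<lambda>i x. F x $ i) \<subseteq> P"
    proof
      fix g assume "g \<in> range (\<lambda>i x. F x $ i)"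
      then obtain i where "g = (\<lambda>x. F x $ i)" by blast
      then show "g \<in> P" unfolding P_def
        by (intro image_eqI[of _ _ "\<lambda>w. w $ i"]) (auto intro: holomorphic_polynomial_coord)
    qed
    show "(\<lambda>x. f x + g x) \<in> P" if fg: "f \<in> P" "g \<in> P" for f g
    proof -
      obtain p r where "f = (\<lambda>x. p (F x))" "g = (\<lambda>x. r (F x))" "holomorphic_polynomial p" "holomorphic_polynomial r"
        using fg unfolding P_def by blast
      then show ?thesis unfolding P_def
        by (intro image_eqI[of _ _ "\<lambda>w. p w + r w"]) (auto intro: holomorphic_polynomial_add)
    qed
    show "(\<lambda>x. f x * g x) \<in> P" if fg: "f \<in> P" "g \<in> P" for f g
    proof -
      obtain p r where "f = (\<lambda>x. p (F x))" "g = (\<lambda>x. r (F x))" "holomorphic_polynomial p" "holomorphic_polynomial r"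
        using fg unfolding P_def by blast
      then show ?thesis unfolding P_def
        by (intro image_eqI[of _ _ "\<lambda>w. p w * r w"]) (auto intro: holomorphic_polynomial_mult)
    qed
  qed
  then have "\<exists>p. holomorphic_polynomial p \<and> (\<forall>x\<in>X. cmod (f x - p (F x)) < inverse (real (Suc k)))" for k
    unfolding P_def by force
  then obtain p where p: "\<And>k. holomorphic_polynomial (p k)"
    "\<And>k x. x \<in> X \<Longrightarrow> cmod (f x - p k (F x)) < inverse (real (Suc k))" by metis
  have "uniform_limit X (\<lambda>k x. p k (F x)) f sequentially"
  proof (rule uniform_limitI)
    fix e :: real assume "e > 0"
    then have "\<forall>\<^sub>F k in sequentially. inverse (real (Suc k)) < e"
      using order_tendstoD(2)[OF LIMSEQ_inverse_real_of_nat] by blast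
    then show "\<forall>\<^sub>F k in sequentially. \<forall>x\<in>X. dist (p k (F x)) (f x) < e"
    proof eventually_elim
      case (elim k)
      show ?case
      proof
        fix x assume "x \<in> X"
        from p(2)[OF this, of k] elim show "dist (p k (F x)) (f x) < e"
          by (simp add: dist_norm norm_minus_commute)
      qed
    qed
  qed
  with p(1) show ?thesis by blast
qed

text \<open>The bound on the argument is chosen so that the \<open>p\<close>-th power stays in the right half plane.\<close>

lemma Ln_sector_near_1:
  assumes "p > 0"
  shows "\<exists>\<eta>>0. \<eta> \<le> 1/2 \<and> (\<forall>y. cmod (y - 1) \<le> \<eta> \<longrightarrow> \<bar>Im (Ln y)\<bar> \<le> pi / (2 * real p))"
proof -
  have "isCont Ln 1" by (intro continuous_intros) (auto simp: complex_nonpos_Reals_iff)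
  moreover have "pi / (2 * real p) > 0" using assms by simp
  ultimately obtain d where d: "d > 0" "\<And>y. dist y 1 < d \<Longrightarrow> dist (Ln y) (Ln 1) < pi / (2 * real p)"
    unfolding continuous_at_eps_delta by metis
  show ?thesis
  proof (intro exI[of _ "min (1/2) (d/2)"] conjI allI impI)
    fix y assume "cmod (y - 1) \<le> min (1/2) (d/2)"
    then have "dist y 1 < d" using d(1) by (simp add: dist_norm)
    then have "cmod (Ln y) < pi / (2 * real p)" using d(2) by (force simp: dist_norm)
    then show "\<bar>Im (Ln y)\<bar> \<le> pi / (2 * real p)" using abs_Im_le_cmod[of "Ln y"] by linarith
  qed (use d in auto)
qed

lemma eq_if_coprime_powers_eq:
  fixes x y :: complex
  assumes "x ^ p = y ^ p" "x ^ q = y ^ q" "gcd p q = 1" "p > 0" "q > 0"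
  shows "x = y"
proof (cases "y = 0")
  case True
  then show ?thesis using assms by (metis power_eq_0_iff)
next
  case False
  then have "x \<noteq> 0" using assms by (metis power_eq_0_iff)
  obtain u v where uv: "p * u = q * v + 1"
    using bezout_nat[of p q] assms by auto
  have "x ^ (p * u) = y ^ (p * u)" "x ^ (q * v) = y ^ (q * v)"
    using assms by (simp_all add: power_mult)
  then have "x * x ^ (q * v) = y * x ^ (q * v)" unfolding uv by (simp add: power_add)
  then show ?thesis using \<open>x \<noteq> 0\<close> by simp
qed

theorem theorem1p12:
  fixes m :: "'n::finite + 'n \<Rightarrow> nat"
    and \<delta>\<^sub>0 c :: real
    and R :: "complex ^ 'n \<Rightarrow> complex ^ 'n"
  assumes "\<And>i. m i > 0"
    and "\<delta>\<^sub>0 > 0"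
    and "C1_on R (polydisc \<delta>\<^sub>0)"
    and "0 < c" and "c < 1"
    and "\<And>z \<xi>. z \<in> polydisc \<delta>\<^sub>0 \<Longrightarrow> \<xi> \<in> polydisc \<delta>\<^sub>0 \<Longrightarrow>
           norm (R z - R \<xi>)
             \<le> c * sqrt (\<Sum>j\<in>UNIV. (cmod ((z $ j) ^ m (Inr j) - (\<xi> $ j) ^ m (Inr j)))\<^sup>2)"
    and "\<And>j \<epsilon>. \<epsilon> > 0 \<Longrightarrow>
           \<exists>d>0. \<forall>z\<in>polydisc \<delta>\<^sub>0. cmod (z $ j) \<le> d \<longrightarrow>
             cmod (R z $ j) \<le> \<epsilon> * cmod (z $ j) ^ m (Inr j)"
  shows "\<exists>\<delta>. 0 < \<delta> \<and> \<delta> < \<delta>\<^sub>0 \<and>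
           (let K = power_graph_map m R ` closure (polydisc \<delta>)
            in poly_limits K = cont_funs K) \<and>
           ((\<forall>i j. i \<noteq> j \<longrightarrow> gcd (m i) (m j) = 1) \<longrightarrow>
             uniform_algebra_gen (power_graph_map m R) (closure (polydisc \<delta>))
               = cont_funs (closure (polydisc \<delta>)))"
proof -
  define p where "p j = m (Inl j)" for j
  define q where "q j = m (Inr j)" for j
  have p: "p j > 0" and q: "q j > 0" for j using assms(1) by (auto simp: p_def q_def)
  interpret power_graph q \<delta>\<^sub>0 c R
  proof
    show "norm (R z - R \<xi>) \<le> c * norm (power_map q z - power_map q \<xi>)"
      if "z \<in> polydisc \<delta>\<^sub>0" "\<xi> \<in> polydisc \<delta>\<^sub>0" for z \<xi>
      using assms(6)[OF that] by (simp add: norm_vec_def L2_set_def q_def)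
    show "R z $ j = 0" if z: "z \<in> polydisc \<delta>\<^sub>0" "z $ j = 0" for z j
    proof -
      obtain d where "d > 0" "\<forall>z\<in>polydisc \<delta>\<^sub>0. cmod (z $ j) \<le> d \<longrightarrow>
          cmod (R z $ j) \<le> 1 * cmod (z $ j) ^ q j"
        using assms(7)[of 1 j] unfolding q_def by auto
      moreover have "cmod (z $ j) \<le> d" using z(2) \<open>d > 0\<close> by simp
      ultimately have "cmod (R z $ j) \<le> 1 * cmod (z $ j) ^ q j" using z(1) by blast
      then show ?thesis using z(2) q[of j] by (simp add: zero_power)
    qed
  qed (use assms q in auto)
  obtain \<eta> where \<eta>: "\<And>j. \<eta> j > (0::real)" "\<And>j. \<eta> j \<le> 1/2"
    "\<And>j y. cmod (y - 1) \<le> \<eta> j \<Longrightarrow> \<bar>Im (Ln y)\<bar> \<le> pi / (2 * real (p j))"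
    using Ln_sector_near_1[OF p] by metis
  have "\<exists>d>0. \<forall>z\<in>polydisc \<delta>\<^sub>0. cmod (z $ j) \<le> d \<longrightarrow>
      cmod (R z $ j) \<le> \<eta> j * cmod (z $ j) ^ q j" for j
    using assms(7)[OF \<eta>(1)[of j], of j] by (simp add: q_def)
  then obtain d where d: "\<And>j. d j > 0" "\<And>z j. z \<in> polydisc \<delta>\<^sub>0 \<Longrightarrow> cmod (z $ j) \<le> d j \<Longrightarrow>
      cmod (R z $ j) \<le> \<eta> j * cmod (z $ j) ^ q j"
    by metis
  \<comment> \<open>On the closed polydisc of this radius \<open>|R\<^sub>j z| \<le> \<eta>\<^sub>j * |\<zeta>\<^sub>j|\<close> for every \<open>j\<close>.\<close>
  define \<delta> where "\<delta> = min (\<delta>\<^sub>0 / 2) (Min (range d))"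
  have \<delta>: "0 < \<delta>" "\<delta> < \<delta>\<^sub>0" using \<delta>\<^sub>0 d(1) by (auto simp: \<delta>_def)
  have \<delta>_le: "\<delta> \<le> d j" for j unfolding \<delta>_def by (intro min.coboundedI2 Min_le) auto
  define X where "X = closure (polydisc \<delta> :: (complex ^ 'n) set)"
  have X_eq: "X = {z. \<forall>j. cmod (z $ j) \<le> \<delta>}" unfolding X_def by (rule closure_polydisc[OF \<delta>(1)])
  have X: "compact X" "X \<subseteq> polydisc \<delta>\<^sub>0"
  proof -
    show "compact X" unfolding X_def by (rule compact_closure_polydisc[OF \<delta>(1)])
    show "X \<subseteq> polydisc \<delta>\<^sub>0" using \<delta>(2) by (auto simp: X_eq polydisc_def intro: le_less_trans)
  qed
  have small: "cmod (R z $ j) \<le> \<eta> j * cmod (z $ j) ^ q j" if "z \<in> X" for z j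
    using that X(2) \<delta>_le[of j] by (intro d) (auto simp: X_eq intro: order_trans)
  define \<Phi> where "\<Phi> = power_graph_map m R"
  have \<Phi>_l: "\<Phi> z $ Inl j = z $ j ^ p j" and \<Phi>_r: "\<Phi> z $ Inr j = cnj (z $ j) ^ q j + R z $ j" for z j
    by (simp_all add: \<Phi>_def power_graph_map_def p_def q_def)
  define H where "H = range (\<lambda>i z. \<Phi> z $ i)"
  have gen: "(\<lambda>z. \<Phi> z $ i) \<in> closed_algebra X H" for i
    by (rule closed_algebra.gen) (auto simp: H_def)
  have R_cont: "continuous_on X R"
  proof -
    obtain R' where "\<And>z. z \<in> polydisc \<delta>\<^sub>0 \<Longrightarrow> (R has_derivative blinfun_apply (R' z)) (at z)"
      using assms(3) unfolding C1_on_def by blast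
    then show ?thesis using X(2) by (intro continuous_at_imp_continuous_on) (auto dest: has_derivative_continuous)
  qed
  have \<Phi>_cont: "continuous_on X \<Phi>"
  proof -
    have "continuous_on X (\<lambda>z. \<Phi> z $ i)" for i
      by (cases i) (auto simp: \<Phi>_l \<Phi>_r intro!: continuous_intros R_cont)
    then have "continuous_on X (\<lambda>z. \<chi> i. \<Phi> z $ i)" by (rule continuous_on_vec_lambda)
    then show ?thesis by simp
  qed
  have bd: "bounded (f ` X)" if "continuous_on X f" for f :: "complex ^ 'n \<Rightarrow> complex"
    using compact_imp_bounded[OF compact_continuous_image[OF that X(1)]] .
  have gl: "(\<lambda>z. z $ j ^ p j) \<in> closed_algebra X H" for j
    using gen[of "Inl j"] by (simp add: \<Phi>_l)
  have gr: "(\<lambda>z. cnj (z $ j) ^ q j + R z $ j) \<in> closed_algebra X H" for j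
    using gen[of "Inr j"] by (simp add: \<Phi>_r)
  have pw: "(\<lambda>z. z $ j ^ q j) \<in> closed_algebra X H" for j
  proof (rule closed_algebra_root[OF p[of j] _ gr[of j] _ _ _ \<eta>(3)])
    show "(\<lambda>z. (z $ j ^ q j) ^ p j) \<in> closed_algebra X H"
      using closed_algebra_power[OF gl[of j], of "q j"] by (simp add: power_mult[symmetric] mult.commute)
    show "bounded ((\<lambda>z. z $ j ^ q j) ` X)" "bounded ((\<lambda>z. cnj (z $ j) ^ q j + R z $ j) ` X)"
      by (intro bd continuous_intros R_cont)+
    show "\<eta> j < 1" using \<eta>(2)[of j] by simp
    fix z assume z: "z \<in> X"
    have "z $ j ^ q j * (cnj (z $ j) ^ q j + R z $ j) - of_real ((cmod (z $ j ^ q j))\<^sup>2) = z $ j ^ q j * R z $ j"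
      by (simp only: complex_norm_square complex_cnj_power) (simp add: algebra_simps)
    then have "cmod (z $ j ^ q j * (cnj (z $ j) ^ q j + R z $ j) - of_real ((cmod (z $ j ^ q j))\<^sup>2))
        = cmod (z $ j) ^ q j * cmod (R z $ j)"
      by (simp only: norm_mult norm_power)
    also have "\<dots> \<le> cmod (z $ j) ^ q j * (\<eta> j * cmod (z $ j) ^ q j)"
      using small[OF z] by (intro mult_left_mono) auto
    finally show "cmod (z $ j ^ q j * (cnj (z $ j) ^ q j + R z $ j) - of_real ((cmod (z $ j ^ q j))\<^sup>2))
        \<le> \<eta> j * (cmod (z $ j ^ q j))\<^sup>2"
      by (simp add: norm_power power2_eq_square mult_ac)
  qed
  have fun_mem: "(\<lambda>z. F (power_map q z)) \<in> closed_algebra X H" if "continuous_on (power_map q ` X) F" for F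
  proof (rule power_map_algebra[OF X _ that pw gr])
    fix z j assume "z \<in> X"
    then show "cmod (R z $ j) \<le> 1/2 * cmod (z $ j) ^ q j"
      using small[of z j] \<eta>(2)[of j] mult_right_mono[of "\<eta> j" "1/2" "cmod (z $ j) ^ q j"] by simp
  qed
  have cnj_gen: "(\<lambda>z. cnj (\<Phi> z $ i)) \<in> closed_algebra X H" for i
  proof (cases i)
    case (Inl j)
    have "(\<lambda>z. cnj (z $ j ^ p j)) \<in> closed_algebra X H"
    proof (rule conjugate_from_power[OF q[of j] gl])
      fix \<kappa> :: "complex \<Rightarrow> complex" assume "continuous_on UNIV \<kappa>"
      then have "continuous_on (power_map q ` X) (\<lambda>\<zeta>. \<kappa> (\<zeta> $ j ^ p j))"
        by (rule continuous_on_compose2) (auto intro!: continuous_intros)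
      from fun_mem[OF this] show "(\<lambda>z. \<kappa> ((z $ j ^ p j) ^ q j)) \<in> closed_algebra X H"
        by (simp add: power_mult[symmetric] mult.commute)
    qed
    then show ?thesis by (simp add: Inl \<Phi>_l)
  next
    case (Inr j)
    have V_sub: "power_map q ` X \<subseteq> V" using X(2) polydisc_iff by auto
    have "continuous_on (power_map q ` X) (\<lambda>\<zeta>. \<zeta> $ j + cnj (S \<zeta> $ j))"
    proof -
      have "continuous_on V S" by (rule lipschitz_imp_continuous_on[OF c(1) S_lip])
      then have "continuous_on (power_map q ` X) S" by (rule continuous_on_subset[OF _ V_sub])
      then show ?thesis by (intro continuous_intros)
    qed
    from fun_mem[OF this] show ?thesis
      by (rule closed_algebra_cong) (use S_power_map X(2) in \<open>auto simp: Inr \<Phi>_r\<close>)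
  qed
  have approx: "\<exists>P. (\<forall>k. holomorphic_polynomial (P k)) \<and> uniform_limit X (\<lambda>k z. P k (\<Phi> z)) (\<lambda>z. u (\<Phi> z)) sequentially"
    if "continuous_on (\<Phi> ` X) u" for u
    using closed_algebra_polynomial_limit[of "\<lambda>z. u (\<Phi> z)" X \<Phi>]
      complex_Stone_Weierstrass_quotient[OF X(1) \<Phi>_cont gen cnj_gen that]
      compact_imp_bounded[OF compact_continuous_image[OF \<Phi>_cont X(1)]]
    by (simp add: H_def)
  have part1: "poly_limits (\<Phi> ` X) = cont_funs (\<Phi> ` X)"
  proof (intro equalityI subsetI)
    fix u assume "u \<in> poly_limits (\<Phi> ` X)"
    then obtain P where P: "\<forall>k. holomorphic_polynomial (P k)" "uniform_limit (\<Phi> ` X) P u sequentially"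
      unfolding poly_limits_def by blast
    then show "u \<in> cont_funs (\<Phi> ` X)"
      unfolding cont_funs_def mem_Collect_eq
      by (intro uniform_limit_theorem[OF _ P(2) trivial_limit_sequentially])
         (auto intro!: always_eventually holomorphic_polynomial_continuous)
  next
    fix u assume "u \<in> cont_funs (\<Phi> ` X)"
    then obtain P where P: "\<forall>k. holomorphic_polynomial (P k)"
      "uniform_limit X (\<lambda>k z. P k (\<Phi> z)) (\<lambda>z. u (\<Phi> z)) sequentially"
      using approx unfolding cont_funs_def by blast
    then show "u \<in> poly_limits (\<Phi> ` X)"
      unfolding poly_limits_def uniform_limit_iff by auto
  qed
  have part2: "uniform_algebra_gen \<Phi> X = cont_funs X" if cop: "\<forall>i j. i \<noteq> j \<longrightarrow> gcd (m i) (m j) = 1"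
  proof (intro equalityI subsetI)
    fix F assume F: "F \<in> cont_funs X"
    have inj: "inj_on \<Phi> X"
    proof (rule inj_onI)
      fix z w assume zw: "z \<in> X" "w \<in> X" "\<Phi> z = \<Phi> w"
      \<comment> \<open>Equal last components make the increment of \<open>R\<close> as large as that of \<open>\<zeta>\<close>, against \<open>c < 1\<close>.\<close>
      have "norm (R z - R w) = norm (power_map q z - power_map q w)"
      proof -
        have "R z - R w = (\<chi> j. cnj ((power_map q w - power_map q z) $ j))"
        proof (simp add: vec_eq_iff, intro allI)
          fix j
          have "\<Phi> z $ Inr j = \<Phi> w $ Inr j" using zw(3) by simp
          then show "R z $ j - R w $ j = cnj (w $ j) ^ q j - cnj (z $ j) ^ q j"
            unfolding \<Phi>_r by (simp add: algebra_simps)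
        qed
        then have "norm (R z - R w) = norm (power_map q w - power_map q z)"
          by (simp add: norm_vec_def del: power_map_nth vector_minus_component)
        then show ?thesis by (simp add: norm_minus_commute)
      qed
      moreover have "norm (R z - R w) \<le> c * norm (power_map q z - power_map q w)"
        using lipR zw X(2) by blast
      ultimately have "(1 - c) * norm (power_map q z - power_map q w) \<le> 0" by (simp add: algebra_simps)
      then have "norm (power_map q z - power_map q w) = 0"
        using c by (simp add: mult_le_0_iff)
      then have q_eq: "z $ j ^ q j = w $ j ^ q j" for j by (simp add: vec_eq_iff)
      have "z $ j = w $ j" for j
      proof (rule eq_if_coprime_powers_eq[OF _ q_eq _ p q])
        have "\<Phi> z $ Inl j = \<Phi> w $ Inl j" using zw(3) by simp
        then show "z $ j ^ p j = w $ j ^ p j" by (simp add: \<Phi>_l)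
        show "gcd (p j) (q j) = 1" using cop by (simp add: p_def q_def)
      qed
      then show "z = w" by (simp add: vec_eq_iff)
    qed
    have F_cont: "continuous_on X F" using F by (simp add: cont_funs_def)
    have inv: "continuous_on (\<Phi> ` X) (inv_into X \<Phi>)"
      using inj by (intro continuous_on_inv[OF \<Phi>_cont X(1)]) auto
    have "continuous_on (\<Phi> ` X) (\<lambda>w. F (inv_into X \<Phi> w))"
      by (rule continuous_on_compose2[OF F_cont inv]) (auto intro: inv_into_into)
    from approx[OF this] obtain P where P: "\<forall>k. holomorphic_polynomial (P k)"
      "uniform_limit X (\<lambda>k z. P k (\<Phi> z)) (\<lambda>z. F (inv_into X \<Phi> (\<Phi> z))) sequentially" by blast
    have "uniform_limit X (\<lambda>k z. P k (\<Phi> z)) F sequentially"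
      using P(2) inj by (simp cong: uniform_limit_cong')
    with P(1) F show "F \<in> uniform_algebra_gen \<Phi> X"
      unfolding uniform_algebra_gen_def by blast
  qed (simp add: uniform_algebra_gen_def)
  show ?thesis
    using \<delta> part1 part2 unfolding \<Phi>_def X_def Let_def by blast
qed

end
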